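(* Let $k\in\mathbb{N}$ and let $\Lambda$ be a $k$-graph. For every left $\Lambda$-module $\mathcal{N}$, every right $\Lambda$-module $\mathcal{M}$ and all $n$, the cubical and categorical (co-)homology groups of $\Lambda$ are isomorphic: \[ H_n^{\mathrm{cub}}(\Lambda,\mathcal{N})\cong H_n(\Lambda,\mathcal{N})\qquad\text{and}\qquad H^n_{\mathrm{cub}}(\Lambda,\mathcal{M})\cong H^n(\Lambda,\mathcal{M}). \]
   Context: $\mathbb{N}$ includes $0$; $e_1,\dots,e_k$ are the canonical generators of $\mathbb{N}^k$. **k-graphs.** A $k$-graph is a countable small category $\Lambda$ with a functor $d\colon\Lambda\to\mathbb{N}^k$ ($\mathbb{N}^k$ being a one-object category under addition) with the factorization property: if $d(\lambda)=m+n$ there are unique morphisms $\mu,\nu$ with $d(\mu)=m$, $d(\nu)=n$, $\lambda=\mu\nu$. Here $\mu\nu$ is defined iff $s(\mu)=r(\nu)$ ($s$ = source, $r$ = range). $\lambda\in\Lambda$ means $\lambda$ is a morphism; objects are identified with identity morphisms, which are exactly the morphisms of degree $0$ (vertices). $d_i(\lambda)$ is the $i$-th coordinate of $d(\lambda)$. For $0\le m\le n\le d(\lambda)$ (coordinatewise), $\lambda(m,n)$ is the unique morphism of degree $n-m$ with $\lambda=\lambda'\lambda(m,n)\lambda''$, $d(\lambda')=m$. **Modules.** A right (left) $\Lambda$-module is a contravariant (covariant) functor from $\Lambda$ to abelian groups; the action of $\lambda$ is written $m\cdot\lambda$ for $m\in\mathcal{M}(r(\lambda))$ (resp. $\lambda\cdot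 a$ for $a\in\mathcal{N}(s(\lambda))$). Module maps are natural transformations and form the group $\mathrm{Hom}_\Lambda$; exactness and surjectivity are objectwise; a module $\mathcal{P}$ is projective if every surjective module map onto $\mathcal{P}$ has a right inverse module map. $\mathcal{M}\otimes_\Lambda\mathcal{N}$ is the abelian group generated by $m\otimes a$ with $m\in\mathcal{M}(v)$, $a\in\mathcal{N}(v)$, $v$ an object, subject to biadditivity and $(m\cdot\lambda)\otimes a=m\otimes(\lambda\cdot a)$. $\mathbb{Z}^\Lambda$ is the constant right module with value $\mathbb{Z}$ and all morphisms acting as the identity. **Categorical (co-)homology.** Choose a projective resolution $\cdots\to\mathcal{R}_1\to\mathcal{R}_0\to\mathbb{Z}^\Lambda\to0$ of right $\Lambda$-modules. $H^n(\Lambda,\mathcal{M})$ is the $n$-th cohomology of the cochain complex $\mathrm{Hom}_\Lambda(\mathcal{R}_*,\mathcal{M})$, and $H_n(\Lambda,\mathcal{N})$ is the $n$-th homology of $\mathcal{R}_*\otimes_\Lambda\mathcal{N}$ (the term $\mathbb{Z}^\Lambda$ is dropped). These do not depend on the choice of resolution up to isomorphism. **Cubical (co-)homology.** For $n\in\mathbb{N}$, $Q_n(\Lambda)=\{\eta\in\Lambda:\sum_i d_i(\eta)=n,\ d_i(\eta)\in\{0,1\}\text{ for all }i\}$; $Q_n(\Lambda)=\varnothing$ for $n<0$. For $\lambda\in Q_n(\Lambda)$ with $d(\lambda)=\sum_{j=1}^n e_{c_j}$, $c_1<\dots<c_n$, put $F^0_j(\lambda)=\lambda(0,d(\lambda)-e_{c_j})$,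 $F^1_j(\lambda)=\lambda(e_{c_j},d(\lambda))$, $S_j(\lambda)=\lambda(d(\lambda)-e_{c_j},d(\lambda))$. $H_n^{\mathrm{cub}}(\Lambda,\mathcal{N})$ is the homology of the chain complex $C_n^{\mathrm{cub}}(\Lambda,\mathcal{N})=\bigoplus_{\lambda\in Q_n(\Lambda)}\mathcal{N}(s(\lambda))$ (generated by pairs $(\lambda,a)$, $a\in\mathcal{N}(s(\lambda))$) with boundary \[(\lambda,a)\mapsto\sum_{i=1}^n(-1)^i\big((F_i^0(\lambda),S_i(\lambda)\cdot a)-(F_i^1(\lambda),a)\big).\] $H^n_{\mathrm{cub}}(\Lambda,\mathcal{M})$ is the cohomology of the cochain complex $C^n_{\mathrm{cub}}(\Lambda,\mathcal{M})=\prod_{\lambda\in Q_n(\Lambda)}\mathcal{M}(s(\lambda))$ with \[\delta_{n-1}(f)(\lambda)=\sum_{i=1}^n(-1)^i\big(f(F_i^0(\lambda))\cdot S_i(\lambda)-f(F_i^1(\lambda))\big),\quad \lambda\in Q_n(\Lambda).\] Both complexes are zero in negative degrees. *)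

theory Defs
  imports "HOL-Algebra.Free_Abelian_Groups" "HOL-Library.Function_Algebras"
begin

section \<open>Higher-rank graphs\<close>

text \<open>
  Small categories are single-sorted: an object is identified with its identity morphism, so
  source and range are maps from morphisms to morphisms.  The product \<open>Cmp \<Lambda> \<mu> \<nu>\<close> is
  meaningful only if \<open>Src \<Lambda> \<mu> = Rng \<Lambda> \<nu>\<close>.
\<close>

record 'l cat =
  Mor :: "'l set"
  Src :: "'l \<Rightarrow> 'l"
  Rng :: "'l \<Rightarrow> 'l"
  Cmp :: "'l \<Rightarrow> 'l \<Rightarrow> 'l"

record 'l kgraph = "'l cat" +
  deg :: "'l \<Rightarrow> nat \<Rightarrow> nat"

definition Obj :: "('l, 'z) cat_scheme \<Rightarrow> 'l set"
  where "Obj \<Lambda> = {v \<in> Mor \<Lambda>. Src \<Lambda> v = v}"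

locale small_category =
  fixes \<Lambda> :: "('l, 'z) cat_scheme"
  assumes Src_Obj: "\<mu> \<in> Mor \<Lambda> \<Longrightarrow> Src \<Lambda> \<mu> \<in> Obj \<Lambda>"
    and Rng_Obj: "\<mu> \<in> Mor \<Lambda> \<Longrightarrow> Rng \<Lambda> \<mu> \<in> Obj \<Lambda>"
    and Rng_id: "v \<in> Obj \<Lambda> \<Longrightarrow> Rng \<Lambda> v = v"
    and Cmp_closed: "\<lbrakk>\<mu> \<in> Mor \<Lambda>; \<nu> \<in> Mor \<Lambda>; Src \<Lambda> \<mu> = Rng \<Lambda> \<nu>\<rbrakk> \<Longrightarrow> Cmp \<Lambda> \<mu> \<nu> \<in> Mor \<Lambda>"
    and Src_Cmp: "\<lbrakk>\<mu> \<in> Mor \<Lambda>; \<nu> \<in> Mor \<Lambda>; Src \<Lambda> \<mu> = Rng \<Lambda> \<nu>\<rbrakk> \<Longrightarrow> Src \<Lambda> (Cmp \<Lambda> \<mu> \<nu>) = Src \<Lambda> \<nu>"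
    and Rng_Cmp: "\<lbrakk>\<mu> \<in> Mor \<Lambda>; \<nu> \<in> Mor \<Lambda>; Src \<Lambda> \<mu> = Rng \<Lambda> \<nu>\<rbrakk> \<Longrightarrow> Rng \<Lambda> (Cmp \<Lambda> \<mu> \<nu>) = Rng \<Lambda> \<mu>"
    and Cmp_id_left: "\<mu> \<in> Mor \<Lambda> \<Longrightarrow> Cmp \<Lambda> (Rng \<Lambda> \<mu>) \<mu> = \<mu>"
    and Cmp_id_right: "\<mu> \<in> Mor \<Lambda> \<Longrightarrow> Cmp \<Lambda> \<mu> (Src \<Lambda> \<mu>) = \<mu>"
    and Cmp_assoc: "\<lbrakk>\<mu> \<in> Mor \<Lambda>; \<nu> \<in> Mor \<Lambda>; \<xi> \<in> Mor \<Lambda>; Src \<Lambda> \<mu> = Rng \<Lambda> \<nu>; Src \<Lambda> \<nu> = Rng \<Lambda> \<xi>\<rbrakk>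
      \<Longrightarrow> Cmp \<Lambda> (Cmp \<Lambda> \<mu> \<nu>) \<xi> = Cmp \<Lambda> \<mu> (Cmp \<Lambda> \<nu> \<xi>)"

text \<open>
  The monoid of \<open>k\<close>-tuples of natural numbers (\<open>k = 0\<close> allowed): functions supported on
  \<open>{0, \<dots>, k - 1}\<close>, with pointwise \<open>+\<close>, \<open>-\<close> and \<open>0\<close>.  Coordinates are thus numbered from \<open>0\<close>.
\<close>

definition Nk :: "nat \<Rightarrow> (nat \<Rightarrow> nat) set"
  where "Nk k = {m. \<forall>i\<ge>k. m i = 0}"

definition unit_deg :: "nat \<Rightarrow> nat \<Rightarrow> nat"
  where "unit_deg i = (\<lambda>j. if j = i then 1 else 0)"

locale k_graph = small_category \<Lambda>
  for k :: nat and \<Lambda> :: "('l, 'z) kgraph_scheme" +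
  assumes countable_Mor: "countable (Mor \<Lambda>)"
    and deg_Nk: "\<mu> \<in> Mor \<Lambda> \<Longrightarrow> deg \<Lambda> \<mu> \<in> Nk k"
    and deg_Obj: "v \<in> Obj \<Lambda> \<Longrightarrow> deg \<Lambda> v = 0"
    and deg_Cmp: "\<lbrakk>\<mu> \<in> Mor \<Lambda>; \<nu> \<in> Mor \<Lambda>; Src \<Lambda> \<mu> = Rng \<Lambda> \<nu>\<rbrakk>
      \<Longrightarrow> deg \<Lambda> (Cmp \<Lambda> \<mu> \<nu>) = deg \<Lambda> \<mu> + deg \<Lambda> \<nu>"
    and factorization: "\<lbrakk>\<xi> \<in> Mor \<Lambda>; m \<in> Nk k; n \<in> Nk k; deg \<Lambda> \<xi> = m + n\<rbrakk>
      \<Longrightarrow> \<exists>!(\<mu>, \<nu>). \<mu> \<in> Mor \<Lambda> \<and> \<nu> \<in> Mor \<Lambda> \<and> Src \<Lambda> \<mu> = Rng \<Lambda> \<nu> \<and>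
            deg \<Lambda> \<mu> = m \<and> deg \<Lambda> \<nu> = n \<and> \<xi> = Cmp \<Lambda> \<mu> \<nu>"

definition seg :: "('l, 'z) kgraph_scheme \<Rightarrow> 'l \<Rightarrow> (nat \<Rightarrow> nat) \<Rightarrow> (nat \<Rightarrow> nat) \<Rightarrow> 'l"
  where "seg \<Lambda> \<xi> m n = (THE \<mu>. \<mu> \<in> Mor \<Lambda> \<and> deg \<Lambda> \<mu> = n - m \<and>
    (\<exists>\<alpha>\<in>Mor \<Lambda>. \<exists>\<beta>\<in>Mor \<Lambda>. Src \<Lambda> \<alpha> = Rng \<Lambda> \<mu> \<and> Src \<Lambda> \<mu> = Rng \<Lambda> \<beta> \<and>
      deg \<Lambda> \<alpha> = m \<and> \<xi> = Cmp \<Lambda> (Cmp \<Lambda> \<alpha> \<mu>) \<beta>))"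


section \<open>Modules over a small category\<close>

text \<open>
  Both left and right modules assign to each object an abelian group (written multiplicatively,
  as in \<open>HOL-Algebra\<close>) and to each morphism an action map; they differ in its direction.
\<close>

record ('l, 'a) cmodule =
  Grp :: "'l \<Rightarrow> 'a monoid"
  Act :: "'l \<Rightarrow> 'a \<Rightarrow> 'a"

definition right_module :: "('l, 'z) cat_scheme \<Rightarrow> ('l, 'a) cmodule \<Rightarrow> bool"
  where "right_module \<Lambda> M \<longleftrightarrow>
    (\<forall>v\<in>Obj \<Lambda>. comm_group (Grp M v)) \<and>
    (\<forall>\<mu>\<in>Mor \<Lambda>. Act M \<mu> \<in> hom (Grp M (Rng \<Lambda> \<mu>)) (Grp M (Src \<Lambda> \<mu>))) \<and>
    (\<forall>v\<in>Obj \<Lambda>. \<forall>x\<in>carrier (Grp M v). Act M v x = x) \<and>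
    (\<forall>\<mu>\<in>Mor \<Lambda>. \<forall>\<nu>\<in>Mor \<Lambda>. Src \<Lambda> \<mu> = Rng \<Lambda> \<nu> \<longrightarrow>
      (\<forall>x\<in>carrier (Grp M (Rng \<Lambda> \<mu>)). Act M (Cmp \<Lambda> \<mu> \<nu>) x = Act M \<nu> (Act M \<mu> x)))"

definition left_module :: "('l, 'z) cat_scheme \<Rightarrow> ('l, 'a) cmodule \<Rightarrow> bool"
  where "left_module \<Lambda> N \<longleftrightarrow>
    (\<forall>v\<in>Obj \<Lambda>. comm_group (Grp N v)) \<and>
    (\<forall>\<mu>\<in>Mor \<Lambda>. Act N \<mu> \<in> hom (Grp N (Src \<Lambda> \<mu>)) (Grp N (Rng \<Lambda> \<mu>))) \<and>
    (\<forall>v\<in>Obj \<Lambda>. \<forall>a\<in>carrier (Grp N v). Act N v a = a) \<and>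
    (\<forall>\<mu>\<in>Mor \<Lambda>. \<forall>\<nu>\<in>Mor \<Lambda>. Src \<Lambda> \<mu> = Rng \<Lambda> \<nu> \<longrightarrow>
      (\<forall>a\<in>carrier (Grp N (Src \<Lambda> \<nu>)). Act N (Cmp \<Lambda> \<mu> \<nu>) a = Act N \<mu> (Act N \<nu> a)))"

text \<open>Maps of right modules.\<close>

definition module_map ::
    "('l, 'z) cat_scheme \<Rightarrow> ('l, 'a) cmodule \<Rightarrow> ('l, 'b) cmodule \<Rightarrow> ('l \<Rightarrow> 'a \<Rightarrow> 'b) \<Rightarrow> bool"
  where "module_map \<Lambda> M M' \<phi> \<longleftrightarrow>
    (\<forall>v\<in>Obj \<Lambda>. \<phi> v \<in> hom (Grp M v) (Grp M' v)) \<and>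
    (\<forall>\<mu>\<in>Mor \<Lambda>. \<forall>x\<in>carrier (Grp M (Rng \<Lambda> \<mu>)).
      \<phi> (Src \<Lambda> \<mu>) (Act M \<mu> x) = Act M' \<mu> (\<phi> (Rng \<Lambda> \<mu>) x))"

definition surj_module_map ::
    "('l, 'z) cat_scheme \<Rightarrow> ('l, 'a) cmodule \<Rightarrow> ('l, 'b) cmodule \<Rightarrow> ('l \<Rightarrow> 'a \<Rightarrow> 'b) \<Rightarrow> bool"
  where "surj_module_map \<Lambda> M M' \<phi> \<longleftrightarrow>
    module_map \<Lambda> M M' \<phi> \<and> (\<forall>v\<in>Obj \<Lambda>. \<phi> v ` carrier (Grp M v) = carrier (Grp M' v))"

definition const_int_module :: "('l, int) cmodule"
  where "const_int_module = \<lparr>Grp = (\<lambda>v. integer_group), Act = (\<lambda>\<mu> x. x)\<rparr>"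

text \<open>
  HOL cannot quantify over types inside a definition, so the modules \<open>Q\<close> mapping onto \<open>P\<close>
  have their elements in a fixed type.  It is the type of the free cover of \<open>P\<close>, the module with
  a generator at \<open>Src \<Lambda> \<mu>\<close> for each morphism \<open>\<mu>\<close> and each element of \<open>P\<close> at \<open>Rng \<Lambda> \<mu>\<close>.
  Nothing is lost: since the free cover of \<open>P\<close> splits, surjections onto \<open>P\<close> from modules in any
  other type split as well, as shown by \<open>projective_splits\<close> below.
\<close>

definition projective :: "('l, 'z) cat_scheme \<Rightarrow> ('l, 'p) cmodule \<Rightarrow> bool"
  where "projective \<Lambda> P \<longleftrightarrow> right_module \<Lambda> P \<and>
    (\<forall>(Q :: ('l, ('l \<times> 'p) \<Rightarrow>\<^sub>0 int) cmodule) \<pi>. right_module \<Lambda> Q \<longrightarrow> surj_module_map \<Lambda> Q P \<pi> \<longrightarrow>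
      (\<exists>\<sigma>. module_map \<Lambda> P Q \<sigma> \<and> (\<forall>v\<in>Obj \<Lambda>. \<forall>x\<in>carrier (Grp P v). \<pi> v (\<sigma> v x) = x)))"

subsection \<open>Projectivity against modules in an arbitrary type\<close>

lemma hom_free_Abelian_group_eqI:
  assumes G: "group G"
    and h: "h \<in> hom (free_Abelian_group S) G" and h': "h' \<in> hom (free_Abelian_group S) G"
    and eq: "\<And>x. x \<in> S \<Longrightarrow> h (frag_of x) = h' (frag_of x)"
    and c: "c \<in> carrier (free_Abelian_group S)"
  shows "h c = h' c"
proof -
  interpret a: group_hom "free_Abelian_group S" G h
    using G h by (simp add: group_hom_def group_hom_axioms_def)
  interpret b: group_hom "free_Abelian_group S" G h'
    using G h' by (simp add: group_hom_def group_hom_axioms_def)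
  have keys: "Poly_Mapping.keys c \<subseteq> S" using c by simp
  show ?thesis
  proof (rule free_Abelian_group_induct[OF keys, where P = "\<lambda>c. h c = h' c"])
    show "h 0 = h' 0" using a.hom_one b.hom_one by simp
  next
    show "h (frag_of x) = h' (frag_of x)" if "x \<in> S" for x using that by (rule eq)
  next
    fix x y
    assume x: "Poly_Mapping.keys x \<subseteq> S" and y: "Poly_Mapping.keys y \<subseteq> S"
      and IH: "h x = h' x" "h y = h' y"
    from y have y': "Poly_Mapping.keys (- y) \<subseteq> S" by simp
    have "h (x + - y) = h x \<otimes>\<^bsub>G\<^esub> inv\<^bsub>G\<^esub> (h y)"
      using a.hom_mult[of x "- y"] a.hom_inv[of y] x y y' by simp
    moreover have "h' (x + - y) = h' x \<otimes>\<^bsub>G\<^esub> inv\<^bsub>G\<^esub> (h' y)"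
      using b.hom_mult[of x "- y"] b.hom_inv[of y] x y y' by simp
    ultimately show "h (x - y) = h' (x - y)" using IH by simp
  qed
qed

definition free_cover_gens :: "('l, 'z) cat_scheme \<Rightarrow> ('l, 'p) cmodule \<Rightarrow> 'l \<Rightarrow> ('l \<times> 'p) set"
  where "free_cover_gens \<Lambda> P v = {(\<mu>, p). \<mu> \<in> Mor \<Lambda> \<and> Src \<Lambda> \<mu> = v \<and> p \<in> carrier (Grp P (Rng \<Lambda> \<mu>))}"

definition free_cover :: "('l, 'z) cat_scheme \<Rightarrow> ('l, 'p) cmodule \<Rightarrow> ('l, ('l \<times> 'p) \<Rightarrow>\<^sub>0 int) cmodule"
  where "free_cover \<Lambda> P =
    \<lparr>Grp = (\<lambda>v. free_Abelian_group (free_cover_gens \<Lambda> P v)),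
     Act = (\<lambda>\<nu>. frag_extend (\<lambda>(\<mu>, p). frag_of (Cmp \<Lambda> \<mu> \<nu>, p)))\<rparr>"

lemma frag_extend_hom_free:
  assumes "\<And>x. x \<in> S \<Longrightarrow> Poly_Mapping.keys (f x) \<subseteq> T"
  shows "frag_extend f \<in> hom (free_Abelian_group S) (free_Abelian_group T)"
proof (rule homI)
  fix c assume "c \<in> carrier (free_Abelian_group S)"
  then show "frag_extend f c \<in> carrier (free_Abelian_group T)"
    using keys_frag_extend[of f c] assms by auto
qed (simp add: frag_extend_add)

context small_category
begin

lemma Src_Mor: "\<mu> \<in> Mor \<Lambda> \<Longrightarrow> Src \<Lambda> \<mu> \<in> Mor \<Lambda>"
  and Rng_Mor: "\<mu> \<in> Mor \<Lambda> \<Longrightarrow> Rng \<Lambda> \<mu> \<in> Mor \<Lambda>"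
  and Obj_Mor: "v \<in> Obj \<Lambda> \<Longrightarrow> v \<in> Mor \<Lambda>"
  and Src_id: "v \<in> Obj \<Lambda> \<Longrightarrow> Src \<Lambda> v = v"
  using Src_Obj Rng_Obj by (auto simp: Obj_def)

lemma free_cover_Act_hom:
  assumes "\<nu> \<in> Mor \<Lambda>"
  shows "Act (free_cover \<Lambda> P) \<nu> \<in>
    hom (Grp (free_cover \<Lambda> P) (Rng \<Lambda> \<nu>)) (Grp (free_cover \<Lambda> P) (Src \<Lambda> \<nu>))"
  using assms unfolding free_cover_def
  by (auto intro!: frag_extend_hom_free simp: free_cover_gens_def Cmp_closed Src_Cmp Rng_Cmp)

lemma right_module_free_cover: "right_module \<Lambda> (free_cover \<Lambda> P)"
  unfolding right_module_def
proof (intro conjI ballI impI)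
  let ?F = "free_cover \<Lambda> P"
  show "comm_group (Grp ?F v)" for v
    by (simp add: free_cover_def abelian_free_Abelian_group)
  show hom: "Act ?F \<nu> \<in> hom (Grp ?F (Rng \<Lambda> \<nu>)) (Grp ?F (Src \<Lambda> \<nu>))" if "\<nu> \<in> Mor \<Lambda>" for \<nu>
    by (rule free_cover_Act_hom[OF that])
  show "Act ?F v x = x" if v: "v \<in> Obj \<Lambda>" and x: "x \<in> carrier (Grp ?F v)" for v x
  proof -
    have "Act ?F v x = id x"
    proof (rule hom_free_Abelian_group_eqI[where h = "Act ?F v" and h' = id])
      show "group (Grp ?F v)" by (simp add: free_cover_def)
      show "Act ?F v \<in> hom (free_Abelian_group (free_cover_gens \<Lambda> P v)) (Grp ?F v)"
        using free_cover_Act_hom[OF Obj_Mor[OF v], of P] v by (simp add: Rng_id Src_id free_cover_def)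
      show "id \<in> hom (free_Abelian_group (free_cover_gens \<Lambda> P v)) (Grp ?F v)"
        by (auto simp: free_cover_def hom_def)
      show "Act ?F v (frag_of y) = id (frag_of y)" if "y \<in> free_cover_gens \<Lambda> P v" for y
        using that by (auto simp: free_cover_def free_cover_gens_def Cmp_id_right)
      show "x \<in> carrier (free_Abelian_group (free_cover_gens \<Lambda> P v))"
        using x by (simp add: free_cover_def)
    qed
    then show ?thesis by simp
  qed
  show "Act ?F (Cmp \<Lambda> \<mu> \<nu>) x = Act ?F \<nu> (Act ?F \<mu> x)"
    if \<mu>: "\<mu> \<in> Mor \<Lambda>" and \<nu>: "\<nu> \<in> Mor \<Lambda>" and c: "Src \<Lambda> \<mu> = Rng \<Lambda> \<nu>"
      and x: "x \<in> carrier (Grp ?F (Rng \<Lambda> \<mu>))" for \<mu> \<nu> x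
  proof -
    have "Act ?F (Cmp \<Lambda> \<mu> \<nu>) x = (Act ?F \<nu> \<circ> Act ?F \<mu>) x"
    proof (rule hom_free_Abelian_group_eqI[where h = "Act ?F (Cmp \<Lambda> \<mu> \<nu>)" and h' = "Act ?F \<nu> \<circ> Act ?F \<mu>"])
      show "group (Grp ?F (Src \<Lambda> \<nu>))" by (simp add: free_cover_def)
      show "Act ?F (Cmp \<Lambda> \<mu> \<nu>) \<in> hom (free_Abelian_group (free_cover_gens \<Lambda> P (Rng \<Lambda> \<mu>))) (Grp ?F (Src \<Lambda> \<nu>))"
        using free_cover_Act_hom[OF Cmp_closed[OF \<mu> \<nu> c], of P]
        by (simp add: Rng_Cmp[OF \<mu> \<nu> c] Src_Cmp[OF \<mu> \<nu> c] free_cover_def)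
      show "Act ?F \<nu> \<circ> Act ?F \<mu> \<in> hom (free_Abelian_group (free_cover_gens \<Lambda> P (Rng \<Lambda> \<mu>))) (Grp ?F (Src \<Lambda> \<nu>))"
        using hom_compose[OF free_cover_Act_hom[OF \<mu>] free_cover_Act_hom[OF \<nu>, of P, folded c]]
        by (simp add: free_cover_def)
      show "Act ?F (Cmp \<Lambda> \<mu> \<nu>) (frag_of y) = (Act ?F \<nu> \<circ> Act ?F \<mu>) (frag_of y)"
        if "y \<in> free_cover_gens \<Lambda> P (Rng \<Lambda> \<mu>)" for y
        using that \<mu> \<nu> c by (auto simp: free_cover_def free_cover_gens_def Cmp_assoc)
      show "x \<in> carrier (free_Abelian_group (free_cover_gens \<Lambda> P (Rng \<Lambda> \<mu>)))"
        using x by (simp add: free_cover_def)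
    qed
    then show ?thesis by simp
  qed
qed

lemma free_cover_universal:
  assumes M: "right_module \<Lambda> M"
    and g: "\<And>v p. \<lbrakk>v \<in> Obj \<Lambda>; p \<in> carrier (Grp P v)\<rbrakk> \<Longrightarrow> g v p \<in> carrier (Grp M v)"
  shows "\<exists>\<phi>. module_map \<Lambda> (free_cover \<Lambda> P) M \<phi> \<and>
    (\<forall>v\<in>Obj \<Lambda>. \<forall>\<mu> p. (\<mu>, p) \<in> free_cover_gens \<Lambda> P v \<longrightarrow> \<phi> v (frag_of (\<mu>, p)) = Act M \<mu> (g (Rng \<Lambda> \<mu>) p))"
proof -
  let ?F = "free_cover \<Lambda> P"
  let ?g = "\<lambda>x. Act M (fst x) (g (Rng \<Lambda> (fst x)) (snd x))"
  have act: "Act M \<mu> \<in> hom (Grp M (Rng \<Lambda> \<mu>)) (Grp M (Src \<Lambda> \<mu>))" if "\<mu> \<in> Mor \<Lambda>" for \<mu>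
    using M that by (auto simp: right_module_def)
  have gM: "?g x \<in> carrier (Grp M v)" if "x \<in> free_cover_gens \<Lambda> P v" for x v
    using that g Rng_Obj by (auto simp: free_cover_gens_def intro!: hom_in_carrier[OF act])
  have "\<exists>h. h \<in> hom (Grp ?F v) (Grp M v) \<and> (\<forall>x\<in>free_cover_gens \<Lambda> P v. h (frag_of x) = ?g x)"
    if v: "v \<in> Obj \<Lambda>" for v
  proof -
    interpret comm_group "Grp M v" using M v by (simp add: right_module_def)
    have "?g ` free_cover_gens \<Lambda> P v \<subseteq> carrier (Grp M v)" using gM by blast
    from free_Abelian_group_universal[OF this] show ?thesis
      by (simp add: free_cover_def) metis
  qed
  then obtain \<phi> where \<phi>: "\<And>v. v \<in> Obj \<Lambda> \<Longrightarrow> \<phi> v \<in> hom (Grp ?F v) (Grp M v)"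
    and \<phi>g: "\<And>v x. \<lbrakk>v \<in> Obj \<Lambda>; x \<in> free_cover_gens \<Lambda> P v\<rbrakk> \<Longrightarrow> \<phi> v (frag_of x) = ?g x"
    by metis
  have "\<phi> (Src \<Lambda> \<nu>) (Act ?F \<nu> x) = Act M \<nu> (\<phi> (Rng \<Lambda> \<nu>) x)"
    if \<nu>: "\<nu> \<in> Mor \<Lambda>" and x: "x \<in> carrier (Grp ?F (Rng \<Lambda> \<nu>))" for \<nu> x
  proof -
    let ?S = "free_cover_gens \<Lambda> P (Rng \<Lambda> \<nu>)"
    have "(\<phi> (Src \<Lambda> \<nu>) \<circ> Act ?F \<nu>) x = (Act M \<nu> \<circ> \<phi> (Rng \<Lambda> \<nu>)) x"
    proof (rule hom_free_Abelian_group_eqI)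
      show "group (Grp M (Src \<Lambda> \<nu>))"
        using M Src_Obj[OF \<nu>] by (auto simp: right_module_def comm_group_def)
      show "\<phi> (Src \<Lambda> \<nu>) \<circ> Act ?F \<nu> \<in> hom (free_Abelian_group ?S) (Grp M (Src \<Lambda> \<nu>))"
        using hom_compose[OF free_cover_Act_hom[OF \<nu>] \<phi>[OF Src_Obj[OF \<nu>]]] by (simp add: free_cover_def)
      show "Act M \<nu> \<circ> \<phi> (Rng \<Lambda> \<nu>) \<in> hom (free_Abelian_group ?S) (Grp M (Src \<Lambda> \<nu>))"
        using hom_compose[OF \<phi>[OF Rng_Obj[OF \<nu>]] act[OF \<nu>]] by (simp add: free_cover_def)
      show "x \<in> carrier (free_Abelian_group ?S)" using x by (simp add: free_cover_def)
      fix y assume y: "y \<in> ?S"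
      obtain \<mu> p where yy: "y = (\<mu>, p)" by fastforce
      have \<mu>: "\<mu> \<in> Mor \<Lambda>" "Src \<Lambda> \<mu> = Rng \<Lambda> \<nu>" "p \<in> carrier (Grp P (Rng \<Lambda> \<mu>))"
        using y yy by (auto simp: free_cover_gens_def)
      have "(Cmp \<Lambda> \<mu> \<nu>, p) \<in> free_cover_gens \<Lambda> P (Src \<Lambda> \<nu>)"
        using \<mu> \<nu> by (simp add: free_cover_gens_def Cmp_closed Src_Cmp Rng_Cmp)
      then have "(\<phi> (Src \<Lambda> \<nu>) \<circ> Act ?F \<nu>) (frag_of y) = Act M (Cmp \<Lambda> \<mu> \<nu>) (g (Rng \<Lambda> \<mu>) p)"
        using \<phi>g[OF Src_Obj[OF \<nu>]] \<mu> \<nu> by (simp add: yy free_cover_def Rng_Cmp)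
      also have "\<dots> = Act M \<nu> (Act M \<mu> (g (Rng \<Lambda> \<mu>) p))"
        using M \<mu> \<nu> g Rng_Obj by (simp add: right_module_def)
      also have "\<dots> = (Act M \<nu> \<circ> \<phi> (Rng \<Lambda> \<nu>)) (frag_of y)"
        using \<phi>g[OF Rng_Obj[OF \<nu>] y] by (simp add: yy)
      finally show "(\<phi> (Src \<Lambda> \<nu>) \<circ> Act ?F \<nu>) (frag_of y) = (Act M \<nu> \<circ> \<phi> (Rng \<Lambda> \<nu>)) (frag_of y)" .
    qed
    then show ?thesis by simp
  qed
  with \<phi> \<phi>g show ?thesis by (intro exI[of _ \<phi>]) (auto simp: module_map_def)
qed

lemma module_map_comp:
  assumes \<phi>: "module_map \<Lambda> L M \<phi>" and \<psi>: "module_map \<Lambda> M N \<psi>"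
  shows "module_map \<Lambda> L N (\<lambda>v. \<psi> v \<circ> \<phi> v)"
  unfolding module_map_def
proof (intro conjI ballI)
  show "\<psi> v \<circ> \<phi> v \<in> hom (Grp L v) (Grp N v)" if "v \<in> Obj \<Lambda>" for v
    using that \<phi> \<psi> by (intro hom_compose[where H = "Grp M v"]) (simp_all add: module_map_def)
  show "(\<psi> (Src \<Lambda> \<mu>) \<circ> \<phi> (Src \<Lambda> \<mu>)) (Act L \<mu> x) = Act N \<mu> ((\<psi> (Rng \<Lambda> \<mu>) \<circ> \<phi> (Rng \<Lambda> \<mu>)) x)"
    if \<mu>: "\<mu> \<in> Mor \<Lambda>" and x: "x \<in> carrier (Grp L (Rng \<Lambda> \<mu>))" for \<mu> x
  proof -
    have "\<phi> (Rng \<Lambda> \<mu>) \<in> hom (Grp L (Rng \<Lambda> \<mu>)) (Grp M (Rng \<Lambda> \<mu>))"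
      using \<phi> Rng_Obj[OF \<mu>] by (simp add: module_map_def)
    then have "\<phi> (Rng \<Lambda> \<mu>) x \<in> carrier (Grp M (Rng \<Lambda> \<mu>))" using x by (rule hom_in_carrier)
    then show ?thesis using \<phi> \<psi> \<mu> x by (simp add: module_map_def)
  qed
qed

lemma projective_splits:
  assumes P: "projective \<Lambda> P" and Q: "right_module \<Lambda> Q" and \<pi>: "surj_module_map \<Lambda> Q P \<pi>"
  shows "\<exists>\<sigma>. module_map \<Lambda> P Q \<sigma> \<and> (\<forall>v\<in>Obj \<Lambda>. \<forall>x\<in>carrier (Grp P v). \<pi> v (\<sigma> v x) = x)"
proof -
  let ?F = "free_cover \<Lambda> P"
  have Pm: "right_module \<Lambda> P" using P by (simp add: projective_def)
  have surj: "\<pi> v ` carrier (Grp Q v) = carrier (Grp P v)" if "v \<in> Obj \<Lambda>" for v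
    using \<pi> that by (simp add: surj_module_map_def)
  define q where "q v p = inv_into (carrier (Grp Q v)) (\<pi> v) p" for v p
  have q: "q v p \<in> carrier (Grp Q v)" if "v \<in> Obj \<Lambda>" "p \<in> carrier (Grp P v)" for v p
    unfolding q_def using that surj[of v] by (intro inv_into_into) simp
  have \<pi>q: "\<pi> v (q v p) = p" if "v \<in> Obj \<Lambda>" "p \<in> carrier (Grp P v)" for v p
    unfolding q_def using that surj[of v] by (intro f_inv_into_f) simp
  have \<pi>m: "module_map \<Lambda> Q P \<pi>" using \<pi> by (simp add: surj_module_map_def)
  obtain \<tau> where \<tau>: "module_map \<Lambda> ?F Q \<tau>"
    and \<tau>g: "\<And>v \<mu> p. \<lbrakk>v \<in> Obj \<Lambda>; (\<mu>, p) \<in> free_cover_gens \<Lambda> P v\<rbrakk> \<Longrightarrow>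
      \<tau> v (frag_of (\<mu>, p)) = Act Q \<mu> (q (Rng \<Lambda> \<mu>) p)"
    using free_cover_universal[OF Q, of P q] q by blast
  let ?\<rho> = "\<lambda>v. \<pi> v \<circ> \<tau> v"
  have \<rho>: "module_map \<Lambda> ?F P ?\<rho>"
    by (rule module_map_comp[OF \<tau> \<pi>m])
  have "?\<rho> v ` carrier (Grp ?F v) = carrier (Grp P v)" if v: "v \<in> Obj \<Lambda>" for v
  proof
    show "?\<rho> v ` carrier (Grp ?F v) \<subseteq> carrier (Grp P v)"
    proof -
      have "?\<rho> v \<in> hom (Grp ?F v) (Grp P v)" using \<rho> v by (simp add: module_map_def)
      then show ?thesis by (auto simp: hom_def)
    qed
    show "carrier (Grp P v) \<subseteq> ?\<rho> v ` carrier (Grp ?F v)"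
    proof
      fix p assume p: "p \<in> carrier (Grp P v)"
      have gen: "(v, p) \<in> free_cover_gens \<Lambda> P v"
        using v p by (simp add: free_cover_gens_def Obj_Mor Src_id Rng_id)
      have "?\<rho> v (frag_of (v, p)) = \<pi> v (Act Q v (q v p))"
        using \<tau>g[OF v gen] v by (simp add: Rng_id)
      also have "\<dots> = p" using Q v q[OF v p] \<pi>q[OF v p] by (simp add: right_module_def)
      finally show "p \<in> ?\<rho> v ` carrier (Grp ?F v)"
        using gen by (auto simp: free_cover_def intro!: image_eqI[of _ _ "frag_of (v, p)"])
    qed
  qed
  with \<rho> have "surj_module_map \<Lambda> ?F P ?\<rho>" by (simp add: surj_module_map_def)
  then obtain \<sigma> where \<sigma>: "module_map \<Lambda> P ?F \<sigma>"
    and \<rho>\<sigma>: "\<And>v x. \<lbrakk>v \<in> Obj \<Lambda>; x \<in> carrier (Grp P v)\<rbrakk> \<Longrightarrow> ?\<rho> v (\<sigma> v x) = x"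
    using P right_module_free_cover[of P] unfolding projective_def by blast
  have "module_map \<Lambda> P Q (\<lambda>v. \<tau> v \<circ> \<sigma> v)"
    by (rule module_map_comp[OF \<sigma> \<tau>])
  with \<rho>\<sigma> show ?thesis by (intro exI[of _ "\<lambda>v. \<tau> v \<circ> \<sigma> v"]) auto
qed

end

subsection \<open>Projective resolutions of the constant module\<close>

text \<open>
  The differential \<open>d n\<close> maps \<open>R n\<close> to \<open>R (n - 1)\<close> for \<open>n \<ge> 1\<close>; \<open>d 0\<close> is irrelevant.
  Categorical (co-)homology depends on a choice of resolution, so the resolution is an explicit
  argument of \<open>cat_homology\<close> and \<open>cat_cohomology\<close> below.
\<close>

definition projective_resolution ::
    "('l, 'z) cat_scheme \<Rightarrow> (nat \<Rightarrow> ('l, 'r) cmodule) \<Rightarrow> (nat \<Rightarrow> 'l \<Rightarrow> 'r \<Rightarrow> 'r) \<Rightarrow>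
     ('l \<Rightarrow> 'r \<Rightarrow> int) \<Rightarrow> bool"
  where "projective_resolution \<Lambda> R d \<epsilon> \<longleftrightarrow>
    (\<forall>n. projective \<Lambda> (R n)) \<and>
    (\<forall>n. module_map \<Lambda> (R (Suc n)) (R n) (d (Suc n))) \<and>
    surj_module_map \<Lambda> (R 0) const_int_module \<epsilon> \<and>
    (\<forall>v\<in>Obj \<Lambda>. d 1 v ` carrier (Grp (R 1) v) = kernel (Grp (R 0) v) integer_group (\<epsilon> v)) \<and>
    (\<forall>n. \<forall>v\<in>Obj \<Lambda>. d (Suc (Suc n)) v ` carrier (Grp (R (Suc (Suc n))) v) =
      kernel (Grp (R (Suc n)) v) (Grp (R n) v) (d (Suc n) v))"


section \<open>(Co-)homology of complexes of abelian groups\<close>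

text \<open>Degrees are integers; the complexes below are trivial in negative degrees.\<close>

definition chain_homology :: "(int \<Rightarrow> 'a monoid) \<Rightarrow> (int \<Rightarrow> 'a \<Rightarrow> 'a) \<Rightarrow> int \<Rightarrow> 'a set monoid"
  where "chain_homology C d n =
    (C n)\<lparr>carrier := kernel (C n) (C (n - 1)) (d n)\<rparr> Mod (d (n + 1) ` carrier (C (n + 1)))"

definition cochain_cohomology :: "(int \<Rightarrow> 'a monoid) \<Rightarrow> (int \<Rightarrow> 'a \<Rightarrow> 'a) \<Rightarrow> int \<Rightarrow> 'a set monoid"
  where "cochain_cohomology C d n =
    (C n)\<lparr>carrier := kernel (C n) (C (n + 1)) (d n)\<rparr> Mod (d (n - 1) ` carrier (C (n - 1)))"


section \<open>Categorical (co-)homology\<close>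

text \<open>
  Module maps are made extensional so that the elements of this group correspond one-to-one
  to the natural transformations.
\<close>

definition Hom_group ::
    "('l, 'z) cat_scheme \<Rightarrow> ('l, 'a) cmodule \<Rightarrow> ('l, 'b) cmodule \<Rightarrow> ('l \<Rightarrow> 'a \<Rightarrow> 'b) monoid"
  where "Hom_group \<Lambda> P M =
    \<lparr>carrier = {\<phi> \<in> extensional (Obj \<Lambda>). module_map \<Lambda> P M \<phi> \<and>
                 (\<forall>v\<in>Obj \<Lambda>. \<phi> v \<in> extensional (carrier (Grp P v)))},
     monoid.mult = (\<lambda>\<phi> \<psi>. \<lambda>v\<in>Obj \<Lambda>. \<lambda>x\<in>carrier (Grp P v). \<phi> v x \<otimes>\<^bsub>Grp M v\<^esub> \<psi> v x),
     one = (\<lambda>v\<in>Obj \<Lambda>. \<lambda>x\<in>carrier (Grp P v). \<one>\<^bsub>Grp M v\<^esub>)\<rparr>"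

definition tensor_gens ::
    "('l, 'z) cat_scheme \<Rightarrow> ('l, 'a) cmodule \<Rightarrow> ('l, 'b) cmodule \<Rightarrow> ('l \<times> 'a \<times> 'b) set"
  where "tensor_gens \<Lambda> M N = {(v, m, a). v \<in> Obj \<Lambda> \<and> m \<in> carrier (Grp M v) \<and> a \<in> carrier (Grp N v)}"

definition tensor_relators ::
    "('l, 'z) cat_scheme \<Rightarrow> ('l, 'a) cmodule \<Rightarrow> ('l, 'b) cmodule \<Rightarrow> (('l \<times> 'a \<times> 'b) \<Rightarrow>\<^sub>0 int) set"
  where "tensor_relators \<Lambda> M N =
    {frag_of (v, m \<otimes>\<^bsub>Grp M v\<^esub> m', a) - frag_of (v, m, a) - frag_of (v, m', a) | v m m' a.
       v \<in> Obj \<Lambda> \<and> m \<in> carrier (Grp M v) \<and> m' \<in> carrier (Grp M v) \<and> a \<in> carrier (Grp N v)} \<union>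
    {frag_of (v, m, a \<otimes>\<^bsub>Grp N v\<^esub> a') - frag_of (v, m, a) - frag_of (v, m, a') | v m a a'.
       v \<in> Obj \<Lambda> \<and> m \<in> carrier (Grp M v) \<and> a \<in> carrier (Grp N v) \<and> a' \<in> carrier (Grp N v)} \<union>
    {frag_of (Src \<Lambda> \<mu>, Act M \<mu> m, a) - frag_of (Rng \<Lambda> \<mu>, m, Act N \<mu> a) | \<mu> m a.
       \<mu> \<in> Mor \<Lambda> \<and> m \<in> carrier (Grp M (Rng \<Lambda> \<mu>)) \<and> a \<in> carrier (Grp N (Src \<Lambda> \<mu>))}"

definition tensor_rel_subgroup ::
    "('l, 'z) cat_scheme \<Rightarrow> ('l, 'a) cmodule \<Rightarrow> ('l, 'b) cmodule \<Rightarrow> (('l \<times> 'a \<times> 'b) \<Rightarrow>\<^sub>0 int) set"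
  where "tensor_rel_subgroup \<Lambda> M N =
    generate (free_Abelian_group (tensor_gens \<Lambda> M N)) (tensor_relators \<Lambda> M N)"

definition tensor_group ::
    "('l, 'z) cat_scheme \<Rightarrow> ('l, 'a) cmodule \<Rightarrow> ('l, 'b) cmodule \<Rightarrow> (('l \<times> 'a \<times> 'b) \<Rightarrow>\<^sub>0 int) set monoid"
  where "tensor_group \<Lambda> M N =
    free_Abelian_group (tensor_gens \<Lambda> M N) Mod tensor_rel_subgroup \<Lambda> M N"

text \<open>
  The map \<open>\<phi> \<otimes> id\<close> from \<open>M \<otimes> N\<close> to \<open>M' \<otimes> N\<close> induced by a map \<open>\<phi>\<close> of right modules from
  \<open>M\<close> to \<open>M'\<close>, on cosets.
\<close>

definition tensor_map ::
    "('l, 'z) cat_scheme \<Rightarrow> ('l, 'a) cmodule \<Rightarrow> ('l, 'b) cmodule \<Rightarrow> ('l \<Rightarrow> 'a \<Rightarrow> 'a) \<Rightarrow>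
     (('l \<times> 'a \<times> 'b) \<Rightarrow>\<^sub>0 int) set \<Rightarrow> (('l \<times> 'a \<times> 'b) \<Rightarrow>\<^sub>0 int) set"
  where "tensor_map \<Lambda> M' N \<phi> X =
    the_elem ((\<lambda>c. tensor_rel_subgroup \<Lambda> M' N #>\<^bsub>free_Abelian_group (tensor_gens \<Lambda> M' N)\<^esub>
                    frag_extend (\<lambda>(v, m, a). frag_of (v, \<phi> v m, a)) c) ` X)"

definition cat_chain ::
    "('l, 'z) cat_scheme \<Rightarrow> (nat \<Rightarrow> ('l, 'r) cmodule) \<Rightarrow> ('l, 'a) cmodule \<Rightarrow> int \<Rightarrow>
     (('l \<times> 'r \<times> 'a) \<Rightarrow>\<^sub>0 int) set monoid"
  where "cat_chain \<Lambda> R N n =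
    (if n < 0 then singleton_group undefined else tensor_group \<Lambda> (R (nat n)) N)"

definition cat_boundary ::
    "('l, 'z) cat_scheme \<Rightarrow> (nat \<Rightarrow> ('l, 'r) cmodule) \<Rightarrow> (nat \<Rightarrow> 'l \<Rightarrow> 'r \<Rightarrow> 'r) \<Rightarrow>
     ('l, 'a) cmodule \<Rightarrow> int \<Rightarrow> (('l \<times> 'r \<times> 'a) \<Rightarrow>\<^sub>0 int) set \<Rightarrow> (('l \<times> 'r \<times> 'a) \<Rightarrow>\<^sub>0 int) set"
  where "cat_boundary \<Lambda> R d N n X =
    (if n \<le> 0 then \<one>\<^bsub>cat_chain \<Lambda> R N (n - 1)\<^esub>
     else tensor_map \<Lambda> (R (nat (n - 1))) N (d (nat n)) X)"

definition cat_homology ::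
    "('l, 'z) cat_scheme \<Rightarrow> (nat \<Rightarrow> ('l, 'r) cmodule) \<Rightarrow> (nat \<Rightarrow> 'l \<Rightarrow> 'r \<Rightarrow> 'r) \<Rightarrow>
     ('l, 'a) cmodule \<Rightarrow> int \<Rightarrow> (('l \<times> 'r \<times> 'a) \<Rightarrow>\<^sub>0 int) set set monoid"
  where "cat_homology \<Lambda> R d N = chain_homology (cat_chain \<Lambda> R N) (cat_boundary \<Lambda> R d N)"

definition cat_cochain ::
    "('l, 'z) cat_scheme \<Rightarrow> (nat \<Rightarrow> ('l, 'r) cmodule) \<Rightarrow> ('l, 'b) cmodule \<Rightarrow> int \<Rightarrow>
     ('l \<Rightarrow> 'r \<Rightarrow> 'b) monoid"
  where "cat_cochain \<Lambda> R M n =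
    (if n < 0 then singleton_group undefined else Hom_group \<Lambda> (R (nat n)) M)"

definition cat_coboundary ::
    "('l, 'z) cat_scheme \<Rightarrow> (nat \<Rightarrow> ('l, 'r) cmodule) \<Rightarrow> (nat \<Rightarrow> 'l \<Rightarrow> 'r \<Rightarrow> 'r) \<Rightarrow>
     ('l, 'b) cmodule \<Rightarrow> int \<Rightarrow> ('l \<Rightarrow> 'r \<Rightarrow> 'b) \<Rightarrow> ('l \<Rightarrow> 'r \<Rightarrow> 'b)"
  where "cat_coboundary \<Lambda> R d M n \<phi> =
    (if n < 0 then \<one>\<^bsub>cat_cochain \<Lambda> R M (n + 1)\<^esub>
     else (\<lambda>v\<in>Obj \<Lambda>. \<lambda>x\<in>carrier (Grp (R (nat (n + 1))) v). \<phi> v (d (nat (n + 1)) v x)))"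

definition cat_cohomology ::
    "('l, 'z) cat_scheme \<Rightarrow> (nat \<Rightarrow> ('l, 'r) cmodule) \<Rightarrow> (nat \<Rightarrow> 'l \<Rightarrow> 'r \<Rightarrow> 'r) \<Rightarrow>
     ('l, 'b) cmodule \<Rightarrow> int \<Rightarrow> ('l \<Rightarrow> 'r \<Rightarrow> 'b) set monoid"
  where "cat_cohomology \<Lambda> R d M = cochain_cohomology (cat_cochain \<Lambda> R M) (cat_coboundary \<Lambda> R d M)"


section \<open>Cubical (co-)homology\<close>

definition cubes :: "nat \<Rightarrow> ('l, 'z) kgraph_scheme \<Rightarrow> int \<Rightarrow> 'l set"
  where "cubes k \<Lambda> n =
    {\<eta> \<in> Mor \<Lambda>. int (\<Sum>i<k. deg \<Lambda> \<eta> i) = n \<and> (\<forall>i<k. deg \<Lambda> \<eta> i \<in> {0, 1})}"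

text \<open>The \<open>j\<close>-th smallest direction \<open>c\<^sub>j\<close> of a cube, for \<open>j\<close> from \<open>1\<close> to its dimension.\<close>

definition cube_dir :: "nat \<Rightarrow> ('l, 'z) kgraph_scheme \<Rightarrow> 'l \<Rightarrow> nat \<Rightarrow> nat"
  where "cube_dir k \<Lambda> \<eta> j = sorted_list_of_set {i. i < k \<and> deg \<Lambda> \<eta> i = 1} ! (j - 1)"

definition face0 :: "nat \<Rightarrow> ('l, 'z) kgraph_scheme \<Rightarrow> nat \<Rightarrow> 'l \<Rightarrow> 'l"
  where "face0 k \<Lambda> j \<eta> = seg \<Lambda> \<eta> 0 (deg \<Lambda> \<eta> - unit_deg (cube_dir k \<Lambda> \<eta> j))"

definition face1 :: "nat \<Rightarrow> ('l, 'z) kgraph_scheme \<Rightarrow> nat \<Rightarrow> 'l \<Rightarrow> 'l"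
  where "face1 k \<Lambda> j \<eta> = seg \<Lambda> \<eta> (unit_deg (cube_dir k \<Lambda> \<eta> j)) (deg \<Lambda> \<eta>)"

definition last_edge :: "nat \<Rightarrow> ('l, 'z) kgraph_scheme \<Rightarrow> nat \<Rightarrow> 'l \<Rightarrow> 'l"
  where "last_edge k \<Lambda> j \<eta> = seg \<Lambda> \<eta> (deg \<Lambda> \<eta> - unit_deg (cube_dir k \<Lambda> \<eta> j)) (deg \<Lambda> \<eta>)"

definition cub_chain ::
    "nat \<Rightarrow> ('l, 'z) kgraph_scheme \<Rightarrow> ('l, 'a) cmodule \<Rightarrow> int \<Rightarrow> ('l \<Rightarrow> 'a) monoid"
  where "cub_chain k \<Lambda> N n = sum_group (cubes k \<Lambda> n) (\<lambda>\<eta>. Grp N (Src \<Lambda> \<eta>))"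

text \<open>The generator \<open>(\<eta>, a)\<close> of the direct sum.\<close>

definition cub_gen ::
    "nat \<Rightarrow> ('l, 'z) kgraph_scheme \<Rightarrow> ('l, 'a) cmodule \<Rightarrow> int \<Rightarrow> 'l \<Rightarrow> 'a \<Rightarrow> 'l \<Rightarrow> 'a"
  where "cub_gen k \<Lambda> N n \<eta> a =
    (\<lambda>\<zeta>\<in>cubes k \<Lambda> n. if \<zeta> = \<eta> then a else \<one>\<^bsub>Grp N (Src \<Lambda> \<zeta>)\<^esub>)"

definition cub_boundary_gen ::
    "nat \<Rightarrow> ('l, 'z) kgraph_scheme \<Rightarrow> ('l, 'a) cmodule \<Rightarrow> int \<Rightarrow> 'l \<Rightarrow> 'a \<Rightarrow> 'l \<Rightarrow> 'a"
  where "cub_boundary_gen k \<Lambda> N n \<eta> a = (let C = cub_chain k \<Lambda> N (n - 1) in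
    \<Otimes>\<^bsub>C\<^esub>i\<in>{1..nat n}.
      (cub_gen k \<Lambda> N (n - 1) (face0 k \<Lambda> i \<eta>) (Act N (last_edge k \<Lambda> i \<eta>) a) \<otimes>\<^bsub>C\<^esub>
       inv\<^bsub>C\<^esub> cub_gen k \<Lambda> N (n - 1) (face1 k \<Lambda> i \<eta>) a) [^]\<^bsub>C\<^esub> ((-1) ^ i :: int))"

text \<open>
  The additive extension to all of \<open>\<Oplus>\<^sub>\<eta> N (Src \<Lambda> \<eta>)\<close>; \<open>gfinprod\<close> is the product over the
  (finitely many) indices where the factor is nontrivial.
\<close>

definition cub_boundary ::
    "nat \<Rightarrow> ('l, 'z) kgraph_scheme \<Rightarrow> ('l, 'a) cmodule \<Rightarrow> int \<Rightarrow> ('l \<Rightarrow> 'a) \<Rightarrow> 'l \<Rightarrow> 'a"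
  where "cub_boundary k \<Lambda> N n f =
    gfinprod (cub_chain k \<Lambda> N (n - 1)) (\<lambda>\<eta>. cub_boundary_gen k \<Lambda> N n \<eta> (f \<eta>)) (cubes k \<Lambda> n)"

definition cub_homology ::
    "nat \<Rightarrow> ('l, 'z) kgraph_scheme \<Rightarrow> ('l, 'a) cmodule \<Rightarrow> int \<Rightarrow> ('l \<Rightarrow> 'a) set monoid"
  where "cub_homology k \<Lambda> N = chain_homology (cub_chain k \<Lambda> N) (cub_boundary k \<Lambda> N)"

definition cub_cochain ::
    "nat \<Rightarrow> ('l, 'z) kgraph_scheme \<Rightarrow> ('l, 'b) cmodule \<Rightarrow> int \<Rightarrow> ('l \<Rightarrow> 'b) monoid"
  where "cub_cochain k \<Lambda> M n = product_group (cubes k \<Lambda> n) (\<lambda>\<eta>. Grp M (Src \<Lambda> \<eta>))"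

definition cub_coboundary ::
    "nat \<Rightarrow> ('l, 'z) kgraph_scheme \<Rightarrow> ('l, 'b) cmodule \<Rightarrow> int \<Rightarrow> ('l \<Rightarrow> 'b) \<Rightarrow> 'l \<Rightarrow> 'b"
  where "cub_coboundary k \<Lambda> M n f =
    (\<lambda>\<eta>\<in>cubes k \<Lambda> (n + 1). let G = Grp M (Src \<Lambda> \<eta>) in
      \<Otimes>\<^bsub>G\<^esub>i\<in>{1..nat (n + 1)}.
        (Act M (last_edge k \<Lambda> i \<eta>) (f (face0 k \<Lambda> i \<eta>)) \<otimes>\<^bsub>G\<^esub>
         inv\<^bsub>G\<^esub> f (face1 k \<Lambda> i \<eta>)) [^]\<^bsub>G\<^esub> ((-1) ^ i :: int))"

definition cub_cohomology ::
    "nat \<Rightarrow> ('l, 'z) kgraph_scheme \<Rightarrow> ('l, 'b) cmodule \<Rightarrow> int \<Rightarrow> ('l \<Rightarrow> 'b) set monoid"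
  where "cub_cohomology k \<Lambda> M = cochain_cohomology (cub_cochain k \<Lambda> M) (cub_coboundary k \<Lambda> M)"

end

theory Submission
  imports Defs
begin

text \<open>
Both kinds of (co-)homology are obtained from a projective resolution of the constant module by
  applying \<open>- \<otimes> N\<close> or \<open>Hom(-, M)\<close>.  The cubical complexes belong to one particular resolution: the
  right module \<open>cub_res n\<close>, which is free on the \<open>n\<close>-cubes, a cube \<open>\<eta>\<close> being a generator at its
  source, with the alternating sum of faces as differential.  Its basis at the object \<open>v\<close> consists
  of the pairs \<open>(\<mu>, \<eta>)\<close> where \<open>\<eta>\<close> is an \<open>n\<close>-cube and \<open>\<mu>\<close> a morphism from \<open>v\<close> to the source of \<open>\<eta>\<close>.

  Freeness gives \<open>cub_res n \<otimes> N = \<Oplus>\<^sub>\<eta> N(s(\<eta>))\<close> and \<open>Hom(cub_res n, M) = \<Prod>\<^sub>\<eta> M(s(\<eta>))\<close>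
  (\<open>free_tensor_iso\<close>, \<open>free_eval_iso\<close>), and under these identifications the differentials become the
  cubical ones.  By the comparison theorem (\<open>resolution_map_exists\<close>, \<open>resolution_map_homotopy\<close>) any
  two projective resolutions are homotopy equivalent, so that the (co-)homology does not depend on
  the resolution (\<open>cat_homology_unique\<close>, \<open>cat_cohomology_unique\<close>).

  What remains is the heart of the matter: the free modules on cubes form an exact complex
  (\<open>cubical_resolution\<close>).  Exactness is checked at each object \<open>v\<close>.  By the factorization property
  a basis element \<open>(\<mu>, \<eta>)\<close> is the same thing as a cell \<open>(\<xi>, a)\<close>, where \<open>\<xi> = \<eta>\<mu>\<close> is a morphism with
  source \<open>v\<close> and \<open>a\<close> is the set of directions of \<open>\<eta>\<close>, an arbitrary \<open>n\<close>-element set of directions in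
  which \<open>\<xi>\<close> has positive degree.  Let \<open>T\<^sub>j\<close> remove the first edge of \<open>\<xi>\<close> in direction \<open>j\<close>.  In these
  coordinates the boundary is
  \[ \partial(\xi, a) = \sum_{j \in a} \pm ((\xi, a - \{j\}) - (T_j \xi, a - \{j\})), \]
  a sum of anticommuting boundaries, one for each direction.  For a single direction \<open>j\<close> the complex
  looks like a disjoint union of rays \<open>\<xi>, T\<^sub>j \<xi>, T\<^sub>j\<^sup>2 \<xi>, \<dots>\<close>, each of which is contracted by sliding
  \<open>\<xi>\<close> to the end of its ray, where no edge in direction \<open>j\<close> is left.  The slide is a chain homotopy
  on the whole complex because it anticommutes with the boundaries in the other directions
  (\<open>bd_slide\<close>).  After the slides in all \<open>k\<close> directions only the cell \<open>(v, {})\<close> of dimension \<open>0\<close>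
  survives (\<open>bd_exact\<close>, \<open>bd_contract_0\<close>).
\<close>

section \<open>Isomorphisms of homology groups\<close>

text \<open>
  The map induced by \<open>f\<close> on \<open>Z\<close> with values in \<open>Z' / B'\<close> has kernel \<open>B\<close>, since \<open>g (f x)\<close> differs
  from \<open>x\<close> by an element of \<open>B\<close>, and is onto, since \<open>f (g y)\<close> represents the class of \<open>y\<close>.
\<close>

lemma iso_subquotients:
  fixes C :: "'a monoid" and D :: "'b monoid"
  assumes C: "comm_group C" and D: "comm_group D"
    and Z: "subgroup Z C" "subgroup B C" "B \<subseteq> Z"
    and Z': "subgroup Z' D" "subgroup B' D" "B' \<subseteq> Z'"
    and f: "f \<in> hom C D" "f ` Z \<subseteq> Z'" "f ` B \<subseteq> B'"
    and g: "g \<in> hom D C" "g ` Z' \<subseteq> Z" "g ` B' \<subseteq> B"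
    and gf: "\<And>x. x \<in> Z \<Longrightarrow> \<exists>b\<in>B. g (f x) = b \<otimes>\<^bsub>C\<^esub> x"
    and fg: "\<And>y. y \<in> Z' \<Longrightarrow> \<exists>b\<in>B'. f (g y) = b \<otimes>\<^bsub>D\<^esub> y"
  shows "C\<lparr>carrier := Z\<rparr> Mod B \<cong> D\<lparr>carrier := Z'\<rparr> Mod B'"
proof -
  interpret C: comm_group C by fact
  interpret D: comm_group D by fact
  let ?C = "C\<lparr>carrier := Z\<rparr>" and ?D = "D\<lparr>carrier := Z'\<rparr>"
  have gC: "comm_group ?C" and gD: "comm_group ?D"
    using group.group_comm_groupI[OF C.subgroup_imp_group[OF Z(1)]]
      group.group_comm_groupI[OF D.subgroup_imp_group[OF Z'(1)]]
      subgroup.subset[OF Z(1)] subgroup.subset[OF Z'(1)] C.m_comm D.m_comm by (auto simp: subset_iff)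
  interpret cC: comm_group ?C by (rule gC)
  interpret cD: comm_group ?D by (rule gD)
  have sB: "subgroup B ?C" and sB': "subgroup B' ?D"
    using Z Z' by (simp_all add: C.subgroup_incl D.subgroup_incl)
  have nB: "normal B ?C" and nB': "normal B' ?D"
    using sB sB' by (simp_all add: cC.normal_iff_subgroup cD.normal_iff_subgroup)
  interpret nB': normal B' ?D by (rule nB')
  let ?q = "\<lambda>x. B' #>\<^bsub>?D\<^esub> f x"
  have fh: "f \<in> hom ?C ?D"
    using f(1,2) subsetD[OF subgroup.subset[OF Z(1)]] by (auto simp: hom_def)
  have qh: "?q \<in> hom ?C (?D Mod B')"
    by (rule hom_compose[OF fh nB'.r_coset_hom_Mod, unfolded comp_def])
  interpret q: group_hom ?C "?D Mod B'" ?q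
    unfolding group_hom_def group_hom_axioms_def
    using qh cC.is_group nB'.factorgroup_is_group by blast
  have zc: "x \<in> carrier C" if "x \<in> Z" for x using that subgroup.subset[OF Z(1)] by auto
  have zd: "x \<in> carrier D" if "x \<in> Z'" for x using that subgroup.subset[OF Z'(1)] by auto
  have one: "?q x = B' \<longleftrightarrow> f x \<in> B'" if "x \<in> Z" for x
    using that f(2) nB'.rcos_const  cD.coset_join1[OF _ _ sB', of "f x"] cD.coset_join2[OF _ sB', of "f x"]
      subgroup.subset[OF sB'] by auto
  have "kernel ?C (?D Mod B') ?q = B"
  proof -
    have "x \<in> B" if x: "x \<in> Z" and fx: "f x \<in> B'" for x
    proof -
      obtain b where b: "b \<in> B" "g (f x) = b \<otimes>\<^bsub>C\<^esub> x" using gf[OF x] by blast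
      have bc: "b \<in> carrier C" using b(1) Z(3) zc by auto
      have "x = inv\<^bsub>C\<^esub> b \<otimes>\<^bsub>C\<^esub> g (f x)" using b(2) bc zc[OF x] by (simp flip: C.m_assoc)
      moreover have "g (f x) \<in> B" using fx g(3) by auto
      ultimately show ?thesis
        using b(1) Z(2) by (metis subgroup.m_closed subgroup.m_inv_closed)
    qed
    then show ?thesis using one f(3) Z(3) by (auto simp: kernel_def FactGroup_def)
  qed
  moreover have "?q ` carrier ?C = carrier (?D Mod B')"
  proof
    show "?q ` carrier ?C \<subseteq> carrier (?D Mod B')" using q.hom_closed by auto
    show "carrier (?D Mod B') \<subseteq> ?q ` carrier ?C"
    proof
      fix X assume "X \<in> carrier (?D Mod B')"
      then obtain y where y: "y \<in> Z'" "X = B' #>\<^bsub>?D\<^esub> y"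
        by (auto simp: FactGroup_def RCOSETS_def)
      obtain b where b: "b \<in> B'" "f (g y) = b \<otimes>\<^bsub>D\<^esub> y" using fg[OF y(1)] by blast
      have "f (g y) \<in> B' #>\<^bsub>?D\<^esub> y" using b by (auto simp: r_coset_def)
      then have "X = ?q (g y)" using cD.repr_independence[OF _ _ sB', of "f (g y)" y] y by simp
      then show "X \<in> ?q ` carrier ?C" using y g(2) by auto
    qed
  qed
  ultimately show ?thesis using q.FactGroup_iso by simp
qed

definition chain_complex :: "(int \<Rightarrow> 'a monoid) \<Rightarrow> (int \<Rightarrow> 'a \<Rightarrow> 'a) \<Rightarrow> bool"
  where "chain_complex C d \<longleftrightarrow> (\<forall>n. comm_group (C n)) \<and> (\<forall>n. d n \<in> hom (C n) (C (n - 1))) \<and>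
    (\<forall>n. \<forall>x\<in>carrier (C (n + 1)). d n (d (n + 1) x) = \<one>\<^bsub>C (n - 1)\<^esub>)"

definition chain_map ::
    "(int \<Rightarrow> 'a monoid) \<Rightarrow> (int \<Rightarrow> 'a \<Rightarrow> 'a) \<Rightarrow> (int \<Rightarrow> 'b monoid) \<Rightarrow> (int \<Rightarrow> 'b \<Rightarrow> 'b) \<Rightarrow>
     (int \<Rightarrow> 'a \<Rightarrow> 'b) \<Rightarrow> bool"
  where "chain_map C d D d' f \<longleftrightarrow> (\<forall>n. f n \<in> hom (C n) (D n)) \<and>
    (\<forall>n. \<forall>x\<in>carrier (C n). f (n - 1) (d n x) = d' n (f n x))"

text \<open>
  The homotopies enter only through their values on the cycles of degree \<open>n\<close>, where the term with
  the differential of the argument vanishes.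
\<close>

lemma chain_homology_isoI:
  assumes C: "chain_complex C d" and D: "chain_complex D d'"
    and f: "chain_map C d D d' f" and g: "chain_map D d' C d g"
    and gf: "\<And>x. \<lbrakk>x \<in> carrier (C n); d n x = \<one>\<^bsub>C (n - 1)\<^esub>\<rbrakk> \<Longrightarrow>
      \<exists>b\<in>carrier (C (n + 1)). g n (f n x) = d (n + 1) b \<otimes>\<^bsub>C n\<^esub> x"
    and fg: "\<And>y. \<lbrakk>y \<in> carrier (D n); d' n y = \<one>\<^bsub>D (n - 1)\<^esub>\<rbrakk> \<Longrightarrow>
      \<exists>b\<in>carrier (D (n + 1)). f n (g n y) = d' (n + 1) b \<otimes>\<^bsub>D n\<^esub> y"
  shows "chain_homology C d n \<cong> chain_homology D d' n"
proof -
  have *: "subgroup (kernel (C n) (C (n - 1)) (d n)) (C n) \<and> subgroup (d (n + 1) ` carrier (C (n + 1))) (C n) \<and>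
      d (n + 1) ` carrier (C (n + 1)) \<subseteq> kernel (C n) (C (n - 1)) (d n)"
    if "chain_complex C d" for C :: "int \<Rightarrow> 'x monoid" and d
  proof -
    have h: "comm_group (C n)" "d n \<in> hom (C n) (C (n - 1))" for n
      using that by (auto simp: chain_complex_def)
    have "group_hom (C n) (C (n - 1)) (d n)" for n
      using h[of n] h(1)[of "n-1"] by (simp add: group_hom_def group_hom_axioms_def comm_group_def)
    note gh = this[of n] this[of "n+1"]
    show ?thesis
      using group_hom.subgroup_kernel[OF gh(1)] group_hom.img_is_subgroup[OF gh(2)] that
        group_hom.hom_closed[OF gh(2)]
      by (auto simp: chain_complex_def kernel_def)
  qed
  have cg: "comm_group (C n)" "comm_group (D n)" using C D by (auto simp: chain_complex_def)
  have maps: "f n ` kernel (C n) (C (n - 1)) (d n) \<subseteq> kernel (D n) (D (n - 1)) (d' n) \<and>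
      f n ` d (n + 1) ` carrier (C (n + 1)) \<subseteq> d' (n + 1) ` carrier (D (n + 1))"
    if C: "chain_complex C d" and D: "chain_complex D d'" and f: "chain_map C d D d' f"
    for C :: "int \<Rightarrow> 'x monoid" and d and D :: "int \<Rightarrow> 'y monoid" and d' f
  proof -
    have cl: "f n x \<in> carrier (D n)" if "x \<in> carrier (C n)" for n x
      using f that by (auto simp: chain_map_def hom_def)
    have com: "d' n (f n x) = f (n - 1) (d n x)" if "x \<in> carrier (C n)" for n x
      using f that by (auto simp: chain_map_def)
    have "group (C n)" "group (D n)" for n
      using C D by (auto simp: chain_complex_def comm_group_def)
    then have one: "f n \<one>\<^bsub>C n\<^esub> = \<one>\<^bsub>D n\<^esub>" for n
      using hom_one[of "f n" "C n" "D n"] f by (auto simp: chain_map_def)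
    show ?thesis
      using cl com[of _ n] com[of _ "n+1", symmetric] one by (auto simp: kernel_def)
  qed
  have gf': "\<exists>b\<in>d (n + 1) ` carrier (C (n + 1)). g n (f n x) = b \<otimes>\<^bsub>C n\<^esub> x"
    if "x \<in> kernel (C n) (C (n - 1)) (d n)" for x
    using gf[of x] that by (auto simp: kernel_def)
  have fg': "\<exists>b\<in>d' (n + 1) ` carrier (D (n + 1)). f n (g n x) = b \<otimes>\<^bsub>D n\<^esub> x"
    if "x \<in> kernel (D n) (D (n - 1)) (d' n)" for x
    using fg[of x] that by (auto simp: kernel_def)
  show ?thesis unfolding chain_homology_def
    by (rule iso_subquotients[where f = "f n" and g = "g n"])
      (use *[OF C] *[OF D] maps[OF C D f] maps[OF D C g] cg f g gf' fg' in \<open>auto simp: chain_map_def\<close>)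
qed

text \<open>
  Transport of structure: \<open>d'\<close> is determined by \<open>d\<close> and \<open>\<theta>\<close>, which makes \<open>D\<close> a complex and the
  inverses of the \<open>\<theta> n\<close> a chain map.
\<close>

lemma chain_homology_transfer:
  assumes C: "chain_complex C d" and D: "\<And>n. comm_group (D n)"
    and \<theta>: "\<And>n. \<theta> n \<in> iso (C n) (D n)"
    and com: "\<And>n x. x \<in> carrier (C n) \<Longrightarrow> \<theta> (n - 1) (d n x) = d' n (\<theta> n x)"
  shows "chain_homology D d' n \<cong> chain_homology C d n"
proof -
  have gC: "group (C n)" and gD: "group (D n)" and dh: "d n \<in> hom (C n) (C (n - 1))" for n
    using C D[of n] by (auto simp: chain_complex_def comm_group_def)
  define g where "g n = inv_into (carrier (C n)) (\<theta> n)" for n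
  have \<theta>h: "\<theta> n \<in> hom (C n) (D n)" and bij: "bij_betw (\<theta> n) (carrier (C n)) (carrier (D n))" for n
    using \<theta>[of n] by (auto simp: iso_def)
  have gh: "g n \<in> hom (D n) (C n)" for n
    using group.iso_set_sym[OF gC \<theta>] unfolding g_def iso_def by blast
  have g\<theta>: "g n (\<theta> n x) = x" if "x \<in> carrier (C n)" for n x
    using bij_betw_inv_into_left[OF bij that] by (simp add: g_def)
  have \<theta>g: "\<theta> n (g n y) = y" if "y \<in> carrier (D n)" for n y
    using bij_betw_inv_into_right[OF bij that] by (simp add: g_def)
  have d': "d' n y = \<theta> (n - 1) (d n (g n y))" if "y \<in> carrier (D n)" for n y
    using com[OF hom_in_carrier[OF gh that]] \<theta>g[OF that] by simp
  have dc: "d n x \<in> carrier (C (n - 1))" if "x \<in> carrier (C n)" for n x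
    using hom_in_carrier[OF dh that] .
  have D': "chain_complex D d'"
    unfolding chain_complex_def
  proof (intro conjI allI ballI D)
    show "d' n \<in> hom (D n) (D (n - 1))" for n
      by (rule group.hom_restrict[OF gD hom_compose[OF hom_compose[OF gh dh] \<theta>h]]) (simp add: d')
    show "d' n (d' (n + 1) y) = \<one>\<^bsub>D (n - 1)\<^esub>" if y: "y \<in> carrier (D (n + 1))" for n y
    proof -
      have gy: "g (n + 1) y \<in> carrier (C (n + 1))" by (rule hom_in_carrier[OF gh y])
      have "d' (n + 1) y = \<theta> n (d (n + 1) (g (n + 1) y))" using d'[OF y] by simp
      moreover have "d (n + 1) (g (n + 1) y) \<in> carrier (C n)" using dc[OF gy] by simp
      ultimately have "d' n (d' (n + 1) y) = \<theta> (n - 1) (d n (d (n + 1) (g (n + 1) y)))"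
        by (simp add: com)
      also have "\<dots> = \<theta> (n - 1) \<one>\<^bsub>C (n - 1)\<^esub>"
        using C gy by (simp add: chain_complex_def)
      finally show ?thesis using hom_one[OF \<theta>h gC gD] by simp
    qed
  qed
  have one: "\<one>\<^bsub>C n\<^esub> \<in> carrier (C n)" "\<one>\<^bsub>D n\<^esub> \<in> carrier (D n)" for n
    using gC gD by (simp_all add: group.is_monoid monoid.one_closed)
  have dh': "d' n \<in> hom (D n) (D (n - 1))" for n using D' by (simp add: chain_complex_def)
  have o: "d (n + 1) \<one>\<^bsub>C (n + 1)\<^esub> = \<one>\<^bsub>C n\<^esub>" "d' (n + 1) \<one>\<^bsub>D (n + 1)\<^esub> = \<one>\<^bsub>D n\<^esub>"
    using hom_one[OF dh[of "n + 1"] gC gC] hom_one[OF dh'[of "n + 1"] gD gD] by simp_all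
  show ?thesis
  proof (rule chain_homology_isoI[OF D' C])
    show "chain_map C d D d' \<theta>" using \<theta>h com by (simp add: chain_map_def)
    show "chain_map D d' C d g"
      using gh by (auto simp: chain_map_def d' g\<theta> dc hom_in_carrier[OF gh])
    show "\<exists>b\<in>carrier (C (n + 1)). g n (\<theta> n x) = d (n + 1) b \<otimes>\<^bsub>C n\<^esub> x" if "x \<in> carrier (C n)" for x
      using one(1)[of "n + 1"] that gC[of n] by (intro bexI[of _ "\<one>\<^bsub>C (n + 1)\<^esub>"]) (simp_all add: g\<theta> o group.is_monoid monoid.l_one)
    show "\<exists>b\<in>carrier (D (n + 1)). \<theta> n (g n y) = d' (n + 1) b \<otimes>\<^bsub>D n\<^esub> y" if "y \<in> carrier (D n)" for y
      using one(2)[of "n + 1"] that gD[of n] by (intro bexI[of _ "\<one>\<^bsub>D (n + 1)\<^esub>"]) (simp_all add: \<theta>g o group.is_monoid monoid.l_one)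
  qed
qed

definition cochain_complex :: "(int \<Rightarrow> 'a monoid) \<Rightarrow> (int \<Rightarrow> 'a \<Rightarrow> 'a) \<Rightarrow> bool"
  where "cochain_complex C d \<longleftrightarrow> (\<forall>n. comm_group (C n)) \<and> (\<forall>n. d n \<in> hom (C n) (C (n + 1))) \<and>
    (\<forall>n. \<forall>x\<in>carrier (C (n - 1)). d n (d (n - 1) x) = \<one>\<^bsub>C (n + 1)\<^esub>)"

definition cochain_map ::
    "(int \<Rightarrow> 'a monoid) \<Rightarrow> (int \<Rightarrow> 'a \<Rightarrow> 'a) \<Rightarrow> (int \<Rightarrow> 'b monoid) \<Rightarrow> (int \<Rightarrow> 'b \<Rightarrow> 'b) \<Rightarrow>
     (int \<Rightarrow> 'a \<Rightarrow> 'b) \<Rightarrow> bool"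
  where "cochain_map C d D d' f \<longleftrightarrow> (\<forall>n. f n \<in> hom (C n) (D n)) \<and>
    (\<forall>n. \<forall>x\<in>carrier (C n). f (n + 1) (d n x) = d' n (f n x))"

text \<open>
  Negating the degrees turns cochain complexes into chain complexes, so that the criteria for
  cohomology follow from those for homology.
\<close>

lemma cochain_complex_reverse:
  assumes "cochain_complex C d"
  shows "chain_complex (\<lambda>m. C (- m)) (\<lambda>m. d (- m))"
  unfolding chain_complex_def
proof (intro conjI allI ballI)
  fix n
  show "comm_group (C (- n))" using assms by (simp add: cochain_complex_def)
  show "d (- n) \<in> hom (C (- n)) (C (- (n - 1)))"
    using assms[unfolded cochain_complex_def, THEN conjunct2, THEN conjunct1, rule_format, of "- n"] by (simp add: add.commute)
  show "d (- n) (d (- (n + 1)) x) = \<one>\<^bsub>C (- (n - 1))\<^esub>" if "x \<in> carrier (C (- (n + 1)))" for x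
  proof -
    have "- (n + 1) = - n - 1" "- (n - 1) = - n + 1" by simp_all
    with assms that show ?thesis unfolding cochain_complex_def by metis
  qed
qed

lemma cochain_map_reverse:
  assumes "cochain_map C d D d' f"
  shows "chain_map (\<lambda>m. C (- m)) (\<lambda>m. d (- m)) (\<lambda>m. D (- m)) (\<lambda>m. d' (- m)) (\<lambda>m. f (- m))"
proof -
  have "f (- (n - 1)) (d (- n) x) = d' (- n) (f (- n) x)" if "x \<in> carrier (C (- n))" for n x
    using assms[unfolded cochain_map_def, THEN conjunct2, rule_format, OF that] by (simp add: add.commute)
  with assms show ?thesis by (simp add: chain_map_def cochain_map_def)
qed

lemma cochain_cohomology_reverse:
  "cochain_cohomology C d n = chain_homology (\<lambda>m. C (- m)) (\<lambda>m. d (- m)) (- n)"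
  by (simp add: cochain_cohomology_def chain_homology_def add.commute)

lemma cochain_cohomology_isoI:
  assumes C: "cochain_complex C d" and D: "cochain_complex D d'"
    and f: "cochain_map C d D d' f" and g: "cochain_map D d' C d g"
    and gf: "\<And>x. \<lbrakk>x \<in> carrier (C n); d n x = \<one>\<^bsub>C (n + 1)\<^esub>\<rbrakk> \<Longrightarrow>
      \<exists>b\<in>carrier (C (n - 1)). g n (f n x) = d (n - 1) b \<otimes>\<^bsub>C n\<^esub> x"
    and fg: "\<And>y. \<lbrakk>y \<in> carrier (D n); d' n y = \<one>\<^bsub>D (n + 1)\<^esub>\<rbrakk> \<Longrightarrow>
      \<exists>b\<in>carrier (D (n - 1)). f n (g n y) = d' (n - 1) b \<otimes>\<^bsub>D n\<^esub> y"
  shows "cochain_cohomology C d n \<cong> cochain_cohomology D d' n"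
proof -
  show ?thesis unfolding cochain_cohomology_reverse
    by (rule chain_homology_isoI[OF C[THEN cochain_complex_reverse] D[THEN cochain_complex_reverse]
          f[THEN cochain_map_reverse] g[THEN cochain_map_reverse]])
      (use gf fg in \<open>simp_all add: add.commute\<close>)
qed

lemma cochain_cohomology_transfer:
  assumes C: "cochain_complex C d" and D: "\<And>n. comm_group (D n)"
    and \<theta>: "\<And>n. \<theta> n \<in> iso (C n) (D n)"
    and com: "\<And>n x. x \<in> carrier (C n) \<Longrightarrow> \<theta> (n + 1) (d n x) = d' n (\<theta> n x)"
  shows "cochain_cohomology D d' n \<cong> cochain_cohomology C d n"
  unfolding cochain_cohomology_reverse
proof (rule chain_homology_transfer[OF C[THEN cochain_complex_reverse] D \<theta>])
  show "\<theta> (- (n - 1)) (d (- n) x) = d' (- n) (\<theta> (- n) x)" if "x \<in> carrier (C (- n))" for n x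
    using com[OF that] by (simp add: add.commute)
qed

section \<open>Maps of modules and lifting along surjections\<close>

context small_category
begin

lemma right_moduleD:
  assumes "right_module \<Lambda> M"
  shows right_module_group: "v \<in> Obj \<Lambda> \<Longrightarrow> comm_group (Grp M v)"
    and right_module_act: "\<mu> \<in> Mor \<Lambda> \<Longrightarrow> Act M \<mu> \<in> hom (Grp M (Rng \<Lambda> \<mu>)) (Grp M (Src \<Lambda> \<mu>))"
    and right_module_act_closed: "\<lbrakk>\<mu> \<in> Mor \<Lambda>; x \<in> carrier (Grp M (Rng \<Lambda> \<mu>))\<rbrakk> \<Longrightarrow> Act M \<mu> x \<in> carrier (Grp M (Src \<Lambda> \<mu>))"
    and right_module_act_mult: "\<lbrakk>\<mu> \<in> Mor \<Lambda>; x \<in> carrier (Grp M (Rng \<Lambda> \<mu>)); y \<in> carrier (Grp M (Rng \<Lambda> \<mu>))\<rbrakk> \<Longrightarrow>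
      Act M \<mu> (x \<otimes>\<^bsub>Grp M (Rng \<Lambda> \<mu>)\<^esub> y) = Act M \<mu> x \<otimes>\<^bsub>Grp M (Src \<Lambda> \<mu>)\<^esub> Act M \<mu> y"
    and right_module_act_one: "\<mu> \<in> Mor \<Lambda> \<Longrightarrow> Act M \<mu> \<one>\<^bsub>Grp M (Rng \<Lambda> \<mu>)\<^esub> = \<one>\<^bsub>Grp M (Src \<Lambda> \<mu>)\<^esub>"
    and right_module_act_inv: "\<lbrakk>\<mu> \<in> Mor \<Lambda>; x \<in> carrier (Grp M (Rng \<Lambda> \<mu>))\<rbrakk> \<Longrightarrow>
      Act M \<mu> (inv\<^bsub>Grp M (Rng \<Lambda> \<mu>)\<^esub> x) = inv\<^bsub>Grp M (Src \<Lambda> \<mu>)\<^esub> Act M \<mu> x"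
proof -
  show g: "v \<in> Obj \<Lambda> \<Longrightarrow> comm_group (Grp M v)" for v using assms by (simp add: right_module_def)
  show act: "\<mu> \<in> Mor \<Lambda> \<Longrightarrow> Act M \<mu> \<in> hom (Grp M (Rng \<Lambda> \<mu>)) (Grp M (Src \<Lambda> \<mu>))"
    using assms by (simp add: right_module_def)
  assume \<mu>: "\<mu> \<in> Mor \<Lambda>"
  interpret group_hom "Grp M (Rng \<Lambda> \<mu>)" "Grp M (Src \<Lambda> \<mu>)" "Act M \<mu>"
    using act[OF \<mu>] g[OF Rng_Obj[OF \<mu>]] g[OF Src_Obj[OF \<mu>]]
    by (simp add: group_hom_def group_hom_axioms_def comm_group_def)
  show "x \<in> carrier (Grp M (Rng \<Lambda> \<mu>)) \<Longrightarrow> Act M \<mu> x \<in> carrier (Grp M (Src \<Lambda> \<mu>))" by simp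
  show "x \<in> carrier (Grp M (Rng \<Lambda> \<mu>)) \<Longrightarrow> y \<in> carrier (Grp M (Rng \<Lambda> \<mu>)) \<Longrightarrow>
      Act M \<mu> (x \<otimes>\<^bsub>Grp M (Rng \<Lambda> \<mu>)\<^esub> y) = Act M \<mu> x \<otimes>\<^bsub>Grp M (Src \<Lambda> \<mu>)\<^esub> Act M \<mu> y" by simp
  show "Act M \<mu> \<one>\<^bsub>Grp M (Rng \<Lambda> \<mu>)\<^esub> = \<one>\<^bsub>Grp M (Src \<Lambda> \<mu>)\<^esub>" by simp
  show "x \<in> carrier (Grp M (Rng \<Lambda> \<mu>)) \<Longrightarrow>
      Act M \<mu> (inv\<^bsub>Grp M (Rng \<Lambda> \<mu>)\<^esub> x) = inv\<^bsub>Grp M (Src \<Lambda> \<mu>)\<^esub> Act M \<mu> x" by simp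
qed

lemma module_mapD:
  assumes "module_map \<Lambda> M M' \<phi>"
  shows module_map_hom: "v \<in> Obj \<Lambda> \<Longrightarrow> \<phi> v \<in> hom (Grp M v) (Grp M' v)"
    and module_map_closed: "\<lbrakk>v \<in> Obj \<Lambda>; x \<in> carrier (Grp M v)\<rbrakk> \<Longrightarrow> \<phi> v x \<in> carrier (Grp M' v)"
    and module_map_mult: "\<lbrakk>v \<in> Obj \<Lambda>; x \<in> carrier (Grp M v); y \<in> carrier (Grp M v)\<rbrakk> \<Longrightarrow>
      \<phi> v (x \<otimes>\<^bsub>Grp M v\<^esub> y) = \<phi> v x \<otimes>\<^bsub>Grp M' v\<^esub> \<phi> v y"
    and module_map_act: "\<lbrakk>\<mu> \<in> Mor \<Lambda>; x \<in> carrier (Grp M (Rng \<Lambda> \<mu>))\<rbrakk> \<Longrightarrow>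
      \<phi> (Src \<Lambda> \<mu>) (Act M \<mu> x) = Act M' \<mu> (\<phi> (Rng \<Lambda> \<mu>) x)"
  using assms by (auto simp: module_map_def hom_def)

lemma module_map_group_hom:
  assumes "right_module \<Lambda> M" "right_module \<Lambda> M'" "module_map \<Lambda> M M' \<phi>" "v \<in> Obj \<Lambda>"
  shows "group_hom (Grp M v) (Grp M' v) (\<phi> v)"
  using assms right_module_group[of M v] right_module_group[of M' v] module_map_hom[of M M' \<phi> v]
  by (simp add: group_hom_def group_hom_axioms_def comm_group_def)

lemma module_map_id: "module_map \<Lambda> M M (\<lambda>v x. x)"
  by (auto simp: module_map_def hom_def)

lemma module_map_pointwise_mult:
  assumes M': "right_module \<Lambda> M'"
    and \<phi>: "module_map \<Lambda> M M' \<phi>" and \<psi>: "module_map \<Lambda> M M' \<psi>"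
  shows "module_map \<Lambda> M M' (\<lambda>v x. \<phi> v x \<otimes>\<^bsub>Grp M' v\<^esub> \<psi> v x)"
  unfolding module_map_def
proof (intro conjI ballI)
  fix v assume v: "v \<in> Obj \<Lambda>"
  interpret comm_group "Grp M' v" by (rule right_module_group[OF M' v])
  show "(\<lambda>x. \<phi> v x \<otimes>\<^bsub>Grp M' v\<^esub> \<psi> v x) \<in> hom (Grp M v) (Grp M' v)"
    using module_mapD[OF \<phi>] module_mapD[OF \<psi>] v by (intro homI) (simp_all add: m_ac)
next
  fix \<mu> x assume \<mu>: "\<mu> \<in> Mor \<Lambda>" "x \<in> carrier (Grp M (Rng \<Lambda> \<mu>))"
  then show "\<phi> (Src \<Lambda> \<mu>) (Act M \<mu> x) \<otimes>\<^bsub>Grp M' (Src \<Lambda> \<mu>)\<^esub> \<psi> (Src \<Lambda> \<mu>) (Act M \<mu> x) =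
      Act M' \<mu> (\<phi> (Rng \<Lambda> \<mu>) x \<otimes>\<^bsub>Grp M' (Rng \<Lambda> \<mu>)\<^esub> \<psi> (Rng \<Lambda> \<mu>) x)"
    using module_mapD[OF \<phi>] module_mapD[OF \<psi>] Rng_Obj by (simp add: right_module_act_mult[OF M'])
qed

lemma module_map_pointwise_inv:
  assumes M': "right_module \<Lambda> M'" and \<phi>: "module_map \<Lambda> M M' \<phi>"
  shows "module_map \<Lambda> M M' (\<lambda>v x. inv\<^bsub>Grp M' v\<^esub> \<phi> v x)"
  unfolding module_map_def
proof (intro conjI ballI)
  fix v assume v: "v \<in> Obj \<Lambda>"
  interpret comm_group "Grp M' v" by (rule right_module_group[OF M' v])
  show "(\<lambda>x. inv\<^bsub>Grp M' v\<^esub> \<phi> v x) \<in> hom (Grp M v) (Grp M' v)"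
    using module_mapD[OF \<phi>] v by (intro homI) (simp_all add: inv_mult)
next
  fix \<mu> x assume \<mu>: "\<mu> \<in> Mor \<Lambda>" "x \<in> carrier (Grp M (Rng \<Lambda> \<mu>))"
  then show "inv\<^bsub>Grp M' (Src \<Lambda> \<mu>)\<^esub> \<phi> (Src \<Lambda> \<mu>) (Act M \<mu> x) =
      Act M' \<mu> (inv\<^bsub>Grp M' (Rng \<Lambda> \<mu>)\<^esub> \<phi> (Rng \<Lambda> \<mu>) x)"
    using module_mapD[OF \<phi>] Rng_Obj by (simp add: right_module_act_inv[OF M'])
qed

lemma module_map_const_one:
  assumes "right_module \<Lambda> M'"
  shows "module_map \<Lambda> M M' (\<lambda>v x. \<one>\<^bsub>Grp M' v\<^esub>)"
  using right_module_group[OF assms]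
  by (auto simp: module_map_def hom_def comm_group_def group_def right_module_act_one[OF assms])

lemma right_module_const_int: "right_module \<Lambda> const_int_module"
  by (auto simp: right_module_def const_int_module_def hom_def abelian_integer_group)

text \<open>
  The pullback of \<open>\<pi>\<close> along \<open>\<phi>\<close> maps onto \<open>P\<close> because \<open>\<phi>\<close> takes its values in the image of \<open>\<pi>\<close>.
  A section of this surjection, composed with the projection to \<open>A\<close>, is the lift.
\<close>

lemma projective_lift:
  assumes P: "projective \<Lambda> P" and A: "right_module \<Lambda> A" and B: "right_module \<Lambda> B"
    and \<pi>: "module_map \<Lambda> A B \<pi>" and \<phi>: "module_map \<Lambda> P B \<phi>"
    and im: "\<And>v x. \<lbrakk>v \<in> Obj \<Lambda>; x \<in> carrier (Grp P v)\<rbrakk> \<Longrightarrow> \<phi> v x \<in> \<pi> v ` carrier (Grp A v)"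
  shows "\<exists>\<psi>. module_map \<Lambda> P A \<psi> \<and> (\<forall>v\<in>Obj \<Lambda>. \<forall>x\<in>carrier (Grp P v). \<pi> v (\<psi> v x) = \<phi> v x)"
proof -
  have Pm: "right_module \<Lambda> P" using P by (simp add: projective_def)
  define K where "K v = {(p, a). p \<in> carrier (Grp P v) \<and> a \<in> carrier (Grp A v) \<and> \<phi> v p = \<pi> v a}" for v
  define Q where "Q = \<lparr>Grp = (\<lambda>v. (Grp P v \<times>\<times> Grp A v)\<lparr>carrier := K v\<rparr>),
    Act = (\<lambda>\<mu> (p, a). (Act P \<mu> p, Act A \<mu> a))\<rparr>"
  have Q: "right_module \<Lambda> Q"
    unfolding right_module_def
  proof (intro conjI ballI impI)
    fix v assume v: "v \<in> Obj \<Lambda>"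
    interpret p: comm_group "Grp P v" by (rule right_module_group[OF Pm v])
    interpret a: comm_group "Grp A v" by (rule right_module_group[OF A v])
    interpret b: comm_group "Grp B v" by (rule right_module_group[OF B v])
    interpret \<phi>: group_hom "Grp P v" "Grp B v" "\<phi> v" by (rule module_map_group_hom[OF Pm B \<phi> v])
    interpret \<pi>: group_hom "Grp A v" "Grp B v" "\<pi> v" by (rule module_map_group_hom[OF A B \<pi> v])
    have G: "group (Grp P v \<times>\<times> Grp A v)" by (simp add: DirProd_group p.is_group a.is_group)
    have "subgroup (K v) (Grp P v \<times>\<times> Grp A v)"
      by (rule group.subgroupI[OF G]) (auto simp: K_def p.is_group a.is_group inv_DirProd
        intro!: exI[of _ "\<one>\<^bsub>Grp P v\<^esub>"] exI[of _ "\<one>\<^bsub>Grp A v\<^esub>"])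
    from group.subgroup_imp_group[OF G this] show "comm_group (Grp Q v)"
      unfolding Q_def by (auto intro!: group.group_comm_groupI simp: K_def p.m_comm a.m_comm)
  next
    fix \<mu> assume \<mu>: "\<mu> \<in> Mor \<Lambda>"
    then show "Act Q \<mu> \<in> hom (Grp Q (Rng \<Lambda> \<mu>)) (Grp Q (Src \<Lambda> \<mu>))"
      by (intro homI) (auto simp: Q_def K_def right_module_act_closed[OF Pm] right_module_act_closed[OF A]
          right_module_act_mult[OF Pm] right_module_act_mult[OF A] module_map_act[OF \<phi>] module_map_act[OF \<pi>])
  next
    show "Act Q v x = x" if "v \<in> Obj \<Lambda>" "x \<in> carrier (Grp Q v)" for v x
      using that Pm A by (auto simp: Q_def K_def right_module_def)
    show "Act Q (Cmp \<Lambda> \<mu> \<nu>) x = Act Q \<nu> (Act Q \<mu> x)"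
      if "\<mu> \<in> Mor \<Lambda>" "\<nu> \<in> Mor \<Lambda>" "Src \<Lambda> \<mu> = Rng \<Lambda> \<nu>" "x \<in> carrier (Grp Q (Rng \<Lambda> \<mu>))" for \<mu> \<nu> x
      using that Pm A by (auto simp: Q_def K_def right_module_def)
  qed
  have snd: "module_map \<Lambda> Q A (\<lambda>v. snd)"
    by (auto simp: module_map_def Q_def K_def hom_def)
  have "surj_module_map \<Lambda> Q P (\<lambda>v. fst)"
    unfolding surj_module_map_def
  proof (intro conjI ballI)
    show "module_map \<Lambda> Q P (\<lambda>v. fst)" by (auto simp: module_map_def Q_def K_def hom_def)
    show "fst ` carrier (Grp Q v) = carrier (Grp P v)" if v: "v \<in> Obj \<Lambda>" for v
    proof -
      have "x \<in> fst ` K v" if x: "x \<in> carrier (Grp P v)" for x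
      proof -
        obtain a where "a \<in> carrier (Grp A v)" "\<phi> v x = \<pi> v a" using im[OF v x] by auto
        then show ?thesis using x by (intro image_eqI[of _ _ "(x, a)"]) (auto simp: K_def)
      qed
      then show ?thesis by (auto simp: Q_def K_def)
    qed
  qed
  from projective_splits[OF P Q this] obtain \<sigma> where \<sigma>: "module_map \<Lambda> P Q \<sigma>"
    and fst: "\<And>v x. \<lbrakk>v \<in> Obj \<Lambda>; x \<in> carrier (Grp P v)\<rbrakk> \<Longrightarrow> fst (\<sigma> v x) = x" by blast
  have "\<pi> v (snd (\<sigma> v x)) = \<phi> v x" if "v \<in> Obj \<Lambda>" "x \<in> carrier (Grp P v)" for v x
    using module_map_closed[OF \<sigma> that] fst[OF that] by (auto simp: Q_def K_def)
  with module_map_comp[OF \<sigma> snd] show ?thesis by (intro exI[of _ "\<lambda>v. snd \<circ> \<sigma> v"]) simp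
qed

end

section \<open>Comparison of projective resolutions\<close>

context small_category
begin

text \<open>
  In degree \<open>0\<close> the augmentation takes the place of the differential.  Exactness of a resolution then
  is the single equation \<open>resolution_exact\<close> in all degrees.
\<close>

definition res_cycles ::
    "(nat \<Rightarrow> ('l, 'r) cmodule) \<Rightarrow> (nat \<Rightarrow> 'l \<Rightarrow> 'r \<Rightarrow> 'r) \<Rightarrow> ('l \<Rightarrow> 'r \<Rightarrow> int) \<Rightarrow> nat \<Rightarrow> 'l \<Rightarrow> 'r set"
  where "res_cycles R d \<epsilon> n v = (case n of
      0 \<Rightarrow> kernel (Grp (R 0) v) integer_group (\<epsilon> v)
    | Suc m \<Rightarrow> kernel (Grp (R (Suc m)) v) (Grp (R m) v) (d (Suc m) v))"

lemma projective_resolutionD: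
  assumes "projective_resolution \<Lambda> R d \<epsilon>"
  shows resolution_projective: "projective \<Lambda> (R n)"
    and resolution_module: "right_module \<Lambda> (R n)"
    and resolution_diff: "module_map \<Lambda> (R (Suc n)) (R n) (d (Suc n))"
    and resolution_aug: "surj_module_map \<Lambda> (R 0) const_int_module \<epsilon>"
    and resolution_aug_map: "module_map \<Lambda> (R 0) const_int_module \<epsilon>"
    and resolution_exact: "v \<in> Obj \<Lambda> \<Longrightarrow> d (Suc n) v ` carrier (Grp (R (Suc n)) v) = res_cycles R d \<epsilon> n v"
proof -
  show "projective \<Lambda> (R n)" "module_map \<Lambda> (R (Suc n)) (R n) (d (Suc n))"
    "surj_module_map \<Lambda> (R 0) const_int_module \<epsilon>"
    using assms unfolding projective_resolution_def by blast+
  then show "right_module \<Lambda> (R n)" "module_map \<Lambda> (R 0) const_int_module \<epsilon>"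
    by (simp_all add: projective_def surj_module_map_def)
  show "v \<in> Obj \<Lambda> \<Longrightarrow> d (Suc n) v ` carrier (Grp (R (Suc n)) v) = res_cycles R d \<epsilon> n v"
    using assms unfolding projective_resolution_def res_cycles_def by (cases n) auto
qed

lemma res_cycles_carrier: "x \<in> res_cycles R d \<epsilon> n v \<Longrightarrow> x \<in> carrier (Grp (R n) v)"
  by (auto simp: res_cycles_def kernel_def split: nat.splits)

lemma res_cycles_Suc: "x \<in> res_cycles R d \<epsilon> (Suc n) v \<longleftrightarrow>
    x \<in> carrier (Grp (R (Suc n)) v) \<and> d (Suc n) v x = \<one>\<^bsub>Grp (R n) v\<^esub>"
  by (auto simp: res_cycles_def kernel_def)

lemma res_cycles_0: "x \<in> res_cycles R d \<epsilon> 0 v \<longleftrightarrow> x \<in> carrier (Grp (R 0) v) \<and> \<epsilon> v x = 0"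
  by (auto simp: res_cycles_def kernel_def)

lemma resolution_diff_cycle:
  assumes "projective_resolution \<Lambda> R d \<epsilon>" "v \<in> Obj \<Lambda>" "x \<in> carrier (Grp (R (Suc n)) v)"
  shows "d (Suc n) v x \<in> res_cycles R d \<epsilon> n v"
  using resolution_exact[OF assms(1,2)] assms(3) by blast

lemma resolution_diff_diff:
  assumes "projective_resolution \<Lambda> R d \<epsilon>" "v \<in> Obj \<Lambda>" "x \<in> carrier (Grp (R (Suc (Suc n))) v)"
  shows "d (Suc n) v (d (Suc (Suc n)) v x) = \<one>\<^bsub>Grp (R n) v\<^esub>"
  using resolution_diff_cycle[OF assms] by (simp add: res_cycles_Suc)

definition resolution_map ::
    "(nat \<Rightarrow> ('l, 'p) cmodule) \<Rightarrow> (nat \<Rightarrow> 'l \<Rightarrow> 'p \<Rightarrow> 'p) \<Rightarrow> (nat \<Rightarrow> ('l, 'r) cmodule) \<Rightarrow>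
     (nat \<Rightarrow> 'l \<Rightarrow> 'r \<Rightarrow> 'r) \<Rightarrow> (nat \<Rightarrow> 'l \<Rightarrow> 'p \<Rightarrow> 'r) \<Rightarrow> bool"
  where "resolution_map P dP R dR f \<longleftrightarrow> (\<forall>n. module_map \<Lambda> (P n) (R n) (f n)) \<and>
    (\<forall>n. \<forall>v\<in>Obj \<Lambda>. \<forall>x\<in>carrier (Grp (P (Suc n)) v). dR (Suc n) v (f (Suc n) v x) = f n v (dP (Suc n) v x))"

text \<open>
  The maps are built degree by degree.  The next lifting problem has a solution because the map
  already constructed takes cycles to cycles, and cycles are boundaries in the target.
\<close>

lemma resolution_map_exists:
  fixes P :: "nat \<Rightarrow> ('l, 'p) cmodule" and R :: "nat \<Rightarrow> ('l, 'r) cmodule"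
  assumes P: "projective_resolution \<Lambda> P dP \<epsilon>P" and R: "projective_resolution \<Lambda> R dR \<epsilon>R"
  shows "\<exists>f. resolution_map P dP R dR f \<and> (\<forall>v\<in>Obj \<Lambda>. \<forall>x\<in>carrier (Grp (P 0) v). \<epsilon>R v (f 0 v x) = \<epsilon>P v x)"
proof -
  define ok where "ok n f \<longleftrightarrow> module_map \<Lambda> (P n) (R n) f \<and>
      (\<forall>v\<in>Obj \<Lambda>. \<forall>x\<in>res_cycles P dP \<epsilon>P n v. f v x \<in> res_cycles R dR \<epsilon>R n v) \<and>
      (n = 0 \<longrightarrow> (\<forall>v\<in>Obj \<Lambda>. \<forall>x\<in>carrier (Grp (P 0) v). \<epsilon>R v (f v x) = \<epsilon>P v x))"
    for n and f :: "'l \<Rightarrow> 'p \<Rightarrow> 'r"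
  define step where "step n f f' \<longleftrightarrow> (\<forall>v\<in>Obj \<Lambda>. \<forall>x\<in>carrier (Grp (P (Suc n)) v).
      dR (Suc n) v (f' v x) = f v (dP (Suc n) v x))"
    for n and f f' :: "'l \<Rightarrow> 'p \<Rightarrow> 'r"
  have "\<exists>f. \<forall>n. ok n (f n) \<and> step n (f n) (f (Suc n))"
  proof (rule dependent_nat_choice)
    have "\<epsilon>P v x \<in> \<epsilon>R v ` carrier (Grp (R 0) v)" if "v \<in> Obj \<Lambda>" for v x
      using resolution_aug[OF R] that by (auto simp: surj_module_map_def const_int_module_def)
    then obtain f where f: "module_map \<Lambda> (P 0) (R 0) f"
      "\<And>v x. v \<in> Obj \<Lambda> \<Longrightarrow> x \<in> carrier (Grp (P 0) v) \<Longrightarrow> \<epsilon>R v (f v x) = \<epsilon>P v x"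
      using projective_lift[OF resolution_projective[OF P] resolution_module[OF R] right_module_const_int
          resolution_aug_map[OF R] resolution_aug_map[OF P]] by metis
    then show "\<exists>f. ok 0 f"
      by (intro exI[of _ f]) (auto simp: ok_def res_cycles_0 module_map_closed[OF f(1)])
  next
    fix f n assume f: "ok n f"
    have fm: "module_map \<Lambda> (P n) (R n) f" using f by (simp add: ok_def)
    have fd: "module_map \<Lambda> (P (Suc n)) (R n) (\<lambda>v. f v \<circ> dP (Suc n) v)"
      by (rule module_map_comp[OF resolution_diff[OF P] fm])
    have "(f v \<circ> dP (Suc n) v) x \<in> dR (Suc n) v ` carrier (Grp (R (Suc n)) v)"
      if "v \<in> Obj \<Lambda>" "x \<in> carrier (Grp (P (Suc n)) v)" for v x
      using f resolution_diff_cycle[OF P that] resolution_exact[OF R that(1), of n] that(1)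
      by (simp add: ok_def)
    from projective_lift[OF resolution_projective[OF P] resolution_module[OF R] resolution_module[OF R]
        resolution_diff[OF R] fd this]
    obtain f' where f': "module_map \<Lambda> (P (Suc n)) (R (Suc n)) f'"
      and eq: "\<And>v x. \<lbrakk>v \<in> Obj \<Lambda>; x \<in> carrier (Grp (P (Suc n)) v)\<rbrakk> \<Longrightarrow>
        dR (Suc n) v (f' v x) = f v (dP (Suc n) v x)" by (metis comp_apply)
    have "f' v x \<in> res_cycles R dR \<epsilon>R (Suc n) v"
      if v: "v \<in> Obj \<Lambda>" and x: "x \<in> res_cycles P dP \<epsilon>P (Suc n) v" for v x
      using x v eq[OF v, of x] module_map_closed[OF f' v, of x]
        group_hom.hom_one[OF module_map_group_hom[OF resolution_module[OF P] resolution_module[OF R] fm v]]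
      by (simp add: res_cycles_Suc)
    with f' eq show "\<exists>f'. ok (Suc n) f' \<and> step n f f'"
      by (intro exI[of _ f']) (auto simp: ok_def step_def)
  qed
  then obtain f where "\<And>n. ok n (f n)" "\<And>n. step n (f n) (f (Suc n))" by blast
  then show ?thesis
    by (intro exI[of _ f]) (auto simp: resolution_map_def ok_def step_def)
qed

lemma resolution_map_comp:
  assumes f: "resolution_map P dP Q dQ f" and g: "resolution_map Q dQ R dR g"
  shows "resolution_map P dP R dR (\<lambda>n v x. g n v (f n v x))"
proof -
  have "module_map \<Lambda> (P n) (R n) (\<lambda>v x. g n v (f n v x))" for n
    using module_map_comp[of "P n" "Q n" "f n" "R n" "g n"] f g by (simp add: resolution_map_def o_def)
  moreover have "f n v x \<in> carrier (Grp (Q n) v)" if "v \<in> Obj \<Lambda>" "x \<in> carrier (Grp (P n) v)" for n v x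
    using module_map_closed[of "P n" "Q n" "f n"] that f by (simp add: resolution_map_def)
  ultimately show ?thesis using f g by (simp add: resolution_map_def)
qed

lemma resolution_map_id: "resolution_map P dP P dP (\<lambda>n v x. x)"
  by (simp add: resolution_map_def module_map_id)

text \<open>
  The difference \<open>\<phi>\<close> of the two maps is shown to be null-homotopic by successive lifting.  The
  property that makes the induction work is \<open>dR (h x) = \<phi> x\<close> for cycles \<open>x\<close>: applied to \<open>dP x\<close> it
  says that \<open>\<phi> x - h (dP x)\<close> is a cycle, hence lifts along the next differential.
\<close>

lemma resolution_map_homotopy:
  fixes P :: "nat \<Rightarrow> ('l, 'p) cmodule" and R :: "nat \<Rightarrow> ('l, 'r) cmodule"
  assumes P: "projective_resolution \<Lambda> P dP \<epsilon>P" and R: "projective_resolution \<Lambda> R dR \<epsilon>R"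
    and f: "resolution_map P dP R dR f" and g: "resolution_map P dP R dR g"
    and aug: "\<And>v x. \<lbrakk>v \<in> Obj \<Lambda>; x \<in> carrier (Grp (P 0) v)\<rbrakk> \<Longrightarrow> \<epsilon>R v (f 0 v x) = \<epsilon>R v (g 0 v x)"
  obtains h where "\<forall>n. module_map \<Lambda> (P n) (R (Suc n)) (h n)"
    and "\<forall>v\<in>Obj \<Lambda>. \<forall>x\<in>carrier (Grp (P 0) v).
      f 0 v x = dR (Suc 0) v (h 0 v x) \<otimes>\<^bsub>Grp (R 0) v\<^esub> g 0 v x"
    and "\<forall>n. \<forall>v\<in>Obj \<Lambda>. \<forall>x\<in>carrier (Grp (P (Suc n)) v). f (Suc n) v x =
      dR (Suc (Suc n)) v (h (Suc n) v x) \<otimes>\<^bsub>Grp (R (Suc n)) v\<^esub>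
        (h n v (dP (Suc n) v x) \<otimes>\<^bsub>Grp (R (Suc n)) v\<^esub> g (Suc n) v x)"
proof -
  note mP = resolution_module[OF P] and mR = resolution_module[OF R]
  define \<phi> where "\<phi> n v x = f n v x \<otimes>\<^bsub>Grp (R n) v\<^esub> inv\<^bsub>Grp (R n) v\<^esub> g n v x" for n v x
  have fm: "module_map \<Lambda> (P n) (R n) (f n)" and gm: "module_map \<Lambda> (P n) (R n) (g n)" for n
    using f g by (auto simp: resolution_map_def)
  have \<phi>m: "module_map \<Lambda> (P n) (R n) (\<phi> n)" for n
    unfolding \<phi>_def by (intro module_map_pointwise_mult module_map_pointwise_inv fm gm mR)
  have \<phi>d: "dR (Suc n) v (\<phi> (Suc n) v x) = \<phi> n v (dP (Suc n) v x)"
    if v: "v \<in> Obj \<Lambda>" and x: "x \<in> carrier (Grp (P (Suc n)) v)" for n v x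
  proof -
    interpret d: group_hom "Grp (R (Suc n)) v" "Grp (R n) v" "dR (Suc n) v"
      by (rule module_map_group_hom[OF mR mR resolution_diff[OF R] v])
    show ?thesis using f g v x module_map_closed[OF fm v x] module_map_closed[OF gm v x]
      by (simp add: \<phi>_def resolution_map_def)
  qed
  have \<phi>0: "\<phi> 0 v x \<in> res_cycles R dR \<epsilon>R 0 v" if v: "v \<in> Obj \<Lambda>" and x: "x \<in> carrier (Grp (P 0) v)" for v x
  proof -
    interpret e: group_hom "Grp (R 0) v" "Grp const_int_module v" "\<epsilon>R v"
      by (rule module_map_group_hom[OF mR right_module_const_int resolution_aug_map[OF R] v])
    have "\<epsilon>R v (\<phi> 0 v x) = \<one>\<^bsub>Grp const_int_module v\<^esub>"
      using aug[OF v x] module_map_closed[OF fm v x] module_map_closed[OF gm v x] by (simp add: \<phi>_def)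
    then show ?thesis using module_map_closed[OF \<phi>m v x] by (simp add: res_cycles_0 const_int_module_def)
  qed
  define ok where "ok n h \<longleftrightarrow> module_map \<Lambda> (P n) (R (Suc n)) h \<and>
      (\<forall>v\<in>Obj \<Lambda>. \<forall>x\<in>res_cycles P dP \<epsilon>P n v. dR (Suc n) v (h v x) = \<phi> n v x) \<and>
      (n = 0 \<longrightarrow> (\<forall>v\<in>Obj \<Lambda>. \<forall>x\<in>carrier (Grp (P 0) v). dR 1 v (h v x) = \<phi> 0 v x))"
    for n and h :: "'l \<Rightarrow> 'p \<Rightarrow> 'r"
  define step where "step n h h' \<longleftrightarrow> (\<forall>v\<in>Obj \<Lambda>. \<forall>x\<in>carrier (Grp (P (Suc n)) v).
      \<phi> (Suc n) v x = dR (Suc (Suc n)) v (h' v x) \<otimes>\<^bsub>Grp (R (Suc n)) v\<^esub> h v (dP (Suc n) v x))"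
    for n and h h' :: "'l \<Rightarrow> 'p \<Rightarrow> 'r"
  have "\<exists>h. \<forall>n. ok n (h n) \<and> step n (h n) (h (Suc n))"
  proof (rule dependent_nat_choice)
    have "\<phi> 0 v x \<in> dR (Suc 0) v ` carrier (Grp (R (Suc 0)) v)"
      if "v \<in> Obj \<Lambda>" "x \<in> carrier (Grp (P 0) v)" for v x
      using \<phi>0[OF that] resolution_exact[OF R that(1), of 0] by simp
    from projective_lift[OF resolution_projective[OF P] mR mR resolution_diff[OF R] \<phi>m this]
    obtain h where "module_map \<Lambda> (P 0) (R (Suc 0)) h"
      "\<And>v x. v \<in> Obj \<Lambda> \<Longrightarrow> x \<in> carrier (Grp (P 0) v) \<Longrightarrow> dR (Suc 0) v (h v x) = \<phi> 0 v x" by blast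
    then show "\<exists>h. ok 0 h" by (intro exI[of _ h]) (auto simp: ok_def res_cycles_carrier)
  next
    fix h n assume h: "ok n h"
    have hm: "module_map \<Lambda> (P n) (R (Suc n)) h" using h by (simp add: ok_def)
    have hd: "module_map \<Lambda> (P (Suc n)) (R (Suc n)) (\<lambda>v x. h v (dP (Suc n) v x))"
      using module_map_comp[OF resolution_diff[OF P] hm] by (simp add: o_def)
    let ?\<psi> = "\<lambda>v x. \<phi> (Suc n) v x \<otimes>\<^bsub>Grp (R (Suc n)) v\<^esub> inv\<^bsub>Grp (R (Suc n)) v\<^esub> h v (dP (Suc n) v x)"
    have \<psi>: "module_map \<Lambda> (P (Suc n)) (R (Suc n)) ?\<psi>"
      by (intro module_map_pointwise_mult module_map_pointwise_inv \<phi>m hd mR)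
    have "?\<psi> v x \<in> dR (Suc (Suc n)) v ` carrier (Grp (R (Suc (Suc n))) v)"
      if v: "v \<in> Obj \<Lambda>" and x: "x \<in> carrier (Grp (P (Suc n)) v)" for v x
    proof -
      interpret d: group_hom "Grp (R (Suc n)) v" "Grp (R n) v" "dR (Suc n) v"
        by (rule module_map_group_hom[OF mR mR resolution_diff[OF R] v])
      have "dR (Suc n) v (h v (dP (Suc n) v x)) = \<phi> n v (dP (Suc n) v x)"
        using h v resolution_diff_cycle[OF P v x] by (simp add: ok_def)
      then have "?\<psi> v x \<in> res_cycles R dR \<epsilon>R (Suc n) v"
        using module_map_closed[OF hd v x] module_map_closed[OF \<phi>m v x] \<phi>d[OF v x]
          module_map_closed[OF \<phi>m v, of _ n]
          res_cycles_carrier[OF resolution_diff_cycle[OF P v x]]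
        by (simp add: res_cycles_Suc)
      then show ?thesis using resolution_exact[OF R v, of "Suc n"] by simp
    qed
    from projective_lift[OF resolution_projective[OF P] mR mR resolution_diff[OF R] \<psi> this]
    obtain h' where h': "module_map \<Lambda> (P (Suc n)) (R (Suc (Suc n))) h'"
      and eq: "\<And>v x. \<lbrakk>v \<in> Obj \<Lambda>; x \<in> carrier (Grp (P (Suc n)) v)\<rbrakk> \<Longrightarrow>
        dR (Suc (Suc n)) v (h' v x) = ?\<psi> v x" by blast
    have st: "\<phi> (Suc n) v x = dR (Suc (Suc n)) v (h' v x) \<otimes>\<^bsub>Grp (R (Suc n)) v\<^esub> h v (dP (Suc n) v x)"
      if v: "v \<in> Obj \<Lambda>" and x: "x \<in> carrier (Grp (P (Suc n)) v)" for v x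
    proof -
      interpret comm_group "Grp (R (Suc n)) v" by (rule right_module_group[OF mR v])
      show ?thesis using eq[OF v x] module_map_closed[OF hd v x] module_map_closed[OF \<phi>m v x]
        by (simp add: m_assoc)
    qed
    have "dR (Suc (Suc n)) v (h' v x) = \<phi> (Suc n) v x"
      if v: "v \<in> Obj \<Lambda>" and x: "x \<in> res_cycles P dP \<epsilon>P (Suc n) v" for v x
    proof -
      interpret comm_group "Grp (R (Suc n)) v" by (rule right_module_group[OF mR v])
      show ?thesis using x eq[OF v, of x] module_map_closed[OF \<phi>m v, of x "Suc n"]
        group_hom.hom_one[OF module_map_group_hom[OF mP mR hm v]]
        by (simp add: res_cycles_Suc)
    qed
    with h' st show "\<exists>h'. ok (Suc n) h' \<and> step n h h'"
      by (intro exI[of _ h']) (auto simp: ok_def step_def)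
  qed
  then obtain h where h: "\<And>n. ok n (h n)" "\<And>n. step n (h n) (h (Suc n))" by blast
  have hm: "module_map \<Lambda> (P n) (R (Suc n)) (h n)" for n using h(1)[of n] by (simp add: ok_def)
  have \<phi>f: "f n v x = \<phi> n v x \<otimes>\<^bsub>Grp (R n) v\<^esub> g n v x"
    if v: "v \<in> Obj \<Lambda>" and x: "x \<in> carrier (Grp (P n) v)" for n v x
  proof -
    interpret comm_group "Grp (R n) v" by (rule right_module_group[OF mR v])
    show ?thesis using module_map_closed[OF fm v x] module_map_closed[OF gm v x] by (simp add: \<phi>_def m_assoc)
  qed
  show thesis
  proof (rule that[of h]; intro allI ballI)
    show "module_map \<Lambda> (P n) (R (Suc n)) (h n)" for n by (rule hm)
    show "f 0 v x = dR (Suc 0) v (h 0 v x) \<otimes>\<^bsub>Grp (R 0) v\<^esub> g 0 v x"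
      if "v \<in> Obj \<Lambda>" "x \<in> carrier (Grp (P 0) v)" for v x
      using h(1)[of 0] \<phi>f[OF that] that by (simp add: ok_def)
    fix n v x assume v: "v \<in> Obj \<Lambda>" and x: "x \<in> carrier (Grp (P (Suc n)) v)"
    interpret comm_group "Grp (R (Suc n)) v" by (rule right_module_group[OF mR v])
    have dx: "dP (Suc n) v x \<in> carrier (Grp (P n) v)"
      by (rule module_map_closed[OF resolution_diff[OF P] v x])
    show "f (Suc n) v x = dR (Suc (Suc n)) v (h (Suc n) v x) \<otimes>\<^bsub>Grp (R (Suc n)) v\<^esub>
        (h n v (dP (Suc n) v x) \<otimes>\<^bsub>Grp (R (Suc n)) v\<^esub> g (Suc n) v x)"
      using h(2)[of n] v x \<phi>f[OF v x] module_map_closed[OF hm v dx] module_map_closed[OF gm v x]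
        module_map_closed[OF resolution_diff[OF R] v module_map_closed[OF hm v x]]
      by (simp add: step_def m_assoc)
  qed
qed

end

section \<open>The tensor product as a functor\<close>

lemma hom_pointwise_mult:
  assumes "comm_group H" "f \<in> hom G H" "g \<in> hom G H"
  shows "(\<lambda>x. f x \<otimes>\<^bsub>H\<^esub> g x) \<in> hom G H"
proof -
  interpret comm_group H by fact
  show ?thesis using assms(2,3) by (intro homI) (auto simp: hom_def Pi_iff m_ac)
qed

context small_category
begin

lemma left_moduleD:
  assumes "left_module \<Lambda> N"
  shows left_module_group: "v \<in> Obj \<Lambda> \<Longrightarrow> comm_group (Grp N v)"
    and left_module_act: "\<mu> \<in> Mor \<Lambda> \<Longrightarrow> Act N \<mu> \<in> hom (Grp N (Src \<Lambda> \<mu>)) (Grp N (Rng \<Lambda> \<mu>))"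
    and left_module_act_closed: "\<lbrakk>\<mu> \<in> Mor \<Lambda>; a \<in> carrier (Grp N (Src \<Lambda> \<mu>))\<rbrakk> \<Longrightarrow> Act N \<mu> a \<in> carrier (Grp N (Rng \<Lambda> \<mu>))"
    and left_module_act_id: "\<lbrakk>v \<in> Obj \<Lambda>; a \<in> carrier (Grp N v)\<rbrakk> \<Longrightarrow> Act N v a = a"
    and left_module_act_Cmp: "\<lbrakk>\<mu> \<in> Mor \<Lambda>; \<nu> \<in> Mor \<Lambda>; Src \<Lambda> \<mu> = Rng \<Lambda> \<nu>; a \<in> carrier (Grp N (Src \<Lambda> \<nu>))\<rbrakk> \<Longrightarrow>
      Act N (Cmp \<Lambda> \<mu> \<nu>) a = Act N \<mu> (Act N \<nu> a)"
  using assms by (auto simp: left_module_def hom_def)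

definition tens :: "('l, 'a) cmodule \<Rightarrow> ('l, 'b) cmodule \<Rightarrow> 'l \<Rightarrow> 'a \<Rightarrow> 'b \<Rightarrow> (('l \<times> 'a \<times> 'b) \<Rightarrow>\<^sub>0 int) set"
  where "tens M N v m a =
    tensor_rel_subgroup \<Lambda> M N #>\<^bsub>free_Abelian_group (tensor_gens \<Lambda> M N)\<^esub> frag_of (v, m, a)"

lemma keys_frag_of_diff2: "\<lbrakk>x \<in> S; y \<in> S; z \<in> S\<rbrakk> \<Longrightarrow> Poly_Mapping.keys (frag_of x - frag_of y - frag_of z) \<subseteq> S"
  and keys_frag_of_diff: "\<lbrakk>x \<in> S; y \<in> S\<rbrakk> \<Longrightarrow> Poly_Mapping.keys (frag_of x - frag_of y) \<subseteq> S"
  using keys_diff[of "frag_of x - frag_of y" "frag_of z"] keys_diff[of "frag_of x" "frag_of y"] by auto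

lemma tensor_relatorsE:
  assumes "x \<in> tensor_relators \<Lambda> M N"
  obtains
    (left) v m m' a where "x = frag_of (v, m \<otimes>\<^bsub>Grp M v\<^esub> m', a) - frag_of (v, m, a) - frag_of (v, m', a)"
      "v \<in> Obj \<Lambda>" "m \<in> carrier (Grp M v)" "m' \<in> carrier (Grp M v)" "a \<in> carrier (Grp N v)"
  | (right) v m a a' where "x = frag_of (v, m, a \<otimes>\<^bsub>Grp N v\<^esub> a') - frag_of (v, m, a) - frag_of (v, m, a')"
      "v \<in> Obj \<Lambda>" "m \<in> carrier (Grp M v)" "a \<in> carrier (Grp N v)" "a' \<in> carrier (Grp N v)"
  | (balanced) \<mu> m a where "x = frag_of (Src \<Lambda> \<mu>, Act M \<mu> m, a) - frag_of (Rng \<Lambda> \<mu>, m, Act N \<mu> a)"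
      "\<mu> \<in> Mor \<Lambda>" "m \<in> carrier (Grp M (Rng \<Lambda> \<mu>))" "a \<in> carrier (Grp N (Src \<Lambda> \<mu>))"
  using assms unfolding tensor_relators_def by blast

lemma tensor_relators_closed:
  assumes M: "right_module \<Lambda> M" and N: "left_module \<Lambda> N"
  shows "tensor_relators \<Lambda> M N \<subseteq> carrier (free_Abelian_group (tensor_gens \<Lambda> M N))"
proof -
  have "m \<otimes>\<^bsub>Grp M v\<^esub> m' \<in> carrier (Grp M v)"
    if "v \<in> Obj \<Lambda>" "m \<in> carrier (Grp M v)" "m' \<in> carrier (Grp M v)" for v m m'
    using right_module_group[OF M that(1)] that
    by (simp add: comm_group_def comm_monoid_def monoid.m_closed)
  moreover have "a \<otimes>\<^bsub>Grp N v\<^esub> a' \<in> carrier (Grp N v)"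
    if "v \<in> Obj \<Lambda>" "a \<in> carrier (Grp N v)" "a' \<in> carrier (Grp N v)" for v a a'
    using left_module_group[OF N that(1)] that
    by (simp add: comm_group_def comm_monoid_def monoid.m_closed)
  ultimately have "Poly_Mapping.keys x \<subseteq> tensor_gens \<Lambda> M N" if "x \<in> tensor_relators \<Lambda> M N" for x
    using that
    by (elim tensor_relatorsE; hypsubst; intro keys_frag_of_diff2 keys_frag_of_diff)
      (simp_all add: tensor_gens_def Src_Obj Rng_Obj right_module_act_closed[OF M] left_module_act_closed[OF N])
  then show ?thesis by (simp add: subset_iff)
qed

lemma tensor_rel_subgroup:
  assumes M: "right_module \<Lambda> M" and N: "left_module \<Lambda> N"
  shows "subgroup (tensor_rel_subgroup \<Lambda> M N) (free_Abelian_group (tensor_gens \<Lambda> M N))"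
    and "normal (tensor_rel_subgroup \<Lambda> M N) (free_Abelian_group (tensor_gens \<Lambda> M N))"
proof -
  show *: "subgroup (tensor_rel_subgroup \<Lambda> M N) (free_Abelian_group (tensor_gens \<Lambda> M N))"
    unfolding tensor_rel_subgroup_def
    by (rule group.generate_is_subgroup[OF group_free_Abelian_group tensor_relators_closed[OF M N]])
  show "normal (tensor_rel_subgroup \<Lambda> M N) (free_Abelian_group (tensor_gens \<Lambda> M N))"
    by (rule comm_group.subgroup_imp_normal[OF abelian_free_Abelian_group *])
qed

lemma comm_group_tensor:
  assumes "right_module \<Lambda> M" "left_module \<Lambda> N"
  shows "comm_group (tensor_group \<Lambda> M N)"
  unfolding tensor_group_def
  by (rule comm_group.abelian_FactGroup[OF abelian_free_Abelian_group tensor_rel_subgroup(1)[OF assms]])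

lemma tensor_coset_hom:
  assumes "right_module \<Lambda> M" "left_module \<Lambda> N"
  shows "(\<lambda>c. tensor_rel_subgroup \<Lambda> M N #>\<^bsub>free_Abelian_group (tensor_gens \<Lambda> M N)\<^esub> c) \<in>
    hom (free_Abelian_group (tensor_gens \<Lambda> M N)) (tensor_group \<Lambda> M N)"
  unfolding tensor_group_def by (rule normal.r_coset_hom_Mod[OF tensor_rel_subgroup(2)[OF assms]])

lemma tensor_cosetE:
  assumes "X \<in> carrier (tensor_group \<Lambda> M N)"
  obtains c where "Poly_Mapping.keys c \<subseteq> tensor_gens \<Lambda> M N"
    "X = tensor_rel_subgroup \<Lambda> M N #>\<^bsub>free_Abelian_group (tensor_gens \<Lambda> M N)\<^esub> c"
  using assms by (auto simp: tensor_group_def FactGroup_def RCOSETS_def)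

lemma tens_closed:
  assumes "right_module \<Lambda> M" "left_module \<Lambda> N" "v \<in> Obj \<Lambda>" "m \<in> carrier (Grp M v)" "a \<in> carrier (Grp N v)"
  shows "tens M N v m a \<in> carrier (tensor_group \<Lambda> M N)"
  unfolding tens_def
  by (rule hom_in_carrier[OF tensor_coset_hom[OF assms(1,2)]]) (use assms in \<open>simp add: tensor_gens_def\<close>)

lemma tensor_coset_eqI:
  assumes M: "right_module \<Lambda> M" and N: "left_module \<Lambda> N"
    and xy: "x - y \<in> tensor_relators \<Lambda> M N" and y: "Poly_Mapping.keys y \<subseteq> tensor_gens \<Lambda> M N"
  shows "tensor_rel_subgroup \<Lambda> M N #>\<^bsub>free_Abelian_group (tensor_gens \<Lambda> M N)\<^esub> x =
    tensor_rel_subgroup \<Lambda> M N #>\<^bsub>free_Abelian_group (tensor_gens \<Lambda> M N)\<^esub> y"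
proof -
  let ?F = "free_Abelian_group (tensor_gens \<Lambda> M N)"
  have "x - y \<in> tensor_rel_subgroup \<Lambda> M N"
    using xy unfolding tensor_rel_subgroup_def by (rule generate.incl)
  then have "(x - y) \<otimes>\<^bsub>?F\<^esub> y \<in> tensor_rel_subgroup \<Lambda> M N #>\<^bsub>?F\<^esub> y"
    unfolding r_coset_def by blast
  then have "x \<in> tensor_rel_subgroup \<Lambda> M N #>\<^bsub>?F\<^esub> y" by simp
  from group.repr_independence[OF group_free_Abelian_group this _ tensor_rel_subgroup(1)[OF M N]] y
  show ?thesis by simp
qed

lemma tens_mult_left:
  assumes M: "right_module \<Lambda> M" and N: "left_module \<Lambda> N" and v: "v \<in> Obj \<Lambda>"
    and m: "m \<in> carrier (Grp M v)" "m' \<in> carrier (Grp M v)" and a: "a \<in> carrier (Grp N v)"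
  shows "tens M N v (m \<otimes>\<^bsub>Grp M v\<^esub> m') a = tens M N v m a \<otimes>\<^bsub>tensor_group \<Lambda> M N\<^esub> tens M N v m' a"
proof -
  have "frag_of (v, m \<otimes>\<^bsub>Grp M v\<^esub> m', a) - (frag_of (v, m, a) + frag_of (v, m', a)) \<in> tensor_relators \<Lambda> M N"
    unfolding tensor_relators_def diff_diff_eq[symmetric] using v m a by blast
  from tensor_coset_eqI[OF M N this] hom_mult[OF tensor_coset_hom[OF M N], of "frag_of (v, m, a)" "frag_of (v, m', a)"]
  show ?thesis using v m a keys_add[of "frag_of (v, m, a)" "frag_of (v, m', a)"]
    by (auto simp: tens_def tensor_gens_def)
qed

lemma tens_mult_right:
  assumes M: "right_module \<Lambda> M" and N: "left_module \<Lambda> N" and v: "v \<in> Obj \<Lambda>"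
    and m: "m \<in> carrier (Grp M v)" and a: "a \<in> carrier (Grp N v)" "a' \<in> carrier (Grp N v)"
  shows "tens M N v m (a \<otimes>\<^bsub>Grp N v\<^esub> a') = tens M N v m a \<otimes>\<^bsub>tensor_group \<Lambda> M N\<^esub> tens M N v m a'"
proof -
  have "frag_of (v, m, a \<otimes>\<^bsub>Grp N v\<^esub> a') - (frag_of (v, m, a) + frag_of (v, m, a')) \<in> tensor_relators \<Lambda> M N"
    unfolding tensor_relators_def diff_diff_eq[symmetric] using v m a by blast
  from tensor_coset_eqI[OF M N this] hom_mult[OF tensor_coset_hom[OF M N], of "frag_of (v, m, a)" "frag_of (v, m, a')"]
  show ?thesis using v m a keys_add[of "frag_of (v, m, a)" "frag_of (v, m, a')"]
    by (auto simp: tens_def tensor_gens_def)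
qed

lemma tens_balanced:
  assumes M: "right_module \<Lambda> M" and N: "left_module \<Lambda> N" and \<mu>: "\<mu> \<in> Mor \<Lambda>"
    and m: "m \<in> carrier (Grp M (Rng \<Lambda> \<mu>))" and a: "a \<in> carrier (Grp N (Src \<Lambda> \<mu>))"
  shows "tens M N (Src \<Lambda> \<mu>) (Act M \<mu> m) a = tens M N (Rng \<Lambda> \<mu>) m (Act N \<mu> a)"
proof -
  have "frag_of (Src \<Lambda> \<mu>, Act M \<mu> m, a) - frag_of (Rng \<Lambda> \<mu>, m, Act N \<mu> a) \<in> tensor_relators \<Lambda> M N"
    unfolding tensor_relators_def using \<mu> m a by blast
  from tensor_coset_eqI[OF M N this] show ?thesis
    using \<mu> m a by (simp add: tens_def tensor_gens_def Rng_Obj left_module_act_closed[OF N])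
qed

lemma tens_homs:
  assumes M: "right_module \<Lambda> M" and N: "left_module \<Lambda> N" and v: "v \<in> Obj \<Lambda>"
  shows tens_hom_left: "a \<in> carrier (Grp N v) \<Longrightarrow> (\<lambda>m. tens M N v m a) \<in> hom (Grp M v) (tensor_group \<Lambda> M N)"
    and tens_hom_right: "m \<in> carrier (Grp M v) \<Longrightarrow> (\<lambda>a. tens M N v m a) \<in> hom (Grp N v) (tensor_group \<Lambda> M N)"
  using assms by (auto intro!: homI simp: tens_closed tens_mult_left tens_mult_right)

text \<open>
  The tensor product is generated by the classes \<open>tens M N v m a\<close>.
\<close>

lemma tensor_hom_eqI:
  assumes M: "right_module \<Lambda> M" and N: "left_module \<Lambda> N" and G: "group G"
    and h: "h \<in> hom (tensor_group \<Lambda> M N) G" and h': "h' \<in> hom (tensor_group \<Lambda> M N) G"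
    and eq: "\<And>v m a. \<lbrakk>v \<in> Obj \<Lambda>; m \<in> carrier (Grp M v); a \<in> carrier (Grp N v)\<rbrakk> \<Longrightarrow>
      h (tens M N v m a) = h' (tens M N v m a)"
    and X: "X \<in> carrier (tensor_group \<Lambda> M N)"
  shows "h X = h' X"
proof -
  obtain c where c: "Poly_Mapping.keys c \<subseteq> tensor_gens \<Lambda> M N"
    and Xc: "X = tensor_rel_subgroup \<Lambda> M N #>\<^bsub>free_Abelian_group (tensor_gens \<Lambda> M N)\<^esub> c"
    using tensor_cosetE[OF X] .
  show ?thesis unfolding Xc
    by (rule hom_free_Abelian_group_eqI[OF G, where h = "\<lambda>c. h (_ c)" and h' = "\<lambda>c. h' (_ c)"])
      (use c eq hom_compose[OF tensor_coset_hom[OF M N] h] hom_compose[OF tensor_coset_hom[OF M N] h']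
        in \<open>auto simp: o_def tensor_gens_def tens_def\<close>)
qed

lemma tensor_universal:
  assumes M: "right_module \<Lambda> M" and N: "left_module \<Lambda> N" and G: "comm_group G"
    and \<beta>: "\<And>v m a. \<lbrakk>v \<in> Obj \<Lambda>; m \<in> carrier (Grp M v); a \<in> carrier (Grp N v)\<rbrakk> \<Longrightarrow> \<beta> v m a \<in> carrier G"
    and \<beta>1: "\<And>v m m' a. \<lbrakk>v \<in> Obj \<Lambda>; m \<in> carrier (Grp M v); m' \<in> carrier (Grp M v); a \<in> carrier (Grp N v)\<rbrakk> \<Longrightarrow>
      \<beta> v (m \<otimes>\<^bsub>Grp M v\<^esub> m') a = \<beta> v m a \<otimes>\<^bsub>G\<^esub> \<beta> v m' a"
    and \<beta>2: "\<And>v m a a'. \<lbrakk>v \<in> Obj \<Lambda>; m \<in> carrier (Grp M v); a \<in> carrier (Grp N v); a' \<in> carrier (Grp N v)\<rbrakk> \<Longrightarrow>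
      \<beta> v m (a \<otimes>\<^bsub>Grp N v\<^esub> a') = \<beta> v m a \<otimes>\<^bsub>G\<^esub> \<beta> v m a'"
    and \<beta>3: "\<And>\<mu> m a. \<lbrakk>\<mu> \<in> Mor \<Lambda>; m \<in> carrier (Grp M (Rng \<Lambda> \<mu>)); a \<in> carrier (Grp N (Src \<Lambda> \<mu>))\<rbrakk> \<Longrightarrow>
      \<beta> (Src \<Lambda> \<mu>) (Act M \<mu> m) a = \<beta> (Rng \<Lambda> \<mu>) m (Act N \<mu> a)"
  obtains h where "h \<in> hom (tensor_group \<Lambda> M N) G"
    "\<And>v m a. \<lbrakk>v \<in> Obj \<Lambda>; m \<in> carrier (Grp M v); a \<in> carrier (Grp N v)\<rbrakk> \<Longrightarrow> h (tens M N v m a) = \<beta> v m a"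
proof -
  interpret G: comm_group G by fact
  let ?S = "tensor_gens \<Lambda> M N"
  let ?F = "free_Abelian_group ?S"
  have "(\<lambda>(v, m, a). \<beta> v m a) ` ?S \<subseteq> carrier G" using \<beta> by (auto simp: tensor_gens_def)
  from G.free_Abelian_group_universal[OF this] obtain k where k: "k \<in> hom ?F G"
    and kg: "\<And>x. x \<in> ?S \<Longrightarrow> k (frag_of x) = (\<lambda>(v, m, a). \<beta> v m a) x" by metis
  interpret k: group_hom ?F G k using k by (simp add: group_hom_def group_hom_axioms_def)
  have kd: "k (x - y) = k x \<otimes>\<^bsub>G\<^esub> inv\<^bsub>G\<^esub> k y" 
    if "Poly_Mapping.keys x \<subseteq> ?S" "Poly_Mapping.keys y \<subseteq> ?S" for x y
    using k.hom_mult[of x "- y"] k.hom_inv[of y] that by simp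
  have k': "k (frag_of (v, m, a)) = \<beta> v m a"
    if "v \<in> Obj \<Lambda>" "m \<in> carrier (Grp M v)" "a \<in> carrier (Grp N v)" for v m a
    using kg[of "(v, m, a)"] that by (simp add: tensor_gens_def)
  have mM: "m \<otimes>\<^bsub>Grp M v\<^esub> m' \<in> carrier (Grp M v)"
    if "v \<in> Obj \<Lambda>" "m \<in> carrier (Grp M v)" "m' \<in> carrier (Grp M v)" for v m m'
    using right_module_group[OF M that(1)] that by (simp add: comm_group_def comm_monoid_def monoid.m_closed)
  have mN: "a \<otimes>\<^bsub>Grp N v\<^esub> a' \<in> carrier (Grp N v)"
    if "v \<in> Obj \<Lambda>" "a \<in> carrier (Grp N v)" "a' \<in> carrier (Grp N v)" for v a a'
    using left_module_group[OF N that(1)] that by (simp add: comm_group_def comm_monoid_def monoid.m_closed)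
  have gen: "(v, m, a) \<in> ?S" if "v \<in> Obj \<Lambda>" "m \<in> carrier (Grp M v)" "a \<in> carrier (Grp N v)" for v m a
    using that by (simp add: tensor_gens_def)
  have kdd: "k (frag_of x - frag_of y - frag_of z) = k (frag_of x) \<otimes>\<^bsub>G\<^esub> inv\<^bsub>G\<^esub> k (frag_of y) \<otimes>\<^bsub>G\<^esub> inv\<^bsub>G\<^esub> k (frag_of z)"
    if "x \<in> ?S" "y \<in> ?S" "z \<in> ?S" for x y z
    using that kd[of "frag_of x - frag_of y" "frag_of z"] kd[of "frag_of x" "frag_of y"] keys_frag_of_diff[of x ?S y] by simp
  have canc: "(p \<otimes>\<^bsub>G\<^esub> q) \<otimes>\<^bsub>G\<^esub> inv\<^bsub>G\<^esub> p \<otimes>\<^bsub>G\<^esub> inv\<^bsub>G\<^esub> q = \<one>\<^bsub>G\<^esub>" if "p \<in> carrier G" "q \<in> carrier G" for p q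
    using that by (metis G.inv_closed G.m_assoc G.m_comm G.m_closed G.r_inv G.r_one)
  have "k x = \<one>\<^bsub>G\<^esub>" if "x \<in> tensor_relators \<Lambda> M N" for x
  proof -
    from that show ?thesis
    proof (cases rule: tensor_relatorsE)
      case left
      then show ?thesis
        by (simp add: kdd gen mM k' \<beta>1 canc \<beta>)
    next
      case right
      then show ?thesis
        by (simp add: kdd gen mN k' \<beta>2 canc \<beta>)
    next
      case balanced
      then show ?thesis
        by (simp add: kd gen k' \<beta>3 Src_Obj Rng_Obj right_module_act_closed[OF M] left_module_act_closed[OF N] \<beta>)
    qed
  qed
  then have "tensor_relators \<Lambda> M N \<subseteq> kernel ?F G k"
    using tensor_relators_closed[OF M N] by (auto simp: kernel_def simp del: carrier_free_Abelian_group_iff)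
  then have "tensor_rel_subgroup \<Lambda> M N \<subseteq> kernel ?F G k"
    unfolding tensor_rel_subgroup_def by (rule k.G.generate_subgroup_incl[OF _ k.subgroup_kernel])
  from k.FactGroup_universal_kernel[OF tensor_rel_subgroup(2)[OF M N] this]
  obtain h where "h \<in> hom (tensor_group \<Lambda> M N) G"
    "\<And>x. x \<in> carrier ?F \<Longrightarrow> h (tensor_rel_subgroup \<Lambda> M N #>\<^bsub>?F\<^esub> x) = k x"
    unfolding tensor_group_def by metis
  then show thesis using that[of h] k' gen by (simp add: tens_def)
qed

text \<open>
  The map \<open>\<phi> \<otimes> id\<close> for modules with elements in different types; \<open>tensor_map\<close> is the instance with
  equal types.
\<close>

definition tensor_induced ::
    "('l, 'b) cmodule \<Rightarrow> ('l, 'c) cmodule \<Rightarrow> ('l \<Rightarrow> 'a \<Rightarrow> 'b) \<Rightarrow>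
     (('l \<times> 'a \<times> 'c) \<Rightarrow>\<^sub>0 int) set \<Rightarrow> (('l \<times> 'b \<times> 'c) \<Rightarrow>\<^sub>0 int) set"
  where "tensor_induced M' N \<phi> X =
    the_elem ((\<lambda>c. tensor_rel_subgroup \<Lambda> M' N #>\<^bsub>free_Abelian_group (tensor_gens \<Lambda> M' N)\<^esub>
                    frag_extend (\<lambda>(v, m, a). frag_of (v, \<phi> v m, a)) c) ` X)"

lemma tensor_map_eq_induced: "tensor_map \<Lambda> M' N \<phi> = tensor_induced M' N \<phi>"
  by (simp add: tensor_map_def tensor_induced_def fun_eq_iff)

text \<open>
  The formula for \<open>tensor_induced\<close> is constant on each coset, with the value of the homomorphism that
  the universal property provides.
\<close>

lemma tensor_induced:
  assumes M: "right_module \<Lambda> M" and M': "right_module \<Lambda> M'" and N: "left_module \<Lambda> N"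
    and \<phi>: "module_map \<Lambda> M M' \<phi>"
  shows tensor_induced_hom: "tensor_induced M' N \<phi> \<in> hom (tensor_group \<Lambda> M N) (tensor_group \<Lambda> M' N)"
    and tensor_induced_tens: "\<lbrakk>v \<in> Obj \<Lambda>; m \<in> carrier (Grp M v); a \<in> carrier (Grp N v)\<rbrakk> \<Longrightarrow>
      tensor_induced M' N \<phi> (tens M N v m a) = tens M' N v (\<phi> v m) a"
proof -
  let ?F = "free_Abelian_group (tensor_gens \<Lambda> M N)" and ?F' = "free_Abelian_group (tensor_gens \<Lambda> M' N)"
  let ?T = "tensor_rel_subgroup \<Lambda> M N" and ?T' = "tensor_rel_subgroup \<Lambda> M' N"
  let ?k = "frag_extend (\<lambda>(v, m, a). frag_of (v, \<phi> v m, a))"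
  obtain h where h: "h \<in> hom (tensor_group \<Lambda> M N) (tensor_group \<Lambda> M' N)"
    and ht: "\<And>v m a. \<lbrakk>v \<in> Obj \<Lambda>; m \<in> carrier (Grp M v); a \<in> carrier (Grp N v)\<rbrakk> \<Longrightarrow>
        h (tens M N v m a) = tens M' N v (\<phi> v m) a"
    by (rule tensor_universal[OF M N comm_group_tensor[OF M' N], of "\<lambda>v m a. tens M' N v (\<phi> v m) a"])
      (simp_all add: module_mapD[OF \<phi>] tens_closed[OF M' N] tens_mult_left[OF M' N]
        tens_mult_right[OF M' N] tens_balanced[OF M' N] Rng_Obj)
  have k: "?k \<in> hom ?F ?F'"
    by (rule frag_extend_hom_free) (auto simp: tensor_gens_def module_map_closed[OF \<phi>])
  have hk: "h (?T #>\<^bsub>?F\<^esub> c) = ?T' #>\<^bsub>?F'\<^esub> ?k c" if c: "c \<in> carrier ?F" for c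
  proof (rule hom_free_Abelian_group_eqI[OF comm_group.axioms(2)[OF comm_group_tensor[OF M' N]]
        _ _ _ c, where h = "\<lambda>c. h (_ c)" and h' = "\<lambda>c. r_coset _ _ (_ c)"])
    show "(\<lambda>c. h (?T #>\<^bsub>?F\<^esub> c)) \<in> hom ?F (tensor_group \<Lambda> M' N)"
      by (rule hom_compose[OF tensor_coset_hom[OF M N] h, unfolded comp_def])
    show "(\<lambda>c. ?T' #>\<^bsub>?F'\<^esub> ?k c) \<in> hom ?F (tensor_group \<Lambda> M' N)"
      by (rule hom_compose[OF k tensor_coset_hom[OF M' N], unfolded comp_def])
    show "h (?T #>\<^bsub>?F\<^esub> frag_of x) = ?T' #>\<^bsub>?F'\<^esub> ?k (frag_of x)" if "x \<in> tensor_gens \<Lambda> M N" for x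
      using that ht by (auto simp: tensor_gens_def tens_def)
  qed
  \<comment> \<open>All elements of the coset have the same image, and there is at least one element.\<close>
  have ind: "h X = tensor_induced M' N \<phi> X" if X: "X \<in> carrier (tensor_group \<Lambda> M N)" for X
  proof -
    obtain c where c: "c \<in> carrier ?F" "X = ?T #>\<^bsub>?F\<^esub> c"
      using tensor_cosetE[OF X] by (metis carrier_free_Abelian_group_iff)
    have "?T' #>\<^bsub>?F'\<^esub> ?k c' = h X" if c': "c' \<in> X" for c'
    proof -
      have "?T #>\<^bsub>?F\<^esub> c = ?T #>\<^bsub>?F\<^esub> c'"
        using group.repr_independence[OF group_free_Abelian_group _ c(1) tensor_rel_subgroup(1)[OF M N]] c' c(2)
        by simp
      moreover have "c' \<in> carrier ?F"
        using c' c monoid.r_coset_subset_G[OF group.is_monoid[OF group_free_Abelian_group]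
            subgroup.subset[OF tensor_rel_subgroup(1)[OF M N]] c(1)] by blast
      ultimately show ?thesis using hk[of c'] c(2) by simp
    qed
    moreover have "c \<in> X"
      using group.rcos_self[OF group_free_Abelian_group c(1) tensor_rel_subgroup(1)[OF M N]] c(2) by simp
    ultimately have "(\<lambda>c. ?T' #>\<^bsub>?F'\<^esub> ?k c) ` X = {h X}" by (auto simp: image_iff)
    then show ?thesis by (simp add: tensor_induced_def)
  qed
  show "tensor_induced M' N \<phi> \<in> hom (tensor_group \<Lambda> M N) (tensor_group \<Lambda> M' N)"
    using comm_group_tensor[OF M N] by (intro group.hom_restrict[OF _ h ind]) (simp add: comm_group_def)
  show "tensor_induced M' N \<phi> (tens M N v m a) = tens M' N v (\<phi> v m) a"
    if "v \<in> Obj \<Lambda>" "m \<in> carrier (Grp M v)" "a \<in> carrier (Grp N v)"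
    using ind[OF tens_closed[OF M N that]] ht[OF that] by simp
qed

lemma tensor_induced_comp:
  assumes L: "right_module \<Lambda> L" and M: "right_module \<Lambda> M" and M': "right_module \<Lambda> M'"
    and N: "left_module \<Lambda> N"
    and \<phi>: "module_map \<Lambda> L M \<phi>" and \<psi>: "module_map \<Lambda> M M' \<psi>" and X: "X \<in> carrier (tensor_group \<Lambda> L N)"
  shows "tensor_induced M' N \<psi> (tensor_induced M N \<phi> X) = tensor_induced M' N (\<lambda>v x. \<psi> v (\<phi> v x)) X"
proof -
  have c: "module_map \<Lambda> L M' (\<lambda>v x. \<psi> v (\<phi> v x))"
    using module_map_comp[OF \<phi> \<psi>] by (simp add: o_def)
  note h = tensor_induced_hom[OF L M N \<phi>] tensor_induced_hom[OF M M' N \<psi>] tensor_induced_hom[OF L M' N c]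
  show ?thesis
    by (rule tensor_hom_eqI[OF L N comm_group.axioms(2)[OF comm_group_tensor[OF M' N]]
          hom_compose[OF h(1,2), unfolded comp_def] h(3) _ X])
      (simp add: tensor_induced_tens[OF L M N \<phi>] tensor_induced_tens[OF M M' N \<psi>]
        tensor_induced_tens[OF L M' N c] module_map_closed[OF \<phi>])
qed

lemma tensor_induced_mult:
  assumes M: "right_module \<Lambda> M" and M': "right_module \<Lambda> M'" and N: "left_module \<Lambda> N"
    and \<phi>: "module_map \<Lambda> M M' \<phi>" and \<psi>: "module_map \<Lambda> M M' \<psi>" and X: "X \<in> carrier (tensor_group \<Lambda> M N)"
  shows "tensor_induced M' N (\<lambda>v x. \<phi> v x \<otimes>\<^bsub>Grp M' v\<^esub> \<psi> v x) X =
    tensor_induced M' N \<phi> X \<otimes>\<^bsub>tensor_group \<Lambda> M' N\<^esub> tensor_induced M' N \<psi> X"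
proof -
  note m = module_map_pointwise_mult[OF M' \<phi> \<psi>]
  show ?thesis
    by (rule tensor_hom_eqI[OF M N comm_group.axioms(2)[OF comm_group_tensor[OF M' N]]
          tensor_induced_hom[OF M M' N m]
          hom_pointwise_mult[OF comm_group_tensor[OF M' N] tensor_induced_hom[OF M M' N \<phi>] tensor_induced_hom[OF M M' N \<psi>]] _ X])
      (simp add: tensor_induced_tens[OF M M' N \<phi>] tensor_induced_tens[OF M M' N \<psi>]
        tensor_induced_tens[OF M M' N m] module_map_closed[OF \<phi>] module_map_closed[OF \<psi>] tens_mult_left[OF M' N])
qed

lemma tensor_induced_cong:
  assumes M: "right_module \<Lambda> M" and M': "right_module \<Lambda> M'" and N: "left_module \<Lambda> N"
    and \<phi>: "module_map \<Lambda> M M' \<phi>" and \<psi>: "module_map \<Lambda> M M' \<psi>"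
    and eq: "\<And>v m. \<lbrakk>v \<in> Obj \<Lambda>; m \<in> carrier (Grp M v)\<rbrakk> \<Longrightarrow> \<phi> v m = \<psi> v m"
    and X: "X \<in> carrier (tensor_group \<Lambda> M N)"
  shows "tensor_induced M' N \<phi> X = tensor_induced M' N \<psi> X"
  by (rule tensor_hom_eqI[OF M N comm_group.axioms(2)[OF comm_group_tensor[OF M' N]]
        tensor_induced_hom[OF M M' N \<phi>] tensor_induced_hom[OF M M' N \<psi>] _ X])
    (simp add: tensor_induced_tens[OF M M' N \<phi>] tensor_induced_tens[OF M M' N \<psi>] eq)

lemma tensor_induced_id:
  assumes M: "right_module \<Lambda> M" and N: "left_module \<Lambda> N" and X: "X \<in> carrier (tensor_group \<Lambda> M N)"
  shows "tensor_induced M N (\<lambda>v x. x) X = X"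
  by (rule tensor_hom_eqI[OF M N comm_group.axioms(2)[OF comm_group_tensor[OF M N]]
        tensor_induced_hom[OF M M N module_map_id] _ _ X])
    (auto simp: tensor_induced_tens[OF M M N module_map_id] hom_def)

lemma tensor_induced_const_one:
  assumes M: "right_module \<Lambda> M" and M': "right_module \<Lambda> M'" and N: "left_module \<Lambda> N"
    and X: "X \<in> carrier (tensor_group \<Lambda> M N)"
  shows "tensor_induced M' N (\<lambda>v x. \<one>\<^bsub>Grp M' v\<^esub>) X = \<one>\<^bsub>tensor_group \<Lambda> M' N\<^esub>"
proof -
  note o = module_map_const_one[OF M', of M]
  have G: "group (tensor_group \<Lambda> M' N)" using comm_group_tensor[OF M' N] by (simp add: comm_group_def)
  have "tens M' N v \<one>\<^bsub>Grp M' v\<^esub> a = \<one>\<^bsub>tensor_group \<Lambda> M' N\<^esub>" if v: "v \<in> Obj \<Lambda>" "a \<in> carrier (Grp N v)" for v a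
    using hom_one[OF tens_hom_left[OF M' N v]] right_module_group[OF M' v(1)] G by (simp add: comm_group_def)
  then show ?thesis
    by (intro tensor_hom_eqI[OF M N G tensor_induced_hom[OF M M' N o] _ _ X, where h' = "\<lambda>_. \<one>\<^bsub>tensor_group \<Lambda> M' N\<^esub>"])
      (use G in \<open>auto simp: hom_def group_def tensor_induced_tens[OF M M' N o]\<close>)
qed

end

section \<open>Independence of homology from the resolution\<close>

lemma int_pos_Suc: "\<not> n \<le> 0 \<Longrightarrow> \<exists>m. n = int (Suc m)"
  using zero_less_imp_eq_int[of n] gr0_conv_Suc by auto

lemma int_neg_zero_Suc: "n < 0 \<or> n = int 0 \<or> (\<exists>m. n = int (Suc m))"
  using int_pos_Suc[of n] by force

context small_category
begin

lemma cat_chain_simps: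
  "n < 0 \<Longrightarrow> cat_chain \<Lambda> R N n = singleton_group undefined"
  "cat_chain \<Lambda> R N (int m) = tensor_group \<Lambda> (R m) N"
  "n \<le> 0 \<Longrightarrow> cat_boundary \<Lambda> R d N n X = \<one>\<^bsub>cat_chain \<Lambda> R N (n - 1)\<^esub>"
  "cat_boundary \<Lambda> R d N (int (Suc m)) = tensor_induced (R m) N (d (Suc m))"
  by (auto simp: cat_chain_def cat_boundary_def tensor_map_eq_induced fun_eq_iff nat_add_distrib)

context
  fixes N :: "('l, 'b) cmodule"
  assumes N: "left_module \<Lambda> N"
begin

lemma cat_chain_complex:
  assumes R: "projective_resolution \<Lambda> R d \<epsilon>"
  shows "chain_complex (cat_chain \<Lambda> R N) (cat_boundary \<Lambda> R d N)"
  unfolding chain_complex_def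
proof (intro conjI allI ballI)
  note mR = resolution_module[OF R] and dR = resolution_diff[OF R]
  show cg: "comm_group (cat_chain \<Lambda> R N n)" for n
    using comm_group_tensor[OF mR N] singleton_abelian_group by (simp add: cat_chain_def)
  show hom: "cat_boundary \<Lambda> R d N n \<in> hom (cat_chain \<Lambda> R N n) (cat_chain \<Lambda> R N (n - 1))" for n
  proof (cases "n \<le> 0")
    case True
    interpret comm_group "cat_chain \<Lambda> R N (n - 1)" by (rule cg)
    show ?thesis by (rule homI) (simp_all add: cat_chain_simps(3)[OF True])
  next
    case False
    then obtain m where n: "n = int (Suc m)" using int_pos_Suc by blast
    then have "n - 1 = int m" by simp
    then show ?thesis unfolding n
      using tensor_induced_hom[OF mR mR N dR] by (simp only: cat_chain_simps)
  qed
  show "cat_boundary \<Lambda> R d N n (cat_boundary \<Lambda> R d N (n + 1) x) = \<one>\<^bsub>cat_chain \<Lambda> R N (n - 1)\<^esub>"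
    if x: "x \<in> carrier (cat_chain \<Lambda> R N (n + 1))" for n x
  proof (cases "n \<le> 0")
    case True
    then show ?thesis by (simp add: cat_chain_simps)
  next
    case False
    then obtain m where n: "n = int (Suc m)" using int_pos_Suc by blast
    then have n': "n - 1 = int m" "n + 1 = int (Suc (Suc m))" by simp_all
    have x: "x \<in> carrier (tensor_group \<Lambda> (R (Suc (Suc m))) N)" using x by (simp only: n' cat_chain_simps)
    have dd: "module_map \<Lambda> (R (Suc (Suc m))) (R m) (\<lambda>v y. d (Suc m) v (d (Suc (Suc m)) v y))"
      using module_map_comp[OF dR dR] by (simp add: o_def)
    have "tensor_induced (R m) N (d (Suc m)) (tensor_induced (R (Suc m)) N (d (Suc (Suc m))) x) =
        tensor_induced (R m) N (\<lambda>v y. \<one>\<^bsub>Grp (R m) v\<^esub>) x"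
      unfolding tensor_induced_comp[OF mR mR mR N dR dR x]
      by (rule tensor_induced_cong[OF mR mR N dd module_map_const_one[OF mR] _ x])
        (rule resolution_diff_diff[OF R])
    also have "\<dots> = \<one>\<^bsub>tensor_group \<Lambda> (R m) N\<^esub>" by (rule tensor_induced_const_one[OF mR mR N x])
    finally show ?thesis unfolding n'(1) unfolding n'(2) unfolding n by (simp only: cat_chain_simps)
  qed
qed

text \<open>
  In negative degrees the complexes consist of \<open>singleton_group undefined\<close>, whence the value
  \<open>undefined\<close>.
\<close>

definition cat_chain_map :: "(nat \<Rightarrow> ('l, 'r) cmodule) \<Rightarrow> (nat \<Rightarrow> 'l \<Rightarrow> 'p \<Rightarrow> 'r) \<Rightarrow> int \<Rightarrow>
    (('l \<times> 'p \<times> 'b) \<Rightarrow>\<^sub>0 int) set \<Rightarrow> (('l \<times> 'r \<times> 'b) \<Rightarrow>\<^sub>0 int) set"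
  where "cat_chain_map R f n = (if n < 0 then (\<lambda>_. undefined) else tensor_induced (R (nat n)) N (f (nat n)))"

lemma cat_chain_map_simps:
  "n < 0 \<Longrightarrow> cat_chain_map R f n X = undefined"
  "cat_chain_map R f (int m) = tensor_induced (R m) N (f m)"
  by (simp_all add: cat_chain_map_def)

lemma cat_chain_map:
  assumes P: "projective_resolution \<Lambda> P dP \<epsilon>P" and R: "projective_resolution \<Lambda> R dR \<epsilon>R"
    and f: "resolution_map P dP R dR f"
  shows "chain_map (cat_chain \<Lambda> P N) (cat_boundary \<Lambda> P dP N) (cat_chain \<Lambda> R N) (cat_boundary \<Lambda> R dR N)
    (cat_chain_map R f)"
  unfolding chain_map_def
proof (intro conjI allI ballI)
  note mP = resolution_module[OF P] and mR = resolution_module[OF R]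
  have fm: "module_map \<Lambda> (P n) (R n) (f n)" for n using f by (simp add: resolution_map_def)
  show hom: "cat_chain_map R f n \<in> hom (cat_chain \<Lambda> P N n) (cat_chain \<Lambda> R N n)" for n
    using tensor_induced_hom[OF mP mR N fm]
    by (auto simp: cat_chain_map_def cat_chain_def hom_def singleton_group_def)
  show "cat_chain_map R f (n - 1) (cat_boundary \<Lambda> P dP N n x) = cat_boundary \<Lambda> R dR N n (cat_chain_map R f n x)"
    if x: "x \<in> carrier (cat_chain \<Lambda> P N n)" for n x
  proof (cases "n \<le> 0")
    case True
    then show ?thesis by (simp add: cat_chain_simps cat_chain_map_simps singleton_group_def)
  next
    case False
    then obtain m where n: "n = int (Suc m)" using int_pos_Suc by blast
    then have n': "n - 1 = int m" by simp
    have x: "x \<in> carrier (tensor_group \<Lambda> (P (Suc m)) N)" using x by (simp only: n cat_chain_simps)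
    note dP = resolution_diff[OF P, of m] and dR = resolution_diff[OF R, of m]
    have c: "module_map \<Lambda> (P (Suc m)) (R m) (\<lambda>v y. f m v (dP (Suc m) v y))"
      "module_map \<Lambda> (P (Suc m)) (R m) (\<lambda>v y. dR (Suc m) v (f (Suc m) v y))"
      using module_map_comp[OF dP fm] module_map_comp[OF fm dR] by (simp_all add: o_def)
    have "tensor_induced (R m) N (f m) (tensor_induced (P m) N (dP (Suc m)) x) =
        tensor_induced (R m) N (dR (Suc m)) (tensor_induced (R (Suc m)) N (f (Suc m)) x)"
      unfolding tensor_induced_comp[OF mP mP mR N dP fm x] tensor_induced_comp[OF mP mR mR N fm dR x]
      by (rule tensor_induced_cong[OF mP mR N c _ x]) (use f in \<open>simp add: resolution_map_def\<close>)
    then show ?thesis unfolding n' unfolding n by (simp only: cat_chain_simps cat_chain_map_simps)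
  qed
qed

text \<open>
  Tensoring the homotopy \<open>g f - id = d h + h d\<close> with \<open>N\<close> leaves on a cycle only the boundary \<open>d h\<close>.
\<close>

lemma cat_chain_homotopic:
  assumes P: "projective_resolution \<Lambda> P dP \<epsilon>P" and R: "projective_resolution \<Lambda> R dR \<epsilon>R"
    and f: "resolution_map P dP R dR f" and g: "resolution_map R dR P dP g"
    and aug: "\<And>v x. \<lbrakk>v \<in> Obj \<Lambda>; x \<in> carrier (Grp (P 0) v)\<rbrakk> \<Longrightarrow> \<epsilon>P v (g 0 v (f 0 v x)) = \<epsilon>P v x"
    and x: "x \<in> carrier (cat_chain \<Lambda> P N n)" and cyc: "cat_boundary \<Lambda> P dP N n x = \<one>\<^bsub>cat_chain \<Lambda> P N (n - 1)\<^esub>"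
  shows "\<exists>b\<in>carrier (cat_chain \<Lambda> P N (n + 1)). cat_chain_map P g n (cat_chain_map R f n x) =
    cat_boundary \<Lambda> P dP N (n + 1) b \<otimes>\<^bsub>cat_chain \<Lambda> P N n\<^esub> x"
proof -
  note mP = resolution_module[OF P] and mR = resolution_module[OF R]
  note dP = resolution_diff[OF P]
  have fm: "module_map \<Lambda> (P n) (R n) (f n)" and gm: "module_map \<Lambda> (R n) (P n) (g n)" for n
    using f g by (simp_all add: resolution_map_def)
  note gfm = module_map_comp[OF fm gm, unfolded comp_def]
  obtain h where h: "\<forall>n. module_map \<Lambda> (P n) (P (Suc n)) (h n)"
    and h0: "\<forall>v\<in>Obj \<Lambda>. \<forall>x\<in>carrier (Grp (P 0) v).
      g 0 v (f 0 v x) = dP (Suc 0) v (h 0 v x) \<otimes>\<^bsub>Grp (P 0) v\<^esub> x"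
    and hS: "\<forall>n. \<forall>v\<in>Obj \<Lambda>. \<forall>x\<in>carrier (Grp (P (Suc n)) v). g (Suc n) v (f (Suc n) v x) =
      dP (Suc (Suc n)) v (h (Suc n) v x) \<otimes>\<^bsub>Grp (P (Suc n)) v\<^esub>
        (h n v (dP (Suc n) v x) \<otimes>\<^bsub>Grp (P (Suc n)) v\<^esub> x)"
    using resolution_map_homotopy[where f = "\<lambda>n v x. g n v (f n v x)" and g = "\<lambda>n v x. x",
        OF P P resolution_map_comp[OF f g] resolution_map_id aug] .
  note h = h[rule_format] and h0 = h0[rule_format] and hS = hS[rule_format]
  note dh = module_map_comp[OF h dP, unfolded comp_def] and hd = module_map_comp[OF dP h, unfolded comp_def]
  consider "n < 0" | "n = int 0" | m where "n = int (Suc m)"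
    using int_neg_zero_Suc by blast
  then show ?thesis
  proof cases
    case 1
    have "\<exists>b. b \<in> carrier (cat_chain \<Lambda> P N (n + 1))"
      using cat_chain_complex[OF P] unfolding chain_complex_def comm_group_def comm_monoid_def
      by (meson monoid.one_closed)
    with 1 x show ?thesis by (auto simp: cat_chain_simps cat_chain_map_simps singleton_group_def)
  next
    case 2
    have x: "x \<in> carrier (tensor_group \<Lambda> (P 0) N)" using x by (simp only: 2 cat_chain_simps)
    have n1: "n + 1 = int (Suc 0)" using 2 by simp
    have "tensor_induced (P 0) N (g 0) (tensor_induced (R 0) N (f 0) x) =
      tensor_induced (P 0) N (\<lambda>v x. dP (Suc 0) v (h 0 v x) \<otimes>\<^bsub>Grp (P 0) v\<^esub> x) x"
      unfolding tensor_induced_comp[OF mP mR mP N fm gm x]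
      by (rule tensor_induced_cong[OF mP mP N gfm module_map_pointwise_mult[OF mP dh module_map_id] _ x]) (rule h0)
    also have "\<dots> = tensor_induced (P 0) N (dP (Suc 0)) (tensor_induced (P (Suc 0)) N (h 0) x) \<otimes>\<^bsub>tensor_group \<Lambda> (P 0) N\<^esub> x"
      unfolding tensor_induced_mult[OF mP mP N dh module_map_id x] tensor_induced_comp[OF mP mP mP N h dP x]
        tensor_induced_id[OF mP N x] ..
    finally show ?thesis unfolding n1 unfolding 2 unfolding cat_chain_simps cat_chain_map_simps
      using hom_in_carrier[OF tensor_induced_hom[OF mP mP N h] x] by blast
  next
    case 3
    have n1: "n + 1 = int (Suc (Suc m))" and n2: "n - 1 = int m" using 3 by simp_all
    have x: "x \<in> carrier (tensor_group \<Lambda> (P (Suc m)) N)" using x by (simp only: 3 cat_chain_simps)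
    have cyc: "tensor_induced (P m) N (dP (Suc m)) x = \<one>\<^bsub>tensor_group \<Lambda> (P m) N\<^esub>"
      using cyc unfolding n2 unfolding 3 unfolding cat_chain_simps .
    let ?T = "tensor_group \<Lambda> (P (Suc m)) N"
    interpret T: comm_group ?T by (rule comm_group_tensor[OF mP N])
    have z: "tensor_induced (P (Suc m)) N (\<lambda>v x. h m v (dP (Suc m) v x)) x = \<one>\<^bsub>?T\<^esub>"
      unfolding tensor_induced_comp[OF mP mP mP N dP h x, symmetric] cyc
      using hom_one[OF tensor_induced_hom[OF mP mP N h]] comm_group_tensor[OF mP N] by (simp add: comm_group_def)
    note inner = module_map_pointwise_mult[OF mP hd module_map_id]
    have "tensor_induced (P (Suc m)) N (g (Suc m)) (tensor_induced (R (Suc m)) N (f (Suc m)) x) =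
      tensor_induced (P (Suc m)) N (\<lambda>v x. dP (Suc (Suc m)) v (h (Suc m) v x) \<otimes>\<^bsub>Grp (P (Suc m)) v\<^esub>
        (h m v (dP (Suc m) v x) \<otimes>\<^bsub>Grp (P (Suc m)) v\<^esub> x)) x"
      unfolding tensor_induced_comp[OF mP mR mP N fm gm x]
      by (rule tensor_induced_cong[OF mP mP N gfm module_map_pointwise_mult[OF mP dh inner] _ x]) (rule hS)
    also have "\<dots> = tensor_induced (P (Suc m)) N (dP (Suc (Suc m))) (tensor_induced (P (Suc (Suc m))) N (h (Suc m)) x)
        \<otimes>\<^bsub>?T\<^esub> (\<one>\<^bsub>?T\<^esub> \<otimes>\<^bsub>?T\<^esub> x)"
      unfolding tensor_induced_mult[OF mP mP N dh inner x] tensor_induced_mult[OF mP mP N hd module_map_id x]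
        tensor_induced_comp[OF mP mP mP N h dP x] tensor_induced_id[OF mP N x] z ..
    finally show ?thesis unfolding n1 unfolding 3 unfolding cat_chain_simps cat_chain_map_simps
      using hom_in_carrier[OF tensor_induced_hom[OF mP mP N h] x] x by auto
  qed
qed

lemma cat_homology_unique:
  assumes P: "projective_resolution \<Lambda> P dP \<epsilon>P" and R: "projective_resolution \<Lambda> R dR \<epsilon>R"
  shows "cat_homology \<Lambda> P dP N n \<cong> cat_homology \<Lambda> R dR N n"
proof -
  obtain f where f: "resolution_map P dP R dR f"
    and fa: "\<And>v x. v \<in> Obj \<Lambda> \<Longrightarrow> x \<in> carrier (Grp (P 0) v) \<Longrightarrow> \<epsilon>R v (f 0 v x) = \<epsilon>P v x"
    using resolution_map_exists[OF P R] by blast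
  obtain g where g: "resolution_map R dR P dP g"
    and ga: "\<And>v x. v \<in> Obj \<Lambda> \<Longrightarrow> x \<in> carrier (Grp (R 0) v) \<Longrightarrow> \<epsilon>P v (g 0 v x) = \<epsilon>R v x"
    using resolution_map_exists[OF R P] by blast
  have "f 0 v x \<in> carrier (Grp (R 0) v)" if "v \<in> Obj \<Lambda>" "x \<in> carrier (Grp (P 0) v)" for v x
    using module_map_closed[of "P 0" "R 0" "f 0"] that f by (simp add: resolution_map_def)
  moreover have "g 0 v x \<in> carrier (Grp (P 0) v)" if "v \<in> Obj \<Lambda>" "x \<in> carrier (Grp (R 0) v)" for v x
    using module_map_closed[of "R 0" "P 0" "g 0"] that g by (simp add: resolution_map_def)
  ultimately show ?thesis unfolding cat_homology_def
    by (intro chain_homology_isoI[OF cat_chain_complex[OF P] cat_chain_complex[OF R]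
          cat_chain_map[OF P R f] cat_chain_map[OF R P g]]
        cat_chain_homotopic[OF P R f g] cat_chain_homotopic[OF R P g f])
      (simp_all add: fa ga)
qed

end

end

section \<open>Independence of cohomology from the resolution\<close>

context small_category
begin

text \<open>
  The extensional representative, as an element of \<open>Hom_group\<close>, of a natural transformation.
\<close>

definition hom_ext :: "('l, 'a) cmodule \<Rightarrow> ('l \<Rightarrow> 'a \<Rightarrow> 'b) \<Rightarrow> 'l \<Rightarrow> 'a \<Rightarrow> 'b"
  where "hom_ext P \<phi> = (\<lambda>v\<in>Obj \<Lambda>. \<lambda>x\<in>carrier (Grp P v). \<phi> v x)"

lemma hom_ext_apply: "\<lbrakk>v \<in> Obj \<Lambda>; x \<in> carrier (Grp P v)\<rbrakk> \<Longrightarrow> hom_ext P \<phi> v x = \<phi> v x"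
  by (simp add: hom_ext_def)

lemma module_map_cong:
  assumes P: "right_module \<Lambda> P" and \<phi>: "module_map \<Lambda> P M \<phi>"
    and eq: "\<And>v x. \<lbrakk>v \<in> Obj \<Lambda>; x \<in> carrier (Grp P v)\<rbrakk> \<Longrightarrow> \<phi> v x = \<psi> v x"
  shows "module_map \<Lambda> P M \<psi>"
  unfolding module_map_def
proof (intro conjI ballI)
  show "\<psi> v \<in> hom (Grp P v) (Grp M v)" if v: "v \<in> Obj \<Lambda>" for v
    using right_module_group[OF P v] by (intro group.hom_restrict[OF _ module_map_hom[OF \<phi> v] eq[OF v]]) (simp add: comm_group_def)
  show "\<psi> (Src \<Lambda> \<mu>) (Act P \<mu> x) = Act M \<mu> (\<psi> (Rng \<Lambda> \<mu>) x)"
    if "\<mu> \<in> Mor \<Lambda>" "x \<in> carrier (Grp P (Rng \<Lambda> \<mu>))" for \<mu> x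
    using module_map_act[OF \<phi> that] that
    by (simp add: eq Rng_Obj Src_Obj right_module_act_closed[OF P])
qed

lemma Hom_group_carrierD:
  "\<phi> \<in> carrier (Hom_group \<Lambda> P M) \<Longrightarrow> module_map \<Lambda> P M \<phi>"
  by (simp add: Hom_group_def)

lemma Hom_group_carrierI:
  assumes "right_module \<Lambda> P" "module_map \<Lambda> P M \<phi>"
  shows "hom_ext P \<phi> \<in> carrier (Hom_group \<Lambda> P M)"
  using module_map_cong[OF assms, of "hom_ext P \<phi>"] by (simp add: Hom_group_def hom_ext_apply) (simp add: hom_ext_def)

lemma Hom_group_eqI:
  assumes "\<phi> \<in> carrier (Hom_group \<Lambda> P M)" "\<psi> \<in> carrier (Hom_group \<Lambda> P M)"
    and "\<And>v x. \<lbrakk>v \<in> Obj \<Lambda>; x \<in> carrier (Grp P v)\<rbrakk> \<Longrightarrow> \<phi> v x = \<psi> v x"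
  shows "\<phi> = \<psi>"
proof (rule extensionalityI[of _ "Obj \<Lambda>"])
  show "\<phi> v = \<psi> v" if v: "v \<in> Obj \<Lambda>" for v
    by (rule extensionalityI[of _ "carrier (Grp P v)"]) (use assms v in \<open>simp_all add: Hom_group_def\<close>)
qed (use assms in \<open>simp_all add: Hom_group_def\<close>)

lemma Hom_group_mult: "\<phi> \<otimes>\<^bsub>Hom_group \<Lambda> P M\<^esub> \<psi> = hom_ext P (\<lambda>v x. \<phi> v x \<otimes>\<^bsub>Grp M v\<^esub> \<psi> v x)"
  and Hom_group_one: "\<one>\<^bsub>Hom_group \<Lambda> P M\<^esub> = hom_ext P (\<lambda>v x. \<one>\<^bsub>Grp M v\<^esub>)"
  by (simp_all add: Hom_group_def hom_ext_def)

lemma comm_group_Hom: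
  assumes P: "right_module \<Lambda> P" and M: "right_module \<Lambda> M"
  shows "comm_group (Hom_group \<Lambda> P M)"
proof (rule comm_groupI)
  let ?H = "Hom_group \<Lambda> P M"
  note I = Hom_group_carrierI[OF P] and D = Hom_group_carrierD
  show cl: "x \<otimes>\<^bsub>?H\<^esub> y \<in> carrier ?H" if "x \<in> carrier ?H" "y \<in> carrier ?H" for x y
    unfolding Hom_group_mult by (intro I module_map_pointwise_mult M D that)
  show on: "\<one>\<^bsub>?H\<^esub> \<in> carrier ?H"
    unfolding Hom_group_one by (intro I module_map_const_one M)
  have g: "comm_group (Grp M v)" if "v \<in> Obj \<Lambda>" for v by (rule right_module_group[OF M that])
  note simps = Hom_group_mult Hom_group_one hom_ext_apply module_map_closed[OF D]
  show "x \<otimes>\<^bsub>?H\<^esub> y \<otimes>\<^bsub>?H\<^esub> z = x \<otimes>\<^bsub>?H\<^esub> (y \<otimes>\<^bsub>?H\<^esub> z)"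
    if "x \<in> carrier ?H" "y \<in> carrier ?H" "z \<in> carrier ?H" for x y z
  proof (rule Hom_group_eqI[of _ P M])
    fix v p assume v: "v \<in> Obj \<Lambda>" "p \<in> carrier (Grp P v)"
    interpret comm_group "Grp M v" by (rule g[OF v(1)])
    show "(x \<otimes>\<^bsub>?H\<^esub> y \<otimes>\<^bsub>?H\<^esub> z) v p = (x \<otimes>\<^bsub>?H\<^esub> (y \<otimes>\<^bsub>?H\<^esub> z)) v p"
      using that v by (simp add: simps m_assoc)
  qed (use that in \<open>simp_all add: cl\<close>)
  show "x \<otimes>\<^bsub>?H\<^esub> y = y \<otimes>\<^bsub>?H\<^esub> x" if "x \<in> carrier ?H" "y \<in> carrier ?H" for x y
  proof (rule Hom_group_eqI[of _ P M])
    fix v p assume v: "v \<in> Obj \<Lambda>" "p \<in> carrier (Grp P v)"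
    interpret comm_group "Grp M v" by (rule g[OF v(1)])
    show "(x \<otimes>\<^bsub>?H\<^esub> y) v p = (y \<otimes>\<^bsub>?H\<^esub> x) v p"
      using that v by (simp add: simps m_comm)
  qed (use that in \<open>simp_all add: cl\<close>)
  show "\<one>\<^bsub>?H\<^esub> \<otimes>\<^bsub>?H\<^esub> x = x" if "x \<in> carrier ?H" for x
  proof (rule Hom_group_eqI[of _ P M])
    fix v p assume v: "v \<in> Obj \<Lambda>" "p \<in> carrier (Grp P v)"
    interpret comm_group "Grp M v" by (rule g[OF v(1)])
    show "(\<one>\<^bsub>?H\<^esub> \<otimes>\<^bsub>?H\<^esub> x) v p = x v p"
      using that v by (simp add: simps)
  qed (use that in \<open>simp_all add: cl on\<close>)
  show "\<exists>y\<in>carrier ?H. y \<otimes>\<^bsub>?H\<^esub> x = \<one>\<^bsub>?H\<^esub>" if x: "x \<in> carrier ?H" for x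
  proof
    show i: "hom_ext P (\<lambda>v p. inv\<^bsub>Grp M v\<^esub> x v p) \<in> carrier ?H"
      by (intro I module_map_pointwise_inv M D x)
    show "hom_ext P (\<lambda>v p. inv\<^bsub>Grp M v\<^esub> x v p) \<otimes>\<^bsub>?H\<^esub> x = \<one>\<^bsub>?H\<^esub>"
    proof (rule Hom_group_eqI[of _ P M])
      fix v p assume v: "v \<in> Obj \<Lambda>" "p \<in> carrier (Grp P v)"
      interpret comm_group "Grp M v" by (rule g[OF v(1)])
      show "(hom_ext P (\<lambda>v p. inv\<^bsub>Grp M v\<^esub> x v p) \<otimes>\<^bsub>?H\<^esub> x) v p = \<one>\<^bsub>?H\<^esub> v p"
        using x v by (simp add: simps)
    qed (simp_all add: cl on i x)
  qed
qed

definition hom_pre :: "('l, 'a) cmodule \<Rightarrow> ('l \<Rightarrow> 'a \<Rightarrow> 'b) \<Rightarrow> ('l \<Rightarrow> 'b \<Rightarrow> 'c) \<Rightarrow> 'l \<Rightarrow> 'a \<Rightarrow> 'c"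
  where "hom_pre P f \<phi> = hom_ext P (\<lambda>v x. \<phi> v (f v x))"

lemma hom_pre_apply: "\<lbrakk>v \<in> Obj \<Lambda>; x \<in> carrier (Grp P v)\<rbrakk> \<Longrightarrow> hom_pre P f \<phi> v x = \<phi> v (f v x)"
  by (simp add: hom_pre_def hom_ext_apply)

lemma hom_pre_closed:
  assumes P: "right_module \<Lambda> P" and f: "module_map \<Lambda> P Q f" and \<phi>: "\<phi> \<in> carrier (Hom_group \<Lambda> Q M)"
  shows "hom_pre P f \<phi> \<in> carrier (Hom_group \<Lambda> P M)"
  unfolding hom_pre_def
  by (rule Hom_group_carrierI[OF P module_map_comp[OF f Hom_group_carrierD[OF \<phi>], unfolded comp_def]])

lemma hom_pre_hom:
  assumes P: "right_module \<Lambda> P" and Q: "right_module \<Lambda> Q" and M: "right_module \<Lambda> M"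
    and f: "module_map \<Lambda> P Q f"
  shows "hom_pre P f \<in> hom (Hom_group \<Lambda> Q M) (Hom_group \<Lambda> P M)"
proof (rule homI)
  note cl = hom_pre_closed[OF P f]
  show "hom_pre P f \<phi> \<in> carrier (Hom_group \<Lambda> P M)" if "\<phi> \<in> carrier (Hom_group \<Lambda> Q M)" for \<phi>
    by (rule cl[OF that])
  interpret HQ: comm_group "Hom_group \<Lambda> Q M" by (rule comm_group_Hom[OF Q M])
  interpret HP: comm_group "Hom_group \<Lambda> P M" by (rule comm_group_Hom[OF P M])
  show "hom_pre P f (\<phi> \<otimes>\<^bsub>Hom_group \<Lambda> Q M\<^esub> \<psi>) = hom_pre P f \<phi> \<otimes>\<^bsub>Hom_group \<Lambda> P M\<^esub> hom_pre P f \<psi>"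
    if "\<phi> \<in> carrier (Hom_group \<Lambda> Q M)" "\<psi> \<in> carrier (Hom_group \<Lambda> Q M)" for \<phi> \<psi>
  proof (rule Hom_group_eqI[of _ P M])
    fix v x assume "v \<in> Obj \<Lambda>" "x \<in> carrier (Grp P v)"
    then show "hom_pre P f (\<phi> \<otimes>\<^bsub>Hom_group \<Lambda> Q M\<^esub> \<psi>) v x = (hom_pre P f \<phi> \<otimes>\<^bsub>Hom_group \<Lambda> P M\<^esub> hom_pre P f \<psi>) v x"
      by (simp add: hom_pre_apply Hom_group_mult hom_ext_apply module_map_closed[OF f])
  qed (use that in \<open>simp_all add: cl\<close>)
qed

lemma cat_cochain_simps:
  "n < 0 \<Longrightarrow> cat_cochain \<Lambda> R M n = singleton_group undefined"
  "cat_cochain \<Lambda> R M (int m) = Hom_group \<Lambda> (R m) M"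
  "n < 0 \<Longrightarrow> cat_coboundary \<Lambda> R d M n \<phi> = \<one>\<^bsub>cat_cochain \<Lambda> R M (n + 1)\<^esub>"
  "cat_coboundary \<Lambda> R d M (int m) = hom_pre (R (Suc m)) (d (Suc m))"
  by (auto simp: cat_cochain_def cat_coboundary_def hom_pre_def hom_ext_def fun_eq_iff nat_add_distrib)

lemma int_neg_or_nat: "n < 0 \<or> (\<exists>m. n = int m)"
  by (cases n) auto

context
  fixes M :: "('l, 'b) cmodule"
  assumes M: "right_module \<Lambda> M"
begin

lemma cat_cochain_complex:
  assumes R: "projective_resolution \<Lambda> R d \<epsilon>"
  shows "cochain_complex (cat_cochain \<Lambda> R M) (cat_coboundary \<Lambda> R d M)"
  unfolding cochain_complex_def
proof (intro conjI allI ballI)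
  note mR = resolution_module[OF R] and dR = resolution_diff[OF R]
  show cg: "comm_group (cat_cochain \<Lambda> R M n)" for n
    using comm_group_Hom[OF mR M] singleton_abelian_group by (simp add: cat_cochain_def)
  show hom: "cat_coboundary \<Lambda> R d M n \<in> hom (cat_cochain \<Lambda> R M n) (cat_cochain \<Lambda> R M (n + 1))" for n
  proof (cases "n < 0")
    case True
    interpret comm_group "cat_cochain \<Lambda> R M (n + 1)" by (rule cg)
    show ?thesis by (rule homI) (simp_all add: cat_cochain_simps(3)[OF True])
  next
    case False
    then obtain m where n: "n = int m" using int_neg_or_nat by blast
    then have "n + 1 = int (Suc m)" by simp
    then show ?thesis unfolding n
      using hom_pre_hom[OF mR mR M dR] by (simp only: cat_cochain_simps)
  qed
  show "cat_coboundary \<Lambda> R d M n (cat_coboundary \<Lambda> R d M (n - 1) x) = \<one>\<^bsub>cat_cochain \<Lambda> R M (n + 1)\<^esub>"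
    if x: "x \<in> carrier (cat_cochain \<Lambda> R M (n - 1))" for n x
  proof (cases "n \<le> 0")
    case True
    interpret a: comm_group "cat_cochain \<Lambda> R M n" by (rule cg)
    interpret b: comm_group "cat_cochain \<Lambda> R M (n + 1)" by (rule cg)
    have "cat_coboundary \<Lambda> R d M (n - 1) x = \<one>\<^bsub>cat_cochain \<Lambda> R M n\<^esub>"
      using True by (simp add: cat_cochain_simps)
    then show ?thesis using hom_one[OF hom a.is_group b.is_group] by simp
  next
    case False
    then obtain m where n: "n = int (Suc m)" using int_pos_Suc by blast
    then have n': "n - 1 = int m" "n + 1 = int (Suc (Suc m))" by simp_all
    have x: "x \<in> carrier (Hom_group \<Lambda> (R m) M)" using x by (simp only: n' cat_cochain_simps)
    note cl = hom_pre_closed[OF mR dR]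
    have "hom_pre (R (Suc (Suc m))) (d (Suc (Suc m))) (hom_pre (R (Suc m)) (d (Suc m)) x) =
        \<one>\<^bsub>Hom_group \<Lambda> (R (Suc (Suc m))) M\<^esub>"
    proof (rule Hom_group_eqI[of _ "R (Suc (Suc m))" M])
      show "\<one>\<^bsub>Hom_group \<Lambda> (R (Suc (Suc m))) M\<^esub> \<in> carrier (Hom_group \<Lambda> (R (Suc (Suc m))) M)"
        using comm_group_Hom[OF mR M] by (simp add: comm_group_def comm_monoid_def monoid.one_closed)
      fix v y assume v: "v \<in> Obj \<Lambda>" and y: "y \<in> carrier (Grp (R (Suc (Suc m))) v)"
      show "hom_pre (R (Suc (Suc m))) (d (Suc (Suc m))) (hom_pre (R (Suc m)) (d (Suc m)) x) v y =
        \<one>\<^bsub>Hom_group \<Lambda> (R (Suc (Suc m))) M\<^esub> v y"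
        using v y group_hom.hom_one[OF module_map_group_hom[OF mR M Hom_group_carrierD[OF x] v]]
        by (simp add: hom_pre_apply module_map_closed[OF dR] resolution_diff_diff[OF R] Hom_group_one hom_ext_apply)
    qed (intro cl x)
    then show ?thesis unfolding n' unfolding n by (simp only: cat_cochain_simps)
  qed
qed

definition cat_cochain_map :: "(nat \<Rightarrow> ('l, 'p) cmodule) \<Rightarrow> (nat \<Rightarrow> 'l \<Rightarrow> 'p \<Rightarrow> 'r) \<Rightarrow> int \<Rightarrow>
    ('l \<Rightarrow> 'r \<Rightarrow> 'b) \<Rightarrow> 'l \<Rightarrow> 'p \<Rightarrow> 'b"
  where "cat_cochain_map P f n = (if n < 0 then (\<lambda>_. undefined) else hom_pre (P (nat n)) (f (nat n)))"

lemma cat_cochain_map_simps: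
  "n < 0 \<Longrightarrow> cat_cochain_map P f n \<phi> = undefined"
  "cat_cochain_map P f (int m) = hom_pre (P m) (f m)"
  by (simp_all add: cat_cochain_map_def)

lemma cat_cochain_map:
  assumes P: "projective_resolution \<Lambda> P dP \<epsilon>P" and R: "projective_resolution \<Lambda> R dR \<epsilon>R"
    and f: "resolution_map P dP R dR f"
  shows "cochain_map (cat_cochain \<Lambda> R M) (cat_coboundary \<Lambda> R dR M) (cat_cochain \<Lambda> P M) (cat_coboundary \<Lambda> P dP M)
    (cat_cochain_map P f)"
  unfolding cochain_map_def
proof (intro conjI allI ballI)
  note mP = resolution_module[OF P] and mR = resolution_module[OF R]
  have fm: "module_map \<Lambda> (P n) (R n) (f n)" for n using f by (simp add: resolution_map_def)
  show hom: "cat_cochain_map P f n \<in> hom (cat_cochain \<Lambda> R M n) (cat_cochain \<Lambda> P M n)" for n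
    using hom_pre_hom[OF mP mR M fm]
    by (auto simp: cat_cochain_map_def cat_cochain_def hom_def singleton_group_def)
  show "cat_cochain_map P f (n + 1) (cat_coboundary \<Lambda> R dR M n x) = cat_coboundary \<Lambda> P dP M n (cat_cochain_map P f n x)"
    if x: "x \<in> carrier (cat_cochain \<Lambda> R M n)" for n x
  proof (cases "n < 0")
    case True
    interpret a: comm_group "cat_cochain \<Lambda> R M (n + 1)" 
      using cat_cochain_complex[OF R] by (simp add: cochain_complex_def)
    interpret b: comm_group "cat_cochain \<Lambda> P M (n + 1)"
      using cat_cochain_complex[OF P] by (simp add: cochain_complex_def)
    show ?thesis using True hom_one[OF hom a.is_group b.is_group] by (simp add: cat_cochain_simps)
  next
    case False
    then obtain m where n: "n = int m" using int_neg_or_nat by blast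
    then have n': "n + 1 = int (Suc m)" by simp
    have x: "x \<in> carrier (Hom_group \<Lambda> (R m) M)" using x by (simp only: n cat_cochain_simps)
    note dP = resolution_diff[OF P, of m] and dR = resolution_diff[OF R, of m]
    note cl = hom_pre_closed[OF mP fm] hom_pre_closed[OF mP dP] hom_pre_closed[OF mR dR] x
    have "hom_pre (P (Suc m)) (f (Suc m)) (hom_pre (R (Suc m)) (dR (Suc m)) x) =
        hom_pre (P (Suc m)) (dP (Suc m)) (hom_pre (P m) (f m) x)"
    proof (rule Hom_group_eqI[of _ "P (Suc m)" M])
      fix v y assume "v \<in> Obj \<Lambda>" "y \<in> carrier (Grp (P (Suc m)) v)"
      then show "hom_pre (P (Suc m)) (f (Suc m)) (hom_pre (R (Suc m)) (dR (Suc m)) x) v y =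
        hom_pre (P (Suc m)) (dP (Suc m)) (hom_pre (P m) (f m) x) v y"
        using f by (simp add: hom_pre_apply module_map_closed[OF fm] module_map_closed[OF dP] resolution_map_def)
    qed (intro cl)+
    then show ?thesis unfolding n' unfolding n by (simp only: cat_cochain_simps cat_cochain_map_simps)
  qed
qed

text \<open>
  Composing a cocycle \<open>x\<close> with the homotopy \<open>g f - id = d h + h d\<close> gives \<open>x (d h) + x (h d)\<close>.  The
  first term vanishes, the second is the coboundary of \<open>x h\<close>.
\<close>

lemma cat_cochain_homotopic:
  assumes P: "projective_resolution \<Lambda> P dP \<epsilon>P" and R: "projective_resolution \<Lambda> R dR \<epsilon>R"
    and f: "resolution_map P dP R dR f" and g: "resolution_map R dR P dP g"
    and aug: "\<And>v x. \<lbrakk>v \<in> Obj \<Lambda>; x \<in> carrier (Grp (P 0) v)\<rbrakk> \<Longrightarrow> \<epsilon>P v (g 0 v (f 0 v x)) = \<epsilon>P v x"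
    and x: "x \<in> carrier (cat_cochain \<Lambda> P M n)" and cyc: "cat_coboundary \<Lambda> P dP M n x = \<one>\<^bsub>cat_cochain \<Lambda> P M (n + 1)\<^esub>"
  shows "\<exists>b\<in>carrier (cat_cochain \<Lambda> P M (n - 1)). cat_cochain_map P f n (cat_cochain_map R g n x) =
    cat_coboundary \<Lambda> P dP M (n - 1) b \<otimes>\<^bsub>cat_cochain \<Lambda> P M n\<^esub> x"
proof -
  note mP = resolution_module[OF P] and mR = resolution_module[OF R]
  note dP = resolution_diff[OF P]
  have fm: "module_map \<Lambda> (P n) (R n) (f n)" and gm: "module_map \<Lambda> (R n) (P n) (g n)" for n
    using f g by (simp_all add: resolution_map_def)
  obtain h where h: "\<forall>n. module_map \<Lambda> (P n) (P (Suc n)) (h n)"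
    and h0: "\<forall>v\<in>Obj \<Lambda>. \<forall>x\<in>carrier (Grp (P 0) v).
      g 0 v (f 0 v x) = dP (Suc 0) v (h 0 v x) \<otimes>\<^bsub>Grp (P 0) v\<^esub> x"
    and hS: "\<forall>n. \<forall>v\<in>Obj \<Lambda>. \<forall>x\<in>carrier (Grp (P (Suc n)) v). g (Suc n) v (f (Suc n) v x) =
      dP (Suc (Suc n)) v (h (Suc n) v x) \<otimes>\<^bsub>Grp (P (Suc n)) v\<^esub>
        (h n v (dP (Suc n) v x) \<otimes>\<^bsub>Grp (P (Suc n)) v\<^esub> x)"
    using resolution_map_homotopy[where f = "\<lambda>n v x. g n v (f n v x)" and g = "\<lambda>n v x. x",
        OF P P resolution_map_comp[OF f g] resolution_map_id aug] .
  note h = h[rule_format] and h0 = h0[rule_format] and hS = hS[rule_format]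
  note cl = hom_pre_closed[OF mP fm] hom_pre_closed[OF mR gm] hom_pre_closed[OF mP h] hom_pre_closed[OF mP dP]
  have cmon: "a \<otimes>\<^bsub>Hom_group \<Lambda> (P m) M\<^esub> b \<in> carrier (Hom_group \<Lambda> (P m) M)"
    if "a \<in> carrier (Hom_group \<Lambda> (P m) M)" "b \<in> carrier (Hom_group \<Lambda> (P m) M)" for a b m
    using that comm_group_Hom[OF mP M] by (simp add: comm_group_def comm_monoid_def monoid.m_closed)
  have zero: "x v (dP (Suc m) v y) = \<one>\<^bsub>Grp M v\<^esub>"
    if "n = int m" "v \<in> Obj \<Lambda>" "y \<in> carrier (Grp (P (Suc m)) v)" for m v y
  proof -
    have "n + 1 = int (Suc m)" using that by simp
    then have "hom_pre (P (Suc m)) (dP (Suc m)) x = \<one>\<^bsub>Hom_group \<Lambda> (P (Suc m)) M\<^esub>"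
      using cyc that by (simp only: cat_cochain_simps)
    from fun_cong[OF fun_cong[OF this], of v y] show ?thesis
      using that by (simp add: hom_pre_apply Hom_group_one hom_ext_apply)
  qed
  consider "n < 0" | "n = int 0" | m where "n = int (Suc m)"
    using int_neg_zero_Suc by blast
  then show ?thesis
  proof cases
    case 1
    with x show ?thesis by (auto simp: cat_cochain_simps cat_cochain_map_simps singleton_group_def)
  next
    case 2
    have x: "x \<in> carrier (Hom_group \<Lambda> (P 0) M)" using x by (simp only: 2 cat_cochain_simps)
    interpret H: comm_group "Hom_group \<Lambda> (P 0) M" by (rule comm_group_Hom[OF mP M])
    have "hom_pre (P 0) (f 0) (hom_pre (R 0) (g 0) x) = x"
    proof (rule Hom_group_eqI[of _ "P 0" M])
      fix v y assume v: "v \<in> Obj \<Lambda>" and y: "y \<in> carrier (Grp (P 0) v)"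
      interpret comm_group "Grp M v" by (rule right_module_group[OF M v])
      show "hom_pre (P 0) (f 0) (hom_pre (R 0) (g 0) x) v y = x v y"
        using v y module_map_mult[OF Hom_group_carrierD[OF x]] module_map_closed[OF Hom_group_carrierD[OF x]]
        by (simp add: hom_pre_apply module_map_closed[OF fm] h0 zero[OF 2] module_map_closed[OF h]
            module_map_closed[OF dP])
    qed (intro cl x)+
    moreover have "cat_coboundary \<Lambda> P dP M (n - 1) undefined = \<one>\<^bsub>Hom_group \<Lambda> (P 0) M\<^esub>"
      using 2 cat_cochain_simps(2)[of P M 0] by (simp add: cat_cochain_simps(3))
    moreover have "undefined \<in> carrier (cat_cochain \<Lambda> P M (n - 1))"
      using 2 by (simp add: cat_cochain_simps(1))
    ultimately show ?thesis
      using x by (intro bexI[of _ undefined]) (simp_all only: 2 cat_cochain_simps cat_cochain_map_simps H.l_one)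
  next
    case 3
    have n1: "n - 1 = int m" using 3 by simp
    have x: "x \<in> carrier (Hom_group \<Lambda> (P (Suc m)) M)" using x by (simp only: 3 cat_cochain_simps)
    have "hom_pre (P (Suc m)) (f (Suc m)) (hom_pre (R (Suc m)) (g (Suc m)) x) =
      hom_pre (P (Suc m)) (dP (Suc m)) (hom_pre (P m) (h m) x) \<otimes>\<^bsub>Hom_group \<Lambda> (P (Suc m)) M\<^esub> x"
    proof (rule Hom_group_eqI[of _ "P (Suc m)" M])
      fix v y assume v: "v \<in> Obj \<Lambda>" and y: "y \<in> carrier (Grp (P (Suc m)) v)"
      interpret comm_group "Grp M v" by (rule right_module_group[OF M v])
      interpret p: comm_group "Grp (P (Suc m)) v" by (rule right_module_group[OF mP v])
      show "hom_pre (P (Suc m)) (f (Suc m)) (hom_pre (R (Suc m)) (g (Suc m)) x) v y =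
        (hom_pre (P (Suc m)) (dP (Suc m)) (hom_pre (P m) (h m) x) \<otimes>\<^bsub>Hom_group \<Lambda> (P (Suc m)) M\<^esub> x) v y"
        using v y module_map_mult[OF Hom_group_carrierD[OF x]] module_map_closed[OF Hom_group_carrierD[OF x]]
        by (simp add: hom_pre_apply module_map_closed[OF fm] hS zero[OF 3] module_map_closed[OF h]
            module_map_closed[OF dP] Hom_group_mult hom_ext_apply)
    qed (intro cl x cmon)+
    then show ?thesis unfolding n1 unfolding 3 unfolding cat_cochain_simps cat_cochain_map_simps
      using cl(3)[OF x] by blast
  qed
qed

lemma cat_cohomology_unique:
  assumes P: "projective_resolution \<Lambda> P dP \<epsilon>P" and R: "projective_resolution \<Lambda> R dR \<epsilon>R"
  shows "cat_cohomology \<Lambda> P dP M n \<cong> cat_cohomology \<Lambda> R dR M n"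
proof -
  obtain f where f: "resolution_map P dP R dR f"
    and fa: "\<And>v x. v \<in> Obj \<Lambda> \<Longrightarrow> x \<in> carrier (Grp (P 0) v) \<Longrightarrow> \<epsilon>R v (f 0 v x) = \<epsilon>P v x"
    using resolution_map_exists[OF P R] by blast
  obtain g where g: "resolution_map R dR P dP g"
    and ga: "\<And>v x. v \<in> Obj \<Lambda> \<Longrightarrow> x \<in> carrier (Grp (R 0) v) \<Longrightarrow> \<epsilon>P v (g 0 v x) = \<epsilon>R v x"
    using resolution_map_exists[OF R P] by blast
  have "f 0 v x \<in> carrier (Grp (R 0) v)" if "v \<in> Obj \<Lambda>" "x \<in> carrier (Grp (P 0) v)" for v x
    using module_map_closed[of "P 0" "R 0" "f 0"] that f by (simp add: resolution_map_def)
  moreover have "g 0 v x \<in> carrier (Grp (P 0) v)" if "v \<in> Obj \<Lambda>" "x \<in> carrier (Grp (R 0) v)" for v x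
    using module_map_closed[of "R 0" "P 0" "g 0"] that g by (simp add: resolution_map_def)
  ultimately show ?thesis unfolding cat_cohomology_def
    by (intro cochain_cohomology_isoI[OF cat_cochain_complex[OF P] cat_cochain_complex[OF R]
          cat_cochain_map[OF R P g] cat_cochain_map[OF P R f]]
        cat_cochain_homotopic[OF P R f g] cat_cochain_homotopic[OF R P g f])
      (simp_all add: fa ga)
qed

end

end

section \<open>Free modules\<close>

definition sum_gen :: "'i set \<Rightarrow> ('i \<Rightarrow> 'a monoid) \<Rightarrow> 'i \<Rightarrow> 'a \<Rightarrow> 'i \<Rightarrow> 'a"
  where "sum_gen I A i a = (\<lambda>j\<in>I. if j = i then a else \<one>\<^bsub>A j\<^esub>)"

lemma comm_group_sum_group:
  assumes "\<And>i. i \<in> I \<Longrightarrow> comm_group (A i)"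
  shows "comm_group (sum_group I A)"
proof (rule group.group_comm_groupI)
  have g: "group (A i)" if "i \<in> I" for i using assms[OF that] by (simp add: comm_group_def)
  then show "group (sum_group I A)" by simp
  show "x \<otimes>\<^bsub>sum_group I A\<^esub> y = y \<otimes>\<^bsub>sum_group I A\<^esub> x"
    if "x \<in> carrier (sum_group I A)" "y \<in> carrier (sum_group I A)" for x y
    using that g assms
    by (auto simp: carrier_sum_group fun_eq_iff PiE_def Pi_iff comm_group_def comm_monoid.m_comm)
qed

lemma comm_group_product_group:
  assumes "\<And>i. i \<in> I \<Longrightarrow> comm_group (A i)"
  shows "comm_group (product_group I A)"
proof (rule group.group_comm_groupI)
  have g: "group (A i)" if "i \<in> I" for i using assms[OF that] by (simp add: comm_group_def)
  then show "group (product_group I A)" by simp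
  show "x \<otimes>\<^bsub>product_group I A\<^esub> y = y \<otimes>\<^bsub>product_group I A\<^esub> x"
    if "x \<in> carrier (product_group I A)" "y \<in> carrier (product_group I A)" for x y
    using that assms
    by (auto simp: fun_eq_iff PiE_def Pi_iff comm_group_def comm_monoid.m_comm)
qed

lemma sum_gen_hom:
  assumes "\<And>j. j \<in> I \<Longrightarrow> group (A j)" "i \<in> I"
  shows "sum_gen I A i \<in> hom (A i) (sum_group I A)"
proof (rule homI)
  have "finite {j \<in> I. sum_gen I A i a j \<noteq> \<one>\<^bsub>A j\<^esub>}" for a
    by (rule finite_subset[of _ "{i}"]) (auto simp: sum_gen_def)
  then show "sum_gen I A i a \<in> carrier (sum_group I A)" if "a \<in> carrier (A i)" for a
    using assms that by (auto simp: carrier_sum_group sum_gen_def group.is_monoid)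
  show "sum_gen I A i (a \<otimes>\<^bsub>A i\<^esub> b) = sum_gen I A i a \<otimes>\<^bsub>sum_group I A\<^esub> sum_gen I A i b" for a b
    using assms by (auto simp: sum_gen_def fun_eq_iff group.is_monoid monoid.l_one)
qed

lemma gfinprod_sum_gen:
  assumes G: "comm_group G" and f: "\<And>j. j \<in> I \<Longrightarrow> f j \<in> hom (A j) G"
    and A: "\<And>j. j \<in> I \<Longrightarrow> group (A j)" and i: "i \<in> I" and a: "a \<in> carrier (A i)"
  shows "gfinprod G (\<lambda>j. f j (sum_gen I A i a j)) I = f i a"
proof -
  interpret comm_group G by fact
  have fa: "f i a \<in> carrier G" using hom_in_carrier[OF f[OF i] a] .
  have one: "f j \<one>\<^bsub>A j\<^esub> = \<one>\<^bsub>G\<^esub>" if "j \<in> I" for j using hom_one[OF f A is_group] that by blast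
  have "gfinprod G (\<lambda>j. f j a) {i} = gfinprod G (\<lambda>j. f j (sum_gen I A i a j)) I"
    using i fa by (intro gfinprod_mono_neutral_cong_left) (auto simp: sum_gen_def one)
  then show ?thesis using fa by simp
qed

text \<open>
  Induction on a finite set that contains the support of \<open>x\<close>, splitting off one coordinate at a time.
\<close>

lemma sum_group_hom_eqI:
  assumes G: "group G" and h: "h \<in> hom (sum_group I A) G" and h': "h' \<in> hom (sum_group I A) G"
    and A: "\<And>j. j \<in> I \<Longrightarrow> group (A j)"
    and eq: "\<And>i a. \<lbrakk>i \<in> I; a \<in> carrier (A i)\<rbrakk> \<Longrightarrow> h (sum_gen I A i a) = h' (sum_gen I A i a)"
    and x: "x \<in> carrier (sum_group I A)"
  shows "h x = h' x"
proof -
  have gS: "group (sum_group I A)" using A by simp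
  interpret G: group G by fact
  have "h x = h' x" if "finite S" "x \<in> carrier (sum_group I A)" "{j \<in> I. x j \<noteq> \<one>\<^bsub>A j\<^esub>} \<subseteq> S" for S x
    using that
  proof (induction S arbitrary: x rule: finite_induct)
    case empty
    then have "x = \<one>\<^bsub>sum_group I A\<^esub>"
      using A by (auto simp: carrier_sum_group PiE_def extensional_def fun_eq_iff)
    then show ?case using hom_one[OF h gS G] hom_one[OF h' gS G] by metis
  next
    case (insert i S)
    show ?case
    proof (cases "i \<in> I")
      case False
      then show ?thesis using insert by blast
    next
      case i: True
      define y where "y = x(i := \<one>\<^bsub>A i\<^esub>)"
      have xi: "x i \<in> carrier (A i)" using insert.prems(1) i A by (auto simp: carrier_sum_group PiE_def)
      have yf: "finite {j \<in> I. y j \<noteq> \<one>\<^bsub>A j\<^esub>}"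
        by (rule finite_subset[of _ "insert i S"]) (use insert in \<open>auto simp: y_def\<close>)
      then have y: "y \<in> carrier (sum_group I A)"
        using insert.prems(1) A i by (auto simp: carrier_sum_group PiE_def extensional_def y_def group.is_monoid)
      have "x = sum_gen I A i (x i) \<otimes>\<^bsub>sum_group I A\<^esub> y"
        using insert.prems(1) A i
        by (auto simp: carrier_sum_group PiE_def extensional_def fun_eq_iff sum_gen_def y_def group.is_monoid
            monoid.l_one monoid.r_one Pi_iff)
      moreover have "h y = h' y"
        using insert.prems by (intro insert.IH y) (auto simp: y_def)
      moreover have "sum_gen I A i (x i) \<in> carrier (sum_group I A)"
        using A i xi by (intro hom_in_carrier[OF sum_gen_hom]) auto
      ultimately show ?thesis
        using eq[OF i xi] hom_mult[OF h _ y] hom_mult[OF h' _ y] by metis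
    qed
  qed
  then show ?thesis using x A by (auto simp: carrier_sum_group)
qed

context small_category
begin

text \<open>
  The free cover is built from carriers.  Any family of sets, given the shape of a module, therefore
  has a free cover, which is the free module on this family.
\<close>

definition generators :: "'i set \<Rightarrow> ('i \<Rightarrow> 'l) \<Rightarrow> ('l, 'i) cmodule"
  where "generators I s = \<lparr>Grp = (\<lambda>v. \<lparr>carrier = {i \<in> I. s i = v}, monoid.mult = (\<lambda>x y. x), one = undefined\<rparr>),
    Act = (\<lambda>\<mu> x. x)\<rparr>"

definition free_module :: "'i set \<Rightarrow> ('i \<Rightarrow> 'l) \<Rightarrow> ('l, ('l \<times> 'i) \<Rightarrow>\<^sub>0 int) cmodule"
  where "free_module I s = free_cover \<Lambda> (generators I s)"

definition free_gens :: "'i set \<Rightarrow> ('i \<Rightarrow> 'l) \<Rightarrow> 'l \<Rightarrow> ('l \<times> 'i) set"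
  where "free_gens I s v = {(\<mu>, i). \<mu> \<in> Mor \<Lambda> \<and> Src \<Lambda> \<mu> = v \<and> i \<in> I \<and> s i = Rng \<Lambda> \<mu>}"

lemma free_cover_gens_generators: "free_cover_gens \<Lambda> (generators I s) v = free_gens I s v"
  by (auto simp: free_cover_gens_def free_gens_def generators_def)

lemma Grp_free_module: "Grp (free_module I s) v = free_Abelian_group (free_gens I s v)"
  by (simp add: free_module_def free_cover_def free_cover_gens_generators)

lemma Act_free_module: "Act (free_module I s) \<nu> = frag_extend (\<lambda>(\<mu>, i). frag_of (Cmp \<Lambda> \<mu> \<nu>, i))"
  by (simp add: free_module_def free_cover_def)

lemma right_module_free: "right_module \<Lambda> (free_module I s)"
  unfolding free_module_def by (rule right_module_free_cover)

lemma free_module_map_exists: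
  assumes M: "right_module \<Lambda> M" and c: "\<And>i. i \<in> I \<Longrightarrow> c i \<in> carrier (Grp M (s i))"
  shows "\<exists>\<phi>. module_map \<Lambda> (free_module I s) M \<phi> \<and>
    (\<forall>v\<in>Obj \<Lambda>. \<forall>\<mu> i. (\<mu>, i) \<in> free_gens I s v \<longrightarrow> \<phi> v (frag_of (\<mu>, i)) = Act M \<mu> (c i))"
proof -
  have "c p \<in> carrier (Grp M v)" if "p \<in> carrier (Grp (generators I s) v)" for v p
    using that c by (auto simp: generators_def)
  then show ?thesis using free_cover_universal[OF M, of "generators I s" "\<lambda>v. c"]
    by (simp add: free_module_def free_cover_gens_generators)
qed

text \<open>
  The basis element \<open>(\<mu>, i)\<close> results from the generator \<open>(s i, i)\<close> by the action of \<open>\<mu>\<close>.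
\<close>

lemma free_module_map_eqI:
  assumes M: "right_module \<Lambda> M" and \<phi>: "module_map \<Lambda> (free_module I s) M \<phi>"
    and \<psi>: "module_map \<Lambda> (free_module I s) M \<psi>"
    and eq: "\<And>i. \<lbrakk>i \<in> I; s i \<in> Obj \<Lambda>\<rbrakk> \<Longrightarrow> \<phi> (s i) (frag_of (s i, i)) = \<psi> (s i) (frag_of (s i, i))"
    and v: "v \<in> Obj \<Lambda>" and x: "x \<in> carrier (Grp (free_module I s) v)"
  shows "\<phi> v x = \<psi> v x"
proof (rule hom_free_Abelian_group_eqI)
  show "group (Grp M v)" using right_module_group[OF M v] by (simp add: comm_group_def)
  show "\<phi> v \<in> hom (free_Abelian_group (free_gens I s v)) (Grp M v)"
    "\<psi> v \<in> hom (free_Abelian_group (free_gens I s v)) (Grp M v)"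
    using module_map_hom[OF \<phi> v] module_map_hom[OF \<psi> v] by (simp_all add: Grp_free_module)
  show "x \<in> carrier (free_Abelian_group (free_gens I s v))" using x by (simp add: Grp_free_module)
  fix y assume "y \<in> free_gens I s v"
  then obtain \<mu> i where y: "y = (\<mu>, i)" "\<mu> \<in> Mor \<Lambda>" "Src \<Lambda> \<mu> = v" "i \<in> I" "s i = Rng \<Lambda> \<mu>"
    by (auto simp: free_gens_def)
  have r: "Rng \<Lambda> \<mu> \<in> Obj \<Lambda>" using Rng_Obj y by blast
  have g: "frag_of (Rng \<Lambda> \<mu>, i) \<in> carrier (Grp (free_module I s) (Rng \<Lambda> \<mu>))"
    using y r by (simp add: Grp_free_module free_gens_def Obj_Mor Src_id Rng_id)
  have a: "Act (free_module I s) \<mu> (frag_of (Rng \<Lambda> \<mu>, i)) = frag_of y"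
    using y by (simp add: Act_free_module Cmp_id_left)
  show "\<phi> v (frag_of y) = \<psi> v (frag_of y)"
    using module_map_act[OF \<phi> y(2) g] module_map_act[OF \<psi> y(2) g] eq[OF y(4)] r y(3,5) a by simp
qed

definition free_eval ::
    "'i set \<Rightarrow> ('i \<Rightarrow> 'l) \<Rightarrow> ('l \<Rightarrow> (('l \<times> 'i) \<Rightarrow>\<^sub>0 int) \<Rightarrow> 'b) \<Rightarrow> 'i \<Rightarrow> 'b"
  where "free_eval I s \<phi> = (\<lambda>i\<in>I. \<phi> (s i) (frag_of (s i, i)))"

context
  fixes I :: "'i set" and s :: "'i \<Rightarrow> 'l"
  assumes s: "\<And>i. i \<in> I \<Longrightarrow> s i \<in> Obj \<Lambda>"
begin

lemma free_gens_id: "i \<in> I \<Longrightarrow> (s i, i) \<in> free_gens I s (s i)"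
  using s[of i] by (simp add: free_gens_def Obj_Mor Src_id Rng_id)

lemma free_gens_id_carrier: "i \<in> I \<Longrightarrow> frag_of (s i, i) \<in> carrier (Grp (free_module I s) (s i))"
  by (simp add: Grp_free_module free_gens_id)

text \<open>
  A section of \<open>\<pi>\<close> is the module map that sends each generator to a chosen preimage.
\<close>

lemma projective_free: "projective \<Lambda> (free_module I s :: ('l, ('l \<times> 'i) \<Rightarrow>\<^sub>0 int) cmodule)"
  unfolding projective_def
proof (intro conjI allI impI)
  let ?F = "free_module I s :: ('l, ('l \<times> 'i) \<Rightarrow>\<^sub>0 int) cmodule"
  show F: "right_module \<Lambda> ?F" by (rule right_module_free)
  fix Q :: "('l, ('l \<times> (('l \<times> 'i) \<Rightarrow>\<^sub>0 int)) \<Rightarrow>\<^sub>0 int) cmodule" and \<pi>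
  assume Q: "right_module \<Lambda> Q" and \<pi>: "surj_module_map \<Lambda> Q ?F \<pi>"
  have \<pi>m: "module_map \<Lambda> Q ?F \<pi>" using \<pi> by (simp add: surj_module_map_def)
  have "\<exists>q. q \<in> carrier (Grp Q (s i)) \<and> \<pi> (s i) q = frag_of (s i, i)" if i: "i \<in> I" for i
  proof -
    have "frag_of (s i, i) \<in> carrier (Grp ?F (s i))"
      by (rule free_gens_id_carrier[OF i])
    also have "\<dots> = \<pi> (s i) ` carrier (Grp Q (s i))" using \<pi> s[OF i] by (simp add: surj_module_map_def)
    finally show ?thesis by (rule imageE) (rule exI, rule conjI, assumption, erule sym)
  qed
  then have "\<exists>q. \<forall>i\<in>I. q i \<in> carrier (Grp Q (s i)) \<and> \<pi> (s i) (q i) = frag_of (s i, i)"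
    by (intro bchoice) blast
  then obtain q where q: "\<And>i. i \<in> I \<Longrightarrow> q i \<in> carrier (Grp Q (s i)) \<and> \<pi> (s i) (q i) = frag_of (s i, i)"
    by blast
  obtain \<sigma> where \<sigma>: "module_map \<Lambda> ?F Q \<sigma>"
    and \<sigma>g: "\<And>v \<mu> i. \<lbrakk>v \<in> Obj \<Lambda>; (\<mu>, i) \<in> free_gens I s v\<rbrakk> \<Longrightarrow> \<sigma> v (frag_of (\<mu>, i)) = Act Q \<mu> (q i)"
    using free_module_map_exists[OF Q, of I q s] q by blast
  have c: "module_map \<Lambda> ?F ?F (\<lambda>v x. \<pi> v (\<sigma> v x))"
    using module_map_comp[OF \<sigma> \<pi>m] by (simp add: o_def)
  have "\<pi> v (\<sigma> v x) = x" if "v \<in> Obj \<Lambda>" "x \<in> carrier (Grp ?F v)" for v x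
  proof (rule free_module_map_eqI[OF F c module_map_id _ that])
    fix i assume i: "i \<in> I" and "s i \<in> Obj \<Lambda>"
    with q[OF i] Q free_gens_id[OF i] show "\<pi> (s i) (\<sigma> (s i) (frag_of (s i, i))) = frag_of (s i, i)"
      by (simp add: \<sigma>g right_module_def)
  qed
  with \<sigma> show "\<exists>\<sigma>. module_map \<Lambda> ?F Q \<sigma> \<and> (\<forall>v\<in>Obj \<Lambda>. \<forall>x\<in>carrier (Grp ?F v). \<pi> v (\<sigma> v x) = x)"
    by blast
qed

lemma free_eval_iso:
  assumes M: "right_module \<Lambda> M"
  shows "free_eval I s \<in> iso (Hom_group \<Lambda> (free_module I s) M) (product_group I (\<lambda>i. Grp M (s i)))"
proof -
  let ?F = "free_module I s" let ?H = "Hom_group \<Lambda> ?F M"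
  have F: "right_module \<Lambda> ?F" by (rule right_module_free)
  have hom: "free_eval I s \<in> hom ?H (product_group I (\<lambda>i. Grp M (s i)))"
  proof (rule homI)
    show "free_eval I s \<phi> \<in> carrier (product_group I (\<lambda>i. Grp M (s i)))" if \<phi>: "\<phi> \<in> carrier ?H" for \<phi>
      using module_map_closed[OF Hom_group_carrierD[OF \<phi>] s free_gens_id_carrier] by (auto simp: free_eval_def)
    show "free_eval I s (\<phi> \<otimes>\<^bsub>?H\<^esub> \<psi>) = free_eval I s \<phi> \<otimes>\<^bsub>product_group I (\<lambda>i. Grp M (s i))\<^esub> free_eval I s \<psi>" for \<phi> \<psi>
      by (auto simp: free_eval_def Hom_group_mult hom_ext_apply s free_gens_id_carrier)
  qed
  have inj: "inj_on (free_eval I s) (carrier ?H)"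
  proof (rule inj_onI)
    fix \<phi> \<psi> assume \<phi>: "\<phi> \<in> carrier ?H" and \<psi>: "\<psi> \<in> carrier ?H" and e: "free_eval I s \<phi> = free_eval I s \<psi>"
    show "\<phi> = \<psi>"
    proof (rule Hom_group_eqI[OF \<phi> \<psi>], rule free_module_map_eqI[OF M Hom_group_carrierD[OF \<phi>] Hom_group_carrierD[OF \<psi>]])
      show "\<phi> (s i) (frag_of (s i, i)) = \<psi> (s i) (frag_of (s i, i))" if "i \<in> I" for i
        using fun_cong[OF e, of i] that by (simp add: free_eval_def)
    qed
  qed
  have "c \<in> free_eval I s ` carrier ?H" if c: "c \<in> carrier (product_group I (\<lambda>i. Grp M (s i)))" for c
  proof -
    have ci: "c i \<in> carrier (Grp M (s i))" if "i \<in> I" for i using c that by auto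
    obtain \<phi> where \<phi>: "module_map \<Lambda> ?F M \<phi>"
      and \<phi>g: "\<And>v \<mu> i. \<lbrakk>v \<in> Obj \<Lambda>; (\<mu>, i) \<in> free_gens I s v\<rbrakk> \<Longrightarrow> \<phi> v (frag_of (\<mu>, i)) = Act M \<mu> (c i)"
      using free_module_map_exists[OF M, of I c s] ci by blast
    have "free_eval I s (hom_ext ?F \<phi>) = c"
    proof (rule extensionalityI[of _ I])
      show "free_eval I s (hom_ext ?F \<phi>) i = c i" if i: "i \<in> I" for i
        using i s[OF i] \<phi>g[OF s[OF i] free_gens_id[OF i]] ci[OF i] M free_gens_id_carrier[OF i]
        by (simp add: free_eval_def hom_ext_apply right_module_def)
    qed (use c in \<open>auto simp: free_eval_def PiE_def\<close>)
    then show ?thesis using Hom_group_carrierI[OF F \<phi>] by (metis image_eqI)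
  qed
  with hom inj show ?thesis by (auto simp: iso_def bij_betw_def hom_def Pi_iff)
qed

text \<open>
  By balancedness \<open>(\<mu>, i) \<otimes> a = (s i, i) \<otimes> (\<mu> \<cdot> a)\<close>, so the tensors \<open>(s i, i) \<otimes> a\<close> with \<open>a\<close> in \<open>N (s i)\<close>
  generate, and \<open>a \<mapsto> (s i, i) \<otimes> a\<close> defines the inverse \<open>\<Psi>\<close>.
\<close>

lemma free_tensor_iso:
  assumes N: "left_module \<Lambda> N"
  shows "\<exists>\<Theta>\<in>iso (tensor_group \<Lambda> (free_module I s) N) (sum_group I (\<lambda>i. Grp N (s i))).
    \<forall>v\<in>Obj \<Lambda>. \<forall>\<mu> i a. (\<mu>, i) \<in> free_gens I s v \<longrightarrow> a \<in> carrier (Grp N v) \<longrightarrow>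
      \<Theta> (tens (free_module I s) N v (frag_of (\<mu>, i)) a) = sum_gen I (\<lambda>i. Grp N (s i)) i (Act N \<mu> a)"
proof -
  let ?F = "free_module I s" let ?A = "\<lambda>i. Grp N (s i)"
  let ?S = "sum_group I ?A" and ?T = "tensor_group \<Lambda> ?F N"
  have F: "right_module \<Lambda> ?F" by (rule right_module_free)
  have gA: "group (?A i)" if "i \<in> I" for i using left_module_group[OF N s[OF that]] by (simp add: comm_group_def)
  have cS: "comm_group ?S" by (rule comm_group_sum_group) (rule left_module_group[OF N s])
  interpret S: comm_group ?S by (rule cS)
  interpret T: comm_group ?T by (rule comm_group_tensor[OF F N])
  note gen_hom = sum_gen_hom[of I ?A, OF gA]
  have gen_closed: "sum_gen I ?A i (Act N \<mu> a) \<in> carrier ?S"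
    if "(\<mu>, i) \<in> free_gens I s v" "a \<in> carrier (Grp N v)" for \<mu> i v a
    using that by (intro hom_in_carrier[OF gen_hom]) (auto simp: free_gens_def left_module_act_closed[OF N])
  have "\<exists>b. b \<in> hom (free_Abelian_group (free_gens I s v)) ?S \<and>
      (\<forall>x\<in>free_gens I s v. b (frag_of x) = sum_gen I ?A (snd x) (Act N (fst x) a))"
    if a: "a \<in> carrier (Grp N v)" for v a
  proof -
    have "(\<lambda>x. sum_gen I ?A (snd x) (Act N (fst x) a)) ` free_gens I s v \<subseteq> carrier ?S"
      using gen_closed a by auto
    from S.free_Abelian_group_universal[OF this] obtain h where
      "h \<in> hom (free_Abelian_group (free_gens I s v)) ?S"
      "\<And>x. x \<in> free_gens I s v \<Longrightarrow> h (frag_of x) = sum_gen I ?A (snd x) (Act N (fst x) a)" by blast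
    then show ?thesis by (intro exI[of _ h]) simp
  qed
  note ex = someI_ex[OF this]
  define \<beta> where "\<beta> v a = (SOME b. b \<in> hom (free_Abelian_group (free_gens I s v)) ?S \<and>
      (\<forall>x\<in>free_gens I s v. b (frag_of x) = sum_gen I ?A (snd x) (Act N (fst x) a)))" for v a
  have \<beta>: "\<And>v a. a \<in> carrier (Grp N v) \<Longrightarrow> \<beta> v a \<in> hom (free_Abelian_group (free_gens I s v)) ?S"
    and \<beta>x: "\<And>v a x. a \<in> carrier (Grp N v) \<Longrightarrow> x \<in> free_gens I s v \<Longrightarrow>
      \<beta> v a (frag_of x) = sum_gen I ?A (snd x) (Act N (fst x) a)"
    using ex unfolding \<beta>_def by blast+
  have \<beta>g: "\<beta> v a (frag_of (\<mu>, i)) = sum_gen I ?A i (Act N \<mu> a)"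
    if "a \<in> carrier (Grp N v)" "(\<mu>, i) \<in> free_gens I s v" for v a \<mu> i using \<beta>x[OF that] by simp
  have b1: "\<beta> v a m \<in> carrier ?S" if "m \<in> carrier (Grp ?F v)" "a \<in> carrier (Grp N v)" for v m a
    using hom_in_carrier[OF \<beta>] that by (simp add: Grp_free_module)
  have b2: "\<beta> v a (m \<otimes>\<^bsub>Grp ?F v\<^esub> m') = \<beta> v a m \<otimes>\<^bsub>?S\<^esub> \<beta> v a m'"
    if "m \<in> carrier (Grp ?F v)" "m' \<in> carrier (Grp ?F v)" "a \<in> carrier (Grp N v)" for v m m' a
    using hom_mult[OF \<beta>[OF that(3)], of m m'] that by (simp add: Grp_free_module)
  have b3: "\<beta> v (a \<otimes>\<^bsub>Grp N v\<^esub> a') m = \<beta> v a m \<otimes>\<^bsub>?S\<^esub> \<beta> v a' m"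
    if v: "v \<in> Obj \<Lambda>" and m: "m \<in> carrier (Grp ?F v)"
      and a: "a \<in> carrier (Grp N v)" "a' \<in> carrier (Grp N v)" for v m a a'
  proof -
    interpret Nv: comm_group "Grp N v" by (rule left_module_group[OF N v])
    have aa: "a \<otimes>\<^bsub>Grp N v\<^esub> a' \<in> carrier (Grp N v)" using a by simp
    show ?thesis
    proof (rule hom_free_Abelian_group_eqI[OF S.is_group \<beta>[OF aa] hom_pointwise_mult[OF cS \<beta>[OF a(1)] \<beta>[OF a(2)]]])
      show "m \<in> carrier (free_Abelian_group (free_gens I s v))" using m by (simp add: Grp_free_module)
      fix x assume x: "x \<in> free_gens I s v"
      then obtain \<mu> i where xi: "x = (\<mu>, i)" "\<mu> \<in> Mor \<Lambda>" "Src \<Lambda> \<mu> = v" "i \<in> I" "s i = Rng \<Lambda> \<mu>"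
        by (auto simp: free_gens_def)
      have "Act N \<mu> (a \<otimes>\<^bsub>Grp N v\<^esub> a') = Act N \<mu> a \<otimes>\<^bsub>?A i\<^esub> Act N \<mu> a'"
        using hom_mult[OF left_module_act[OF N xi(2)]] a xi by simp
      then show "\<beta> v (a \<otimes>\<^bsub>Grp N v\<^esub> a') (frag_of x) = \<beta> v a (frag_of x) \<otimes>\<^bsub>?S\<^esub> \<beta> v a' (frag_of x)"
        using hom_mult[OF gen_hom[OF _ xi(4)], of "Act N \<mu> a" "Act N \<mu> a'"] xi a left_module_act_closed[OF N xi(2)]
        unfolding \<beta>x[OF aa x] \<beta>x[OF a(1) x] \<beta>x[OF a(2) x] by simp
    qed
  qed
  have b4: "\<beta> (Src \<Lambda> \<mu>) a (Act ?F \<mu> m) = \<beta> (Rng \<Lambda> \<mu>) (Act N \<mu> a) m"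
    if \<mu>: "\<mu> \<in> Mor \<Lambda>" and m: "m \<in> carrier (Grp ?F (Rng \<Lambda> \<mu>))" and a: "a \<in> carrier (Grp N (Src \<Lambda> \<mu>))" for \<mu> m a
  proof -
    have a': "Act N \<mu> a \<in> carrier (Grp N (Rng \<Lambda> \<mu>))" by (rule left_module_act_closed[OF N \<mu> a])
    have h: "(\<lambda>m. \<beta> (Src \<Lambda> \<mu>) a (Act ?F \<mu> m)) \<in> hom (free_Abelian_group (free_gens I s (Rng \<Lambda> \<mu>))) ?S"
      using hom_compose[OF right_module_act[OF F \<mu>, unfolded Grp_free_module] \<beta>[OF a]] by (simp add: o_def)
    show ?thesis
    proof (rule hom_free_Abelian_group_eqI[OF S.is_group h \<beta>[OF a']])
      show "m \<in> carrier (free_Abelian_group (free_gens I s (Rng \<Lambda> \<mu>)))" using m by (simp add: Grp_free_module)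
      fix x assume x: "x \<in> free_gens I s (Rng \<Lambda> \<mu>)"
      then obtain \<nu> i where xi: "x = (\<nu>, i)" "\<nu> \<in> Mor \<Lambda>" "Src \<Lambda> \<nu> = Rng \<Lambda> \<mu>" "i \<in> I" "s i = Rng \<Lambda> \<nu>"
        by (auto simp: free_gens_def)
      have "(Cmp \<Lambda> \<nu> \<mu>, i) \<in> free_gens I s (Src \<Lambda> \<mu>)"
        using xi \<mu> by (simp add: free_gens_def Cmp_closed Src_Cmp Rng_Cmp)
      then show "\<beta> (Src \<Lambda> \<mu>) a (Act ?F \<mu> (frag_of x)) = \<beta> (Rng \<Lambda> \<mu>) (Act N \<mu> a) (frag_of x)"
        using x xi \<mu> a a' by (simp add: Act_free_module \<beta>g left_module_act_Cmp[OF N])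
    qed
  qed
  obtain \<Theta> where \<Theta>: "\<Theta> \<in> hom ?T ?S"
    and \<Theta>t: "\<And>v m a. \<lbrakk>v \<in> Obj \<Lambda>; m \<in> carrier (Grp ?F v); a \<in> carrier (Grp N v)\<rbrakk> \<Longrightarrow>
      \<Theta> (tens ?F N v m a) = \<beta> v a m"
    by (rule tensor_universal[OF F N cS, of "\<lambda>v m a. \<beta> v a m"]) (simp_all add: b1 b2 b3 b4)
  have \<Theta>g: "\<Theta> (tens ?F N v (frag_of (\<mu>, i)) a) = sum_gen I ?A i (Act N \<mu> a)"
    if "v \<in> Obj \<Lambda>" "(\<mu>, i) \<in> free_gens I s v" "a \<in> carrier (Grp N v)" for v \<mu> i a
    using \<Theta>t[OF that(1) _ that(3)] \<beta>g[OF that(3,2)] that(2) by (simp add: Grp_free_module)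
  define f where "f i a = tens ?F N (s i) (frag_of (s i, i)) a" for i a
  have f: "f i \<in> hom (?A i) ?T" if "i \<in> I" for i
    using tens_hom_right[OF F N s[OF that] free_gens_id_carrier[OF that]] by (simp add: f_def[abs_def])
  define \<Psi> where "\<Psi> x = gfinprod ?T (\<lambda>i. f i (x i)) I" for x
  have \<Psi>: "\<Psi> \<in> hom ?S ?T" using T.hom_group_sum[of I f ?A, OF f gA] by (simp add: \<Psi>_def[abs_def])
  have \<Psi>g: "\<Psi> (sum_gen I ?A i a) = f i a" if "i \<in> I" "a \<in> carrier (?A i)" for i a
    unfolding \<Psi>_def by (rule gfinprod_sum_gen[where f = f and A = "?A" and I = I, OF T.comm_group_axioms f gA that])
  have \<Theta>\<Psi>: "\<Theta> (\<Psi> x) = x" if x: "x \<in> carrier ?S" for x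
  proof (rule sum_group_hom_eqI[where I = I and A = "?A" and h' = "\<lambda>x. x", OF S.is_group hom_compose[OF \<Psi> \<Theta>, unfolded comp_def] _ gA _ x])
    show "(\<lambda>x. x) \<in> hom ?S ?S" by (auto simp: hom_def)
    show "\<Theta> (\<Psi> (sum_gen I ?A i a)) = sum_gen I ?A i a" if i: "i \<in> I" and a: "a \<in> carrier (?A i)" for i a
      using \<Theta>g[OF s[OF i] free_gens_id[OF i] a] left_module_act_id[OF N s[OF i] a] \<Psi>g[OF i a] by (simp add: f_def)
  qed auto
  have \<Psi>\<Theta>: "\<Psi> (\<Theta> x) = x" if x: "x \<in> carrier ?T" for x
  proof (rule tensor_hom_eqI[OF F N T.is_group hom_compose[OF \<Theta> \<Psi>, unfolded comp_def] _ _ x, where h' = "\<lambda>x. x"])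
    show "(\<lambda>x. x) \<in> hom ?T ?T" by (auto simp: hom_def)
    fix v m a assume v: "v \<in> Obj \<Lambda>" and m: "m \<in> carrier (Grp ?F v)" and a: "a \<in> carrier (Grp N v)"
    note t = tens_hom_left[OF F N v a, unfolded Grp_free_module]
    show "\<Psi> (\<Theta> (tens ?F N v m a)) = tens ?F N v m a"
    proof (rule hom_free_Abelian_group_eqI[OF T.is_group _ t,
          where h = "\<lambda>m. \<Psi> (\<Theta> (tens ?F N v m a))"])
      show "(\<lambda>m. \<Psi> (\<Theta> (tens ?F N v m a))) \<in> hom (free_Abelian_group (free_gens I s v)) ?T"
        using hom_compose[OF t hom_compose[OF \<Theta> \<Psi>]] by (simp add: o_def)
      show "m \<in> carrier (free_Abelian_group (free_gens I s v))" using m by (simp add: Grp_free_module)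
      fix x assume x: "x \<in> free_gens I s v"
      then obtain \<mu> i where xi: "x = (\<mu>, i)" "\<mu> \<in> Mor \<Lambda>" "Src \<Lambda> \<mu> = v" "i \<in> I" "s i = Rng \<Lambda> \<mu>"
        by (auto simp: free_gens_def)
      have a': "Act N \<mu> a \<in> carrier (?A i)" using left_module_act_closed[OF N xi(2)] a xi by simp
      have "\<Psi> (\<Theta> (tens ?F N v (frag_of x) a)) = tens ?F N (Rng \<Lambda> \<mu>) (frag_of (Rng \<Lambda> \<mu>, i)) (Act N \<mu> a)"
        using \<Theta>g[OF v _ a, of \<mu> i] x xi(1) \<Psi>g[OF xi(4) a'] xi(5) by (simp add: f_def)
      also have "\<dots> = tens ?F N v (Act ?F \<mu> (frag_of (Rng \<Lambda> \<mu>, i))) a"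
        using tens_balanced[OF F N xi(2), of "frag_of (Rng \<Lambda> \<mu>, i)" a] free_gens_id_carrier[OF xi(4)] xi a by simp
      also have "\<dots> = tens ?F N v (frag_of x) a" using xi by (simp add: Act_free_module Cmp_id_left)
      finally show "\<Psi> (\<Theta> (tens ?F N v (frag_of x) a)) = tens ?F N v (frag_of x) a" .
    qed
  qed
  have "bij_betw \<Theta> (carrier ?T) (carrier ?S)"
    by (rule bij_betwI[where g = \<Psi>]) (use \<Theta> \<Psi> \<Theta>\<Psi> \<Psi>\<Theta> in \<open>auto simp: hom_def\<close>)
  with \<Theta> \<Theta>g show ?thesis by (intro bexI[of _ \<Theta>]) (auto simp: iso_def)
qed

end

end

section \<open>Contracting a complex of cells along commuting shifts\<close>

lemma frag_additive_eqI:
  fixes f g :: "('a \<Rightarrow>\<^sub>0 int) \<Rightarrow> 'b::ab_group_add"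
  assumes f: "\<And>a b. f (a - b) = f a - f b" and g: "\<And>a b. g (a - b) = g a - g b"
    and eq: "\<And>x. x \<in> S \<Longrightarrow> f (frag_of x) = g (frag_of x)" and c: "Poly_Mapping.keys c \<subseteq> S"
  shows "f c = g c"
  using c
proof (rule frag_induction)
  show "f 0 = g 0" using f[of 0 0] g[of 0 0] by simp
qed (simp_all add: f g eq)

lemma frag_cmul_diff: "frag_cmul m (a - b) = frag_cmul m a - frag_cmul m b"
  and frag_cmul_uminus: "frag_cmul (- m) a = - frag_cmul m a"
  by (rule poly_mapping_eqI, simp add: lookup_minus right_diff_distrib)+ 

text \<open>
  The example to keep in mind: \<open>X\<close> consists of the morphisms of a \<open>k\<close>-graph with a fixed source, \<open>D\<close> is
  the degree, and \<open>T i\<close> removes the first edge in direction \<open>i\<close>, which is possible as long as the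
  \<open>i\<close>-th degree is positive.
\<close>

locale commuting_shifts =
  fixes k :: nat and X :: "'x set" and D :: "'x \<Rightarrow> nat \<Rightarrow> nat" and T :: "nat \<Rightarrow> 'x \<Rightarrow> 'x"
  assumes T_closed: "\<lbrakk>x \<in> X; 0 < D x i\<rbrakk> \<Longrightarrow> T i x \<in> X"
    and D_T: "\<lbrakk>x \<in> X; 0 < D x i\<rbrakk> \<Longrightarrow> D (T i x) j = D x j - (if j = i then 1 else 0)"
    and T_comm: "\<lbrakk>x \<in> X; 0 < D x i; 0 < D x j; i \<noteq> j\<rbrakk> \<Longrightarrow> T i (T j x) = T j (T i x)"
    and D_bound: "\<lbrakk>x \<in> X; 0 < D x i\<rbrakk> \<Longrightarrow> i < k"
begin

text \<open>
  A cell \<open>(x, a)\<close> is a cube that starts at \<open>x\<close> and extends in the directions \<open>a\<close>.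
\<close>

definition cells :: "('x \<times> nat set) set"
  where "cells = {(x, a). x \<in> X \<and> (\<forall>i\<in>a. 0 < D x i)}"

definition cells_dim :: "nat \<Rightarrow> ('x \<times> nat set) set"
  where "cells_dim n = {(x, a). (x, a) \<in> cells \<and> card a = n}"

text \<open>
  For \<open>i \<in> a\<close> the exponent is the position of \<open>i\<close>, counted from \<open>1\<close>, in the increasing enumeration of
  \<open>a\<close>.
\<close>

definition sgn_at :: "nat \<Rightarrow> nat set \<Rightarrow> int"
  where "sgn_at i a = (- 1) ^ card {l \<in> a. l \<le> i}"

definition bd_dir :: "nat \<Rightarrow> ('x \<times> nat set \<Rightarrow>\<^sub>0 int) \<Rightarrow> ('x \<times> nat set \<Rightarrow>\<^sub>0 int)"
  where "bd_dir i = frag_extend (\<lambda>(x, a). if i \<in> a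
    then frag_cmul (sgn_at i a) (frag_of (x, a - {i}) - frag_of (T i x, a - {i})) else 0)"

text \<open>
  The sum of all the cells that \<open>x\<close> sweeps out on its way to the end of its ray in direction \<open>j\<close>.
\<close>

definition slide :: "nat \<Rightarrow> ('x \<times> nat set \<Rightarrow>\<^sub>0 int) \<Rightarrow> ('x \<times> nat set \<Rightarrow>\<^sub>0 int)"
  where "slide j = frag_extend (\<lambda>(x, a). if j \<in> a then 0
    else frag_cmul (sgn_at j (insert j a)) (\<Sum>t<D x j. frag_of ((T j ^^ t) x, insert j a)))"

definition collapse :: "nat \<Rightarrow> ('x \<times> nat set \<Rightarrow>\<^sub>0 int) \<Rightarrow> ('x \<times> nat set \<Rightarrow>\<^sub>0 int)"
  where "collapse j = frag_extend (\<lambda>(x, a). if j \<in> a then 0 else frag_of ((T j ^^ D x j) x, a))"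

definition bd :: "('x \<times> nat set \<Rightarrow>\<^sub>0 int) \<Rightarrow> ('x \<times> nat set \<Rightarrow>\<^sub>0 int)"
  where "bd c = (\<Sum>i<k. bd_dir i c)"

lemma additive:
  "bd_dir i (c - c') = bd_dir i c - bd_dir i c'" "slide i (c - c') = slide i c - slide i c'"
  "collapse i (c - c') = collapse i c - collapse i c'" "bd (c - c') = bd c - bd c'"
  by (simp_all add: bd_dir_def slide_def collapse_def bd_def frag_extend_diff sum_subtractf)

lemma frag_zero [simp]: "bd_dir i 0 = 0" "slide i 0 = 0" "bd 0 = 0"
  by (simp_all add: bd_dir_def slide_def bd_def)

lemma additive_simps:
  "bd_dir i (frag_cmul m c) = frag_cmul m (bd_dir i c)" "slide i (frag_cmul m c) = frag_cmul m (slide i c)"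
  "bd_dir i (\<Sum>t<n. f t) = (\<Sum>t<(n::nat). bd_dir i (f t))"
  by (simp_all add: bd_dir_def slide_def frag_extend_cmul)
    (induction n; simp add: frag_extend_add)

lemma bd_dir_of: "bd_dir i (frag_of (x, a)) = (if i \<in> a
    then frag_cmul (sgn_at i a) (frag_of (x, a - {i}) - frag_of (T i x, a - {i})) else 0)"
  and slide_of: "slide j (frag_of (x, a)) = (if j \<in> a then 0
    else frag_cmul (sgn_at j (insert j a)) (\<Sum>t<D x j. frag_of ((T j ^^ t) x, insert j a)))"
  and collapse_of: "collapse j (frag_of (x, a)) = (if j \<in> a then 0 else frag_of ((T j ^^ D x j) x, a))"
  by (simp_all add: bd_dir_def slide_def collapse_def)

lemma cells_finite: "(x, a) \<in> cells \<Longrightarrow> finite a" "(x, a) \<in> cells \<Longrightarrow> a \<subseteq> {..<k}"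
proof -
  show "a \<subseteq> {..<k}" if "(x, a) \<in> cells" using that D_bound by (auto simp: cells_def)
  then show "finite a" if "(x, a) \<in> cells" using that finite_subset by blast
qed

lemma sgn_at_remove:
  assumes "finite a" "i \<in> a" "i < j"
  shows "sgn_at j (a - {i}) = - sgn_at j a"
proof -
  have "{l \<in> a. l \<le> j} = insert i {l \<in> a - {i}. l \<le> j}" using assms by auto
  then have "card {l \<in> a. l \<le> j} = Suc (card {l \<in> a - {i}. l \<le> j})" using assms by simp
  then show ?thesis by (simp add: sgn_at_def)
qed

lemma sgn_at_remove_above: "i < j \<Longrightarrow> sgn_at i (a - {j}) = sgn_at i a"
  unfolding sgn_at_def by (rule arg_cong[of _ _ "\<lambda>S. (- 1) ^ card S"]) auto

text \<open>
  Removing the smaller of the two directions moves the larger one down by one position, whereas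
  removing the larger one does not affect the smaller.
\<close>

lemma sgn_at_swap:
  assumes "finite a" "i \<in> a" "j \<in> a" "i \<noteq> j"
  shows "sgn_at i a * sgn_at j (a - {i}) = - (sgn_at j a * sgn_at i (a - {j}))"
  using assms sgn_at_remove[of a i j] sgn_at_remove[of a j i] sgn_at_remove_above[of i j a]
    sgn_at_remove_above[of j i a]
  by (cases "i < j") auto

lemma sgn_at_square: "sgn_at i a * sgn_at i a = 1"
  by (simp add: sgn_at_def flip: power_add)

lemma sign_exchange:
  fixes p q r t :: int
  assumes "p * p = 1" "t * t = 1" "q * t = - (p * r)"
  shows "p * q = - (r * t)"
proof -
  have "p * q = p * (q * t) * t" using assms(2) by (simp add: mult.assoc)
  also have "\<dots> = - ((p * p) * (r * t))" unfolding assms(3) by simp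
  finally show ?thesis using assms(1) by simp
qed

lemma shift_power:
  assumes "x \<in> X" "t \<le> D x j"
  shows "(T j ^^ t) x \<in> X \<and> (\<forall>i. D ((T j ^^ t) x) i = D x i - (if i = j then t else 0))"
  using assms(2)
proof (induction t)
  case (Suc t)
  then show ?case using T_closed[of "(T j ^^ t) x" j] D_T[of "(T j ^^ t) x" j] by auto
qed (use assms(1) in simp)

lemma shift_power_comm:
  assumes "x \<in> X" "t \<le> D x j" "0 < D x i" "i \<noteq> j"
  shows "(T j ^^ t) (T i x) = T i ((T j ^^ t) x)"
  using assms(2)
proof (induction t)
  case (Suc t)
  then show ?case using T_comm[of "(T j ^^ t) x" i j] shift_power[OF assms(1), of t j] assms by simp
qed simp

lemma bd_dir_anticomm:
  assumes "Poly_Mapping.keys c \<subseteq> cells"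
  shows "bd_dir i (bd_dir j c) = - bd_dir j (bd_dir i c)"
proof (rule frag_additive_eqI[where g = "\<lambda>c. - bd_dir j (bd_dir i c)", OF _ _ _ assms])
  fix z assume z: "z \<in> cells"
  obtain x a where [simp]: "z = (x, a)" by (cases z)
  have x: "x \<in> X" and a: "\<And>l. l \<in> a \<Longrightarrow> 0 < D x l" using z by (auto simp: cells_def)
  have fin: "finite a" using cells_finite z by auto
  show "bd_dir i (bd_dir j (frag_of z)) = - bd_dir j (bd_dir i (frag_of z))"
  proof (cases "i \<in> a \<and> j \<in> a \<and> i \<noteq> j")
    case True
    then have "T i (T j x) = T j (T i x)" by (intro T_comm x a) auto
    moreover have "a - {i} - {j} = a - {j} - {i}" by auto
    moreover have "sgn_at j a * sgn_at i (a - {j}) = - (sgn_at i a * sgn_at j (a - {i}))"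
      using sgn_at_swap[OF fin, of j i] True by simp
    ultimately show ?thesis using True
      by (simp add: bd_dir_of additive additive_simps frag_cmul_diff frag_cmul_uminus del: minus_frag_cmul)
  next
    case False
    then show ?thesis by (auto simp: bd_dir_of additive additive_simps)
  qed
qed (simp_all add: additive)

text \<open>
  The double sum over the anticommuting \<open>bd_dir i\<close> equals its own negative, and a free abelian group
  has no elements of order two.
\<close>

lemma bd_bd:
  assumes "Poly_Mapping.keys c \<subseteq> cells"
  shows "bd (bd c) = 0"
proof -
  let ?A = "\<lambda>i j. bd_dir i (bd_dir j c)"
  have "bd (bd c) = (\<Sum>i<k. \<Sum>j<k. ?A i j)" by (simp add: bd_def additive_simps)
  also have "\<dots> = (\<Sum>j<k. \<Sum>i<k. ?A i j)" by (rule sum.swap)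
  also have "\<dots> = (\<Sum>j<k. \<Sum>i<k. - ?A j i)" by (intro sum.cong refl bd_dir_anticomm[OF assms])
  also have "\<dots> = - bd (bd c)" by (simp add: bd_def additive_simps sum_negf)
  finally have "bd (bd c) = - bd (bd c)" .
  then have "Poly_Mapping.lookup (bd (bd c)) z = Poly_Mapping.lookup (- bd (bd c)) z" for z by simp
  then show ?thesis by (intro poly_mapping_eqI) (simp add: lookup_uminus)
qed

text \<open>
  The cells swept out keep their degrees in the directions other than \<open>j\<close>, because \<open>T j\<close> commutes with
  \<open>T i\<close>.  The two sides therefore involve the same cells, and the signs are compared with
  \<open>sgn_at_swap\<close> for the set \<open>b\<close> obtained from \<open>a\<close> by adding \<open>j\<close>.
\<close>

lemma bd_dir_slide:
  assumes "Poly_Mapping.keys c \<subseteq> cells" and ij: "i \<noteq> j"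
  shows "bd_dir i (slide j c) = - slide j (bd_dir i c)"
proof (rule frag_additive_eqI[where g = "\<lambda>c. - slide j (bd_dir i c)", OF _ _ _ assms(1)])
  fix z assume z: "z \<in> cells"
  obtain x a where [simp]: "z = (x, a)" by (cases z)
  have x: "x \<in> X" and a: "\<And>l. l \<in> a \<Longrightarrow> 0 < D x l" using z by (auto simp: cells_def)
  have fin: "finite a" using cells_finite z by auto
  show "bd_dir i (slide j (frag_of z)) = - slide j (bd_dir i (frag_of z))"
  proof (cases "i \<in> a \<and> j \<notin> a")
    case True
    obtain b where b: "insert j a = b" "insert j (a - {i}) = b - {i}" "b - {j} = a" "finite b" "i \<in> b" "j \<in> b"
      using True ij fin by auto
    have s: "sgn_at j b * sgn_at i b = - (sgn_at i a * sgn_at j (b - {i}))"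
    proof -
      have "sgn_at i b * sgn_at j (b - {i}) = - (sgn_at j b * sgn_at i a)"
        using sgn_at_swap[of b i j] b True ij by simp
      from sign_exchange[OF sgn_at_square sgn_at_square this] show ?thesis .
    qed
    have D: "D (T i x) j = D x j" using D_T[OF x, of i j] a True ij by auto
    have pow: "(T j ^^ t) (T i x) = T i ((T j ^^ t) x)" if "t < D x j" for t
      using shift_power_comm[OF x, of t j i] a True ij that by auto
    have "bd_dir i (slide j (frag_of z)) = frag_cmul (sgn_at j b * sgn_at i b)
        (\<Sum>t<D x j. frag_of ((T j ^^ t) x, b - {i}) - frag_of (T i ((T j ^^ t) x), b - {i}))"
      using True b by (simp add: slide_of bd_dir_of additive_simps frag_cmul_sum)
    also have "\<dots> = - slide j (bd_dir i (frag_of z))"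
      using True ij D unfolding s
      by (simp add: slide_of bd_dir_of additive additive_simps b sum_subtractf pow frag_cmul_diff
          frag_cmul_uminus del: minus_frag_cmul)
    finally show ?thesis .
  next
    case False
    then show ?thesis using ij by (auto simp: bd_dir_of slide_of additive additive_simps)
  qed
qed (simp_all add: additive)

text \<open>
  If \<open>j\<close> is not in \<open>a\<close>, the boundary of the slide telescopes to the two ends of the ray.  If \<open>j\<close> is in
  \<open>a\<close>, the slides of the two ends of the edge differ exactly by the given cell.
\<close>

lemma slide_homotopy:
  assumes "Poly_Mapping.keys c \<subseteq> cells"
  shows "bd_dir j (slide j c) + slide j (bd_dir j c) = c - collapse j c"
proof (rule frag_additive_eqI[where f = "\<lambda>c. bd_dir j (slide j c) + slide j (bd_dir j c)" and
      g = "\<lambda>c. c - collapse j c", OF _ _ _ assms])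
  fix z assume z: "z \<in> cells"
  obtain x a where [simp]: "z = (x, a)" by (cases z)
  have x: "x \<in> X" and a: "\<And>l. l \<in> a \<Longrightarrow> 0 < D x l" using z by (auto simp: cells_def)
  have tele: "(\<Sum>t<n. g t - g (Suc t)) = g 0 - g n" for g :: "nat \<Rightarrow> ('x \<times> nat set \<Rightarrow>\<^sub>0 int)" and n
    by (induction n) simp_all
  show "bd_dir j (slide j (frag_of z)) + slide j (bd_dir j (frag_of z)) = frag_of z - collapse j (frag_of z)"
  proof (cases "j \<in> a")
    case True
    then have "D (T j x) j = D x j - 1" and "0 < D x j" using D_T[OF x, of j j] a by auto
    then obtain n where n: "D x j = Suc n" "D (T j x) j = n" by (cases "D x j") auto
    have "bd_dir j (slide j (frag_of z)) + slide j (bd_dir j (frag_of z)) =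
        (\<Sum>t<Suc n. frag_of ((T j ^^ t) x, a)) - (\<Sum>t<n. frag_of ((T j ^^ t) (T j x), a))"
      using True by (simp add: slide_of bd_dir_of additive additive_simps n insert_absorb sgn_at_square
        frag_cmul_diff[symmetric] del: sum.lessThan_Suc)
    also have "\<dots> = frag_of (x, a)"
      unfolding sum.lessThan_Suc_shift by (simp add: funpow_swap1)
    finally show ?thesis using True by (simp add: collapse_of)
  next
    case False
    then have "bd_dir j (slide j (frag_of z)) =
        (\<Sum>t<D x j. frag_of ((T j ^^ t) x, a) - frag_of ((T j ^^ Suc t) x, a))"
      by (simp add: slide_of bd_dir_of additive_simps sgn_at_square frag_cmul_sum)
    then show ?thesis using False tele[of "\<lambda>t. frag_of ((T j ^^ t) x, a)" "D x j"]
      by (simp add: bd_dir_of collapse_of)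
  qed
qed (simp_all add: additive)

text \<open>
  The directions \<open>i \<noteq> j\<close> cancel by \<open>bd_dir_slide\<close>.
\<close>

lemma bd_slide:
  assumes c: "Poly_Mapping.keys c \<subseteq> cells" and j: "j < k"
  shows "bd (slide j c) + slide j (bd c) = c - collapse j c"
proof -
  have "slide j (bd c) = (\<Sum>i<k. slide j (bd_dir i c))"
    unfolding bd_def slide_def by (rule frag_extend_sum[unfolded o_def]) simp
  then have "bd (slide j c) + slide j (bd c) = (\<Sum>i<k. bd_dir i (slide j c) + slide j (bd_dir i c))"
    by (simp add: bd_def sum.distrib)
  also have "\<dots> = (\<Sum>i<k. if i = j then c - collapse j c else 0)"
    by (rule sum.cong) (simp_all add: slide_homotopy[OF c] bd_dir_slide[OF c] del: minus_frag_cmul)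
  also have "\<dots> = c - collapse j c" using j by simp
  finally show ?thesis .
qed

lemma cells_dim_subset: "cells_dim n \<subseteq> cells"
  by (auto simp: cells_dim_def)

lemma keys_bd:
  assumes "Poly_Mapping.keys c \<subseteq> cells_dim (Suc n)"
  shows "Poly_Mapping.keys (bd c) \<subseteq> cells_dim n"
proof -
  have "Poly_Mapping.keys (bd_dir i c) \<subseteq> cells_dim n" for i
    unfolding bd_dir_def
  proof (rule order.trans[OF keys_frag_extend], rule UN_least)
    fix z assume "z \<in> Poly_Mapping.keys c"
    then obtain x a where z: "z = (x, a)" "(x, a) \<in> cells" "card a = Suc n"
      using assms by (cases z) (auto simp: cells_dim_def)
    have fin: "finite a" using cells_finite(1)[OF z(2)] .
    have "(x, a - {i}) \<in> cells_dim n \<and> (T i x, a - {i}) \<in> cells_dim n" if "i \<in> a"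
      using z that T_closed[of x i] D_T[of x i] by (auto simp: cells_dim_def cells_def card_Diff_singleton)
    then show "Poly_Mapping.keys (case z of (x, a) \<Rightarrow> if i \<in> a
        then frag_cmul (sgn_at i a) (frag_of (x, a - {i}) - frag_of (T i x, a - {i})) else 0) \<subseteq> cells_dim n"
      using keys_cmul[of "sgn_at i a" "frag_of (x, a - {i}) - frag_of (T i x, a - {i})"]
        keys_diff[of "frag_of (x, a - {i})" "frag_of (T i x, a - {i})"] z(1) by auto
  qed
  note * = this
  show ?thesis unfolding bd_def by (rule order.trans[OF keys_sum], rule UN_least, rule *)
qed

lemma keys_slide:
  assumes "Poly_Mapping.keys c \<subseteq> cells_dim n"
  shows "Poly_Mapping.keys (slide j c) \<subseteq> cells_dim (Suc n)"
  unfolding slide_def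
proof (rule order.trans[OF keys_frag_extend], rule UN_least)
  fix z assume "z \<in> Poly_Mapping.keys c"
  then obtain x a where z: "z = (x, a)" "(x, a) \<in> cells" "card a = n"
    using assms by (cases z) (auto simp: cells_dim_def)
  have fin: "finite a" and x: "x \<in> X" using cells_finite(1)[OF z(2)] z(2) by (auto simp: cells_def)
  have "((T j ^^ t) x, insert j a) \<in> cells_dim (Suc n)" if "j \<notin> a" "t < D x j" for t
    using z that shift_power[OF x, of t j] fin by (auto simp: cells_dim_def cells_def)
  then have k: "Poly_Mapping.keys (\<Sum>t<D x j. frag_of ((T j ^^ t) x, insert j a)) \<subseteq> cells_dim (Suc n)" if "j \<notin> a"
    using that by (intro order.trans[OF keys_sum] UN_least) simp
  have "Poly_Mapping.keys (frag_cmul (sgn_at j (insert j a)) (\<Sum>t<D x j. frag_of ((T j ^^ t) x, insert j a)))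
      \<subseteq> cells_dim (Suc n)" if "j \<notin> a"
    by (rule order.trans[OF keys_cmul k[OF that]])
  then show "Poly_Mapping.keys (case z of (x, a) \<Rightarrow> if j \<in> a then 0
    else frag_cmul (sgn_at j (insert j a)) (\<Sum>t<D x j. frag_of ((T j ^^ t) x, insert j a))) \<subseteq> cells_dim (Suc n)"
    using z(1) by (cases "j \<in> a") simp_all
qed

lemma keys_collapse:
  assumes "Poly_Mapping.keys c \<subseteq> {(x, a) \<in> cells_dim n. \<forall>i<m. i \<notin> a \<and> D x i = 0}"
  shows "Poly_Mapping.keys (collapse m c) \<subseteq> {(x, a) \<in> cells_dim n. \<forall>i<Suc m. i \<notin> a \<and> D x i = 0}"
  unfolding collapse_def
proof (rule order.trans[OF keys_frag_extend], rule UN_least)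
  fix z assume "z \<in> Poly_Mapping.keys c"
  then obtain x a where z: "z = (x, a)" "(x, a) \<in> cells" "card a = n" "\<forall>i<m. i \<notin> a \<and> D x i = 0"
    using assms by (cases z) (auto simp: cells_dim_def)
  have x: "x \<in> X" using z(2) by (auto simp: cells_def)
  show "Poly_Mapping.keys (case z of (x, a) \<Rightarrow> if m \<in> a then 0 else frag_of ((T m ^^ D x m) x, a)) \<subseteq>
      {(x, a) \<in> cells_dim n. \<forall>i<Suc m. i \<notin> a \<and> D x i = 0}"
    using z shift_power[OF x, of "D x m" m] by (auto simp: cells_dim_def cells_def less_Suc_eq)
qed

text \<open>
  A cycle is homologous to its collapse in any one direction.  The induction performs the collapses
  one after the other; the cells that are left have no edge and no extent in the directions treated.
  In dimension \<open>0\<close> every chain is a cycle.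
\<close>

lemma collapse_directions:
  assumes c: "Poly_Mapping.keys c \<subseteq> cells_dim n" and cyc: "n = 0 \<or> bd c = 0" and m: "m \<le> k"
  shows "\<exists>b q. Poly_Mapping.keys b \<subseteq> cells_dim (Suc n) \<and>
    Poly_Mapping.keys q \<subseteq> {(x, a) \<in> cells_dim n. \<forall>i<m. i \<notin> a \<and> D x i = 0} \<and> c = bd b + q"
  using m
proof (induction m)
  case 0
  show ?case by (rule exI[of _ 0], rule exI[of _ c]) (use c in auto)
next
  case (Suc m)
  from Suc.prems have "m \<le> k" by simp
  from Suc.IH[OF this] obtain b q where b: "Poly_Mapping.keys b \<subseteq> cells_dim (Suc n)"
    and q: "Poly_Mapping.keys q \<subseteq> {(x, a) \<in> cells_dim n. \<forall>i<m. i \<notin> a \<and> D x i = 0}"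
    and cbq: "c = bd b + q" by blast
  have qc: "Poly_Mapping.keys q \<subseteq> cells_dim n" using q by auto
  have "bd q = 0"
  proof (cases "n = 0")
    case True
    have "bd_dir i q = 0" for i unfolding bd_dir_def
    proof (rule frag_extend_eq_0)
      fix z assume "z \<in> Poly_Mapping.keys q"
      then obtain x a where "z = (x, a)" "(x, a) \<in> cells" "card a = 0"
        using qc True by (cases z) (auto simp: cells_dim_def)
      then show "(case z of (x, a) \<Rightarrow> if i \<in> a
        then frag_cmul (sgn_at i a) (frag_of (x, a - {i}) - frag_of (T i x, a - {i})) else 0) = 0"
        using cells_finite(1) by auto
    qed
    then show ?thesis by (simp add: bd_def)
  next
    case False
    have "bd q = bd c - bd (bd b)" using additive(4)[of c "bd b"] cbq by simp
    also have "\<dots> = 0" using cyc False bd_bd[of b] b cells_dim_subset by auto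
    finally show ?thesis .
  qed
  then have "q = bd (slide m q) + collapse m q"
    using bd_slide[of q m] qc cells_dim_subset[of n] Suc.prems by (simp add: algebra_simps)
  moreover have "bd (b + slide m q) = bd b + bd (slide m q)"
    using additive(4)[of "b + slide m q" "slide m q"] by simp
  ultimately have "c = bd (b + slide m q) + collapse m q" using cbq by (simp add: add.assoc)
  moreover have "Poly_Mapping.keys (b + slide m q) \<subseteq> cells_dim (Suc n)"
    using keys_add[of b "slide m q"] b keys_slide[OF qc, of m] by auto
  ultimately show ?case using keys_collapse[OF q] by blast
qed

lemma bd_exact:
  assumes "Poly_Mapping.keys c \<subseteq> cells_dim (Suc n)" "bd c = 0"
  shows "\<exists>b. Poly_Mapping.keys b \<subseteq> cells_dim (Suc (Suc n)) \<and> bd b = c"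
proof -
  obtain b q where "Poly_Mapping.keys b \<subseteq> cells_dim (Suc (Suc n))"
    and q: "Poly_Mapping.keys q \<subseteq> {(x, a) \<in> cells_dim (Suc n). \<forall>i<k. i \<notin> a \<and> D x i = 0}"
    and "c = bd b + q" using collapse_directions[of c "Suc n" k] assms by blast
  moreover have "{(x, a) \<in> cells_dim (Suc n). \<forall>i<k. i \<notin> a \<and> D x i = 0} = {}"
  proof -
    have False if "(x, a) \<in> cells" "card a = Suc n" "\<forall>i<k. i \<notin> a" for x a
    proof -
      have "a = {}" using that(3) cells_finite(2)[OF that(1)] by blast
      then show False using that(2) by simp
    qed
    then show ?thesis by (auto simp: cells_dim_def)
  qed
  ultimately show ?thesis by auto
qed

lemma bd_contract_0:
  assumes "Poly_Mapping.keys c \<subseteq> cells_dim 0" and x0: "\<And>x. \<lbrakk>x \<in> X; \<forall>i. D x i = 0\<rbrakk> \<Longrightarrow> x = x0"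
  shows "\<exists>b m. Poly_Mapping.keys b \<subseteq> cells_dim 1 \<and> c = bd b + frag_cmul m (frag_of (x0, {}))"
proof -
  obtain b q where b: "Poly_Mapping.keys b \<subseteq> cells_dim 1"
    and q: "Poly_Mapping.keys q \<subseteq> {(x, a) \<in> cells_dim 0. \<forall>i<k. i \<notin> a \<and> D x i = 0}"
    and c: "c = bd b + q" using collapse_directions[of c 0 k] assms(1) unfolding One_nat_def by blast
  have "(x, a) = (x0, {})" if "(x, a) \<in> cells" "\<forall>i<k. i \<notin> a \<and> D x i = 0" for x a
  proof -
    have x: "x \<in> X" using that(1) by (simp add: cells_def)
    have "D x i = 0" for i using that(2) D_bound[OF x, of i] by (cases "i < k") auto
    moreover have "a = {}" using that(2) cells_finite(2)[OF that(1)] by blast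
    ultimately show ?thesis using x0[OF x] by simp
  qed
  then have "Poly_Mapping.keys q \<subseteq> {(x0, {})}" using q by (fastforce simp: cells_dim_def)
  then have "q = frag_cmul (Poly_Mapping.lookup q (x0, {})) (frag_of (x0, {}))"
    by (intro poly_mapping_eqI) (auto simp: in_keys_iff subset_iff)
  then show ?thesis using b c by metis
qed

end

section \<open>Factorization and cubes in a higher-rank graph\<close>

definition ind :: "nat set \<Rightarrow> nat \<Rightarrow> nat"
  where "ind a = (\<lambda>i. if i \<in> a then 1 else 0)"

lemma ind_remove:
  assumes "j \<in> a"
  shows "ind a - unit_deg j = ind (a - {j})" "ind a = ind (a - {j}) + unit_deg j"
    "ind a = unit_deg j + ind (a - {j})"
proof -
  have "ind a i - unit_deg j i = ind (a - {j}) i" "ind a i = ind (a - {j}) i + unit_deg j i"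
    "ind a i = unit_deg j i + ind (a - {j}) i" for i
    using assms by (cases "i = j"; cases "i \<in> a"; simp add: ind_def unit_deg_def)+
  then show "ind a - unit_deg j = ind (a - {j})" "ind a = ind (a - {j}) + unit_deg j"
    "ind a = unit_deg j + ind (a - {j})"
    unfolding fun_eq_iff fun_diff_def plus_fun_def by blast+
qed

lemma card_le_nth_sorted_list_of_set:
  assumes "finite (a :: nat set)" "i < card a"
  shows "card {l \<in> a. l \<le> sorted_list_of_set a ! i} = Suc i"
proof -
  let ?xs = "sorted_list_of_set a"
  have len: "length ?xs = card a" and set: "set ?xs = a" using assms by simp_all
  have "{l \<in> a. l \<le> ?xs ! i} = (\<lambda>j. ?xs ! j) ` {..i}"
  proof (intro equalityI subsetI)
    fix l assume l: "l \<in> {l \<in> a. l \<le> ?xs ! i}"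
    then have "l \<in> set ?xs" using set by blast
    then obtain j where j: "j < card a" "l = ?xs ! j" unfolding in_set_conv_nth len by blast
    have "?xs ! i < ?xs ! j" if "i < j"
      by (rule sorted_wrt_nth_less[OF strict_sorted_list_of_set that]) (simp only: len j)
    then have "j \<le> i" using l j(2) by (cases "i < j") auto
    then show "l \<in> (\<lambda>j. ?xs ! j) ` {..i}" using j(2) by blast
  next
    fix l assume "l \<in> (\<lambda>j. ?xs ! j) ` {..i}"
    then obtain j where j: "j \<le> i" "l = ?xs ! j" by blast
    have "?xs ! j \<in> set ?xs" by (rule nth_mem) (use j(1) assms(2) len in linarith)
    moreover have "?xs ! j \<le> ?xs ! i"
      by (rule sorted_nth_mono[OF sorted_sorted_list_of_set j(1)]) (simp only: len assms(2))
    ultimately show "l \<in> {l \<in> a. l \<le> ?xs ! i}" using j(2) set by blast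
  qed
  moreover have "inj_on (\<lambda>j. ?xs ! j) {..i}"
    by (rule inj_on_nth) (use assms(2) len in auto)
  ultimately show ?thesis by (simp add: card_image)
qed

context k_graph
begin

lemma Nk_diff: "m \<in> Nk k \<Longrightarrow> m - n \<in> Nk k"
  by (simp add: Nk_def)

lemma Nk_le:
  assumes "m \<le> deg \<Lambda> \<xi>" "\<xi> \<in> Mor \<Lambda>"
  shows "m \<in> Nk k"
  unfolding Nk_def mem_Collect_eq
proof (intro allI impI)
  fix i assume "k \<le> i"
  then have "deg \<Lambda> \<xi> i = 0" using deg_Nk[OF assms(2)] by (simp add: Nk_def)
  then show "m i = 0" using le_funD[OF assms(1), of i] by simp
qed

definition fac :: "'l \<Rightarrow> (nat \<Rightarrow> nat) \<Rightarrow> 'l \<times> 'l"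
  where "fac \<xi> m = (THE (\<mu>, \<nu>). \<mu> \<in> Mor \<Lambda> \<and> \<nu> \<in> Mor \<Lambda> \<and> Src \<Lambda> \<mu> = Rng \<Lambda> \<nu> \<and>
    deg \<Lambda> \<mu> = m \<and> deg \<Lambda> \<nu> = deg \<Lambda> \<xi> - m \<and> \<xi> = Cmp \<Lambda> \<mu> \<nu>)"

definition head :: "'l \<Rightarrow> (nat \<Rightarrow> nat) \<Rightarrow> 'l" where "head \<xi> m = fst (fac \<xi> m)"

definition tail :: "'l \<Rightarrow> (nat \<Rightarrow> nat) \<Rightarrow> 'l" where "tail \<xi> m = snd (fac \<xi> m)"

lemma fac_unique:
  assumes "\<mu> \<in> Mor \<Lambda>" "\<nu> \<in> Mor \<Lambda>" "Src \<Lambda> \<mu> = Rng \<Lambda> \<nu>"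
  shows head_Cmp: "head (Cmp \<Lambda> \<mu> \<nu>) (deg \<Lambda> \<mu>) = \<mu>" and tail_Cmp: "tail (Cmp \<Lambda> \<mu> \<nu>) (deg \<Lambda> \<mu>) = \<nu>"
proof -
  let ?\<xi> = "Cmp \<Lambda> \<mu> \<nu>"
  have d: "deg \<Lambda> ?\<xi> = deg \<Lambda> \<mu> + deg \<Lambda> \<nu>" and "?\<xi> \<in> Mor \<Lambda>"
    using assms by (simp_all add: deg_Cmp Cmp_closed)
  then have ex: "\<exists>!(\<mu>', \<nu>'). \<mu>' \<in> Mor \<Lambda> \<and> \<nu>' \<in> Mor \<Lambda> \<and> Src \<Lambda> \<mu>' = Rng \<Lambda> \<nu>' \<and>
      deg \<Lambda> \<mu>' = deg \<Lambda> \<mu> \<and> deg \<Lambda> \<nu>' = deg \<Lambda> \<nu> \<and> ?\<xi> = Cmp \<Lambda> \<mu>' \<nu>'"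
    using assms by (intro factorization deg_Nk) auto
  have d': "deg \<Lambda> ?\<xi> - deg \<Lambda> \<mu> = deg \<Lambda> \<nu>" using d by (simp add: fun_eq_iff)
  have "fac ?\<xi> (deg \<Lambda> \<mu>) = (\<mu>, \<nu>)"
    unfolding fac_def d' by (rule the1_equality[OF ex]) (use assms in simp)
  then show "head ?\<xi> (deg \<Lambda> \<mu>) = \<mu>" "tail ?\<xi> (deg \<Lambda> \<mu>) = \<nu>" by (simp_all add: head_def tail_def)
qed

lemma fac_props:
  assumes \<xi>: "\<xi> \<in> Mor \<Lambda>" and m: "m \<le> deg \<Lambda> \<xi>"
  shows head_Mor: "head \<xi> m \<in> Mor \<Lambda>" and tail_Mor: "tail \<xi> m \<in> Mor \<Lambda>"
    and Src_head: "Src \<Lambda> (head \<xi> m) = Rng \<Lambda> (tail \<xi> m)"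
    and deg_head: "deg \<Lambda> (head \<xi> m) = m" and deg_tail: "deg \<Lambda> (tail \<xi> m) = deg \<Lambda> \<xi> - m"
    and head_tail: "Cmp \<Lambda> (head \<xi> m) (tail \<xi> m) = \<xi>" and Src_tail: "Src \<Lambda> (tail \<xi> m) = Src \<Lambda> \<xi>"
proof -
  have "m + (deg \<Lambda> \<xi> - m) = deg \<Lambda> \<xi>" using m by (auto simp: fun_eq_iff le_fun_def)
  then have "\<exists>!(\<mu>, \<nu>). \<mu> \<in> Mor \<Lambda> \<and> \<nu> \<in> Mor \<Lambda> \<and> Src \<Lambda> \<mu> = Rng \<Lambda> \<nu> \<and>
      deg \<Lambda> \<mu> = m \<and> deg \<Lambda> \<nu> = deg \<Lambda> \<xi> - m \<and> \<xi> = Cmp \<Lambda> \<mu> \<nu>"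
    by (intro factorization \<xi> Nk_le[OF m \<xi>] Nk_diff[OF deg_Nk[OF \<xi>]]) simp
  then obtain \<mu> \<nu> where *: "\<mu> \<in> Mor \<Lambda>" "\<nu> \<in> Mor \<Lambda>" "Src \<Lambda> \<mu> = Rng \<Lambda> \<nu>"
      "deg \<Lambda> \<mu> = m" "deg \<Lambda> \<nu> = deg \<Lambda> \<xi> - m" "\<xi> = Cmp \<Lambda> \<mu> \<nu>" by (auto dest: ex1_implies_ex)
  have h: "head \<xi> m = \<mu>" "tail \<xi> m = \<nu>" using fac_unique[OF *(1-3)] *(4,6) by simp_all
  show "head \<xi> m \<in> Mor \<Lambda>" "tail \<xi> m \<in> Mor \<Lambda>" "Src \<Lambda> (head \<xi> m) = Rng \<Lambda> (tail \<xi> m)"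
    "deg \<Lambda> (head \<xi> m) = m" "deg \<Lambda> (tail \<xi> m) = deg \<Lambda> \<xi> - m" "Cmp \<Lambda> (head \<xi> m) (tail \<xi> m) = \<xi>"
    unfolding h using * by simp_all
  show "Src \<Lambda> (tail \<xi> m) = Src \<Lambda> \<xi>" using * Src_Cmp[OF *(1-3)] unfolding h by simp
qed

lemma head_tail_eqI:
  assumes "\<mu> \<in> Mor \<Lambda>" "\<nu> \<in> Mor \<Lambda>" "Src \<Lambda> \<mu> = Rng \<Lambda> \<nu>" "Cmp \<Lambda> \<mu> \<nu> = \<xi>" "deg \<Lambda> \<mu> = m"
  shows "head \<xi> m = \<mu>" "tail \<xi> m = \<nu>"
  using fac_unique[OF assms(1-3)] assms(4,5) by simp_all

lemma tail_0: "\<xi> \<in> Mor \<Lambda> \<Longrightarrow> tail \<xi> 0 = \<xi>"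
  and head_deg: "\<xi> \<in> Mor \<Lambda> \<Longrightarrow> head \<xi> (deg \<Lambda> \<xi>) = \<xi>"
  using head_tail_eqI(2)[of "Rng \<Lambda> \<xi>" \<xi> \<xi> 0] head_tail_eqI(1)[of \<xi> "Src \<Lambda> \<xi>" \<xi> "deg \<Lambda> \<xi>"]
  by (simp_all add: Rng_Mor Src_Mor Rng_Obj Src_Obj Src_id Rng_id Cmp_id_left Cmp_id_right deg_Obj)

text \<open>
  For \<open>deg \<Lambda> \<xi> = 0\<close> the trivial factorizations of \<open>\<xi>\<close> with the identity on the left and on the right
  have the same degrees, hence agree.
\<close>

lemma deg_0_Obj:
  assumes "\<xi> \<in> Mor \<Lambda>" "deg \<Lambda> \<xi> = 0"
  shows "\<xi> = Src \<Lambda> \<xi>"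
proof -
  have "Rng \<Lambda> \<xi> = \<xi>"
    using head_deg[OF assms(1)] head_tail_eqI(1)[of "Rng \<Lambda> \<xi>" \<xi> \<xi> 0] assms
    by (simp add: Rng_Mor Rng_Obj Src_id Cmp_id_left deg_Obj)
  then have "\<xi> \<in> Obj \<Lambda>" using Rng_Obj[OF assms(1)] by simp
  then show ?thesis by (simp add: Src_id)
qed

text \<open>
  Both sides arise from the factorization of \<open>\<xi>\<close> into pieces of degree \<open>m\<close>, \<open>n\<close> and the rest,
  bracketed in two ways.
\<close>

lemma split3:
  assumes \<xi>: "\<xi> \<in> Mor \<Lambda>" and mn: "m + n \<le> deg \<Lambda> \<xi>"
  shows head_add: "head \<xi> (m + n) = Cmp \<Lambda> (head \<xi> m) (head (tail \<xi> m) n)"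
    and tail_add: "tail \<xi> (m + n) = tail (tail \<xi> m) n"
    and head_head: "head (head \<xi> (m + n)) m = head \<xi> m"
    and tail_head: "tail (head \<xi> (m + n)) m = head (tail \<xi> m) n"
proof -
  have m: "m \<le> deg \<Lambda> \<xi>" using mn by (auto simp: le_fun_def intro: add_leD1)
  note a = fac_props[OF \<xi> m]
  have n: "n \<le> deg \<Lambda> (tail \<xi> m)" using mn by (auto simp: a(5) le_fun_def le_diff_conv2) (metis add.commute le_diff_conv2 add_leD1)
  note b = fac_props[OF a(2) n]
  have c: "Src \<Lambda> (head \<xi> m) = Rng \<Lambda> (head (tail \<xi> m) n)"
    using a(3) b(1-3,6) Rng_Cmp[OF b(1,2,3)] by simp
  have e: "Cmp \<Lambda> (Cmp \<Lambda> (head \<xi> m) (head (tail \<xi> m) n)) (tail (tail \<xi> m) n) = \<xi>"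
    using Cmp_assoc[OF a(1) b(1,2) c b(3)] a(6) b(6) by simp
  have s: "Src \<Lambda> (Cmp \<Lambda> (head \<xi> m) (head (tail \<xi> m) n)) = Rng \<Lambda> (tail (tail \<xi> m) n)"
    using Src_Cmp[OF a(1) b(1) c] b(3) by simp
  have d: "deg \<Lambda> (Cmp \<Lambda> (head \<xi> m) (head (tail \<xi> m) n)) = m + n"
    using deg_Cmp[OF a(1) b(1) c] a(4) b(4) by simp
  note h = head_tail_eqI[OF Cmp_closed[OF a(1) b(1) c] b(2) s e d]
  show "head \<xi> (m + n) = Cmp \<Lambda> (head \<xi> m) (head (tail \<xi> m) n)" "tail \<xi> (m + n) = tail (tail \<xi> m) n"
    by (rule h)+
  show "head (head \<xi> (m + n)) m = head \<xi> m" "tail (head \<xi> (m + n)) m = head (tail \<xi> m) n"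
    unfolding h(1) using head_tail_eqI[OF a(1) b(1) c refl a(4)] by simp_all
qed

lemma seg_eq:
  assumes \<xi>: "\<xi> \<in> Mor \<Lambda>" and m: "m \<le> n" and n: "n \<le> deg \<Lambda> \<xi>"
  shows "seg \<Lambda> \<xi> m n = tail (head \<xi> n) m"
  unfolding seg_def
proof (rule the_equality)
  note a = fac_props[OF \<xi> n]
  have m': "m \<le> deg \<Lambda> (head \<xi> n)" using m a(4) by simp
  note b = fac_props[OF a(1) m']
  show "tail (head \<xi> n) m \<in> Mor \<Lambda> \<and> deg \<Lambda> (tail (head \<xi> n) m) = n - m \<and>
    (\<exists>\<alpha>\<in>Mor \<Lambda>. \<exists>\<beta>\<in>Mor \<Lambda>. Src \<Lambda> \<alpha> = Rng \<Lambda> (tail (head \<xi> n) m) \<and> Src \<Lambda> (tail (head \<xi> n) m) = Rng \<Lambda> \<beta> \<and>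
      deg \<Lambda> \<alpha> = m \<and> \<xi> = Cmp \<Lambda> (Cmp \<Lambda> \<alpha> (tail (head \<xi> n) m)) \<beta>)"
    using a b by (intro conjI bexI[of _ "head (head \<xi> n) m"] bexI[of _ "tail \<xi> n"]) simp_all
next
  fix \<mu> assume "\<mu> \<in> Mor \<Lambda> \<and> deg \<Lambda> \<mu> = n - m \<and> (\<exists>\<alpha>\<in>Mor \<Lambda>. \<exists>\<beta>\<in>Mor \<Lambda>. Src \<Lambda> \<alpha> = Rng \<Lambda> \<mu> \<and>
      Src \<Lambda> \<mu> = Rng \<Lambda> \<beta> \<and> deg \<Lambda> \<alpha> = m \<and> \<xi> = Cmp \<Lambda> (Cmp \<Lambda> \<alpha> \<mu>) \<beta>)"
  then obtain \<alpha> \<beta> where *: "\<mu> \<in> Mor \<Lambda>" "deg \<Lambda> \<mu> = n - m" "\<alpha> \<in> Mor \<Lambda>" "\<beta> \<in> Mor \<Lambda>" "Src \<Lambda> \<alpha> = Rng \<Lambda> \<mu>"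
      "Src \<Lambda> \<mu> = Rng \<Lambda> \<beta>" "deg \<Lambda> \<alpha> = m" "\<xi> = Cmp \<Lambda> (Cmp \<Lambda> \<alpha> \<mu>) \<beta>" by blast
  have "deg \<Lambda> (Cmp \<Lambda> \<alpha> \<mu>) = n"
    using deg_Cmp[OF *(3,1,5)] *(2,7) m by (auto simp: fun_eq_iff le_fun_def)
  then have "head \<xi> n = Cmp \<Lambda> \<alpha> \<mu>"
    using head_tail_eqI(1)[OF Cmp_closed[OF *(3,1,5)] *(4) _ *(8)[symmetric]] Src_Cmp[OF *(3,1,5)] *(6) by simp
  then show "\<mu> = tail (head \<xi> n) m"
    using head_tail_eqI(2)[OF *(3,1,5) refl *(7)] by simp
qed

lemma unit_deg_le: "0 < m i \<Longrightarrow> unit_deg i \<le> m"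
  by (auto simp: unit_deg_def le_fun_def)

definition dirs :: "'l \<Rightarrow> nat set" where "dirs \<eta> = {i. i < k \<and> deg \<Lambda> \<eta> i = 1}"

lemma finite_dirs: "finite (dirs \<eta>)"
  by (rule finite_subset[of _ "{..<k}"]) (auto simp: dirs_def)

text \<open>
  A cube of dimension \<open>n\<close> is a morphism whose degree is the indicator function of a set of \<open>n\<close>
  directions.
\<close>

lemma cubes_iff: "\<eta> \<in> cubes k \<Lambda> (int n) \<longleftrightarrow> \<eta> \<in> Mor \<Lambda> \<and> deg \<Lambda> \<eta> = ind (dirs \<eta>) \<and> card (dirs \<eta>) = n"
proof -
  have iff: "(\<forall>i<k. deg \<Lambda> \<eta> i \<in> {0, 1}) \<longleftrightarrow> deg \<Lambda> \<eta> = ind (dirs \<eta>)" if "\<eta> \<in> Mor \<Lambda>"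
    using deg_Nk[OF that] by (auto simp: ind_def dirs_def fun_eq_iff Nk_def not_less) (metis not_less)
  have sum: "(\<Sum>i<k. deg \<Lambda> \<eta> i) = card (dirs \<eta>)" if d: "deg \<Lambda> \<eta> = ind (dirs \<eta>)"
  proof -
    have "(\<Sum>i<k. deg \<Lambda> \<eta> i) = (\<Sum>i<k. if i \<in> dirs \<eta> then 1 else 0)"
      by (subst d) (simp add: ind_def)
    also have "\<dots> = card ({..<k} \<inter> dirs \<eta>)" by (simp add: sum.inter_restrict[symmetric])
    also have "{..<k} \<inter> dirs \<eta> = dirs \<eta>" by (auto simp: dirs_def)
    finally show ?thesis .
  qed
  show ?thesis unfolding cubes_def mem_Collect_eq using iff sum by (metis of_nat_eq_iff)
qed

lemma dirs_ind: "\<lbrakk>deg \<Lambda> \<eta> = ind a; a \<subseteq> {..<k}\<rbrakk> \<Longrightarrow> dirs \<eta> = a"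
  by (auto simp: dirs_def ind_def split: if_splits)

lemma cubes_neg: "n < 0 \<Longrightarrow> cubes k \<Lambda> n = {}"
  by (auto simp: cubes_def simp del: of_nat_sum)

lemma faces:
  assumes \<eta>: "\<eta> \<in> Mor \<Lambda>" and j: "0 < deg \<Lambda> \<eta> (cube_dir k \<Lambda> \<eta> i)"
  shows face0_eq: "face0 k \<Lambda> i \<eta> = head \<eta> (deg \<Lambda> \<eta> - unit_deg (cube_dir k \<Lambda> \<eta> i))"
    and face1_eq: "face1 k \<Lambda> i \<eta> = tail \<eta> (unit_deg (cube_dir k \<Lambda> \<eta> i))"
    and last_edge_eq: "last_edge k \<Lambda> i \<eta> = tail \<eta> (deg \<Lambda> \<eta> - unit_deg (cube_dir k \<Lambda> \<eta> i))"
proof -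
  let ?e = "unit_deg (cube_dir k \<Lambda> \<eta> i)"
  have le: "?e \<le> deg \<Lambda> \<eta>" "deg \<Lambda> \<eta> - ?e \<le> deg \<Lambda> \<eta>" "0 \<le> deg \<Lambda> \<eta> - ?e"
    using unit_deg_le[of "deg \<Lambda> \<eta>", OF j] by (auto simp: le_fun_def)
  show "face0 k \<Lambda> i \<eta> = head \<eta> (deg \<Lambda> \<eta> - ?e)"
    unfolding face0_def using seg_eq[OF \<eta> le(3,2)] tail_0[OF head_Mor[OF \<eta> le(2)]] by simp
  show "face1 k \<Lambda> i \<eta> = tail \<eta> ?e" "last_edge k \<Lambda> i \<eta> = tail \<eta> (deg \<Lambda> \<eta> - ?e)"
    unfolding face1_def last_edge_def
    using seg_eq[OF \<eta> le(1) order_refl] seg_eq[OF \<eta> le(2) order_refl] head_deg[OF \<eta>] by simp_all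
qed

text \<open>
  The position of the \<open>i\<close>-th direction is \<open>i\<close>; this matches the sign \<open>(- 1) ^ i\<close> of the cubical
  boundary with \<open>sgn_at\<close>.
\<close>

lemma cube_dir_bij:
  assumes "\<eta> \<in> cubes k \<Lambda> (int n)"
  shows "bij_betw (cube_dir k \<Lambda> \<eta>) {1..n} (dirs \<eta>)"
    and "i \<in> {1..n} \<Longrightarrow> card {l \<in> dirs \<eta>. l \<le> cube_dir k \<Lambda> \<eta> i} = i"
proof -
  have n: "card (dirs \<eta>) = n" using assms cubes_iff by simp
  have cd: "cube_dir k \<Lambda> \<eta> i = sorted_list_of_set (dirs \<eta>) ! (i - 1)" for i
    by (simp add: cube_dir_def dirs_def)
  have "bij_betw ((!) (sorted_list_of_set (dirs \<eta>))) {..<n} (dirs \<eta>)"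
    by (rule bij_betw_nth) (use finite_dirs n in simp_all)
  moreover have "bij_betw (\<lambda>i. i - 1) {1..n} {..<n}"
    by (rule bij_betwI[where g = Suc]) auto
  ultimately have "bij_betw ((!) (sorted_list_of_set (dirs \<eta>)) \<circ> (\<lambda>i. i - 1)) {1..n} (dirs \<eta>)"
    by (rule bij_betw_trans[rotated])
  then show "bij_betw (cube_dir k \<Lambda> \<eta>) {1..n} (dirs \<eta>)"
    by (rule bij_betw_cong[THEN iffD1, rotated]) (simp add: cd)
  assume i: "i \<in> {1..n}"
  then have "i - 1 < card (dirs \<eta>)" "Suc (i - 1) = i" using n by auto
  then show "card {l \<in> dirs \<eta>. l \<le> cube_dir k \<Lambda> \<eta> i} = i"
    using card_le_nth_sorted_list_of_set[OF finite_dirs, of "i - 1" \<eta>] by (simp add: cd)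
qed

end

section \<open>The cubical resolution\<close>

context k_graph
begin

definition cub_res :: "nat \<Rightarrow> ('l, ('l \<times> 'l) \<Rightarrow>\<^sub>0 int) cmodule"
  where "cub_res n = free_module (cubes k \<Lambda> (int n)) (Src \<Lambda>)"

abbreviation cub_basis :: "nat \<Rightarrow> 'l \<Rightarrow> ('l \<times> 'l) set"
  where "cub_basis n \<equiv> free_gens (cubes k \<Lambda> (int n)) (Src \<Lambda>)"

text \<open>
  The module map that sends the generator \<open>\<eta>\<close> to the cubical boundary of the cube.  The face at the
  range end has a different source, so that the last edge acts.
\<close>

definition cub_diff :: "nat \<Rightarrow> 'l \<Rightarrow> (('l \<times> 'l) \<Rightarrow>\<^sub>0 int) \<Rightarrow> ('l \<times> 'l) \<Rightarrow>\<^sub>0 int"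
  where "cub_diff n v = frag_extend (\<lambda>(\<mu>, \<eta>). \<Sum>i\<in>{1..n}. frag_cmul ((- 1) ^ i)
    (frag_of (Cmp \<Lambda> (last_edge k \<Lambda> i \<eta>) \<mu>, face0 k \<Lambda> i \<eta>) - frag_of (\<mu>, face1 k \<Lambda> i \<eta>)))"

text \<open>
  The two mutually inverse translations between cells \<open>(\<xi>, a)\<close> and basis elements \<open>(\<mu>, \<eta>)\<close> of the
  cubical resolution, where \<open>\<xi> = \<eta>\<mu>\<close> and \<open>a\<close> is the set of directions of \<open>\<eta>\<close>.
\<close>

definition cell_gen :: "'l \<times> nat set \<Rightarrow> 'l \<times> 'l"
  where "cell_gen = (\<lambda>(\<xi>, a). (tail \<xi> (ind a), head \<xi> (ind a)))"

definition gen_cell :: "'l \<times> 'l \<Rightarrow> 'l \<times> nat set"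
  where "gen_cell = (\<lambda>(\<mu>, \<eta>). (Cmp \<Lambda> \<eta> \<mu>, dirs \<eta>))"

lemma Src_cube: "\<eta> \<in> cubes k \<Lambda> n \<Longrightarrow> Src \<Lambda> \<eta> \<in> Obj \<Lambda>"
  by (auto simp: cubes_def Src_Obj)

lemma Grp_cub_res: "Grp (cub_res n) v = free_Abelian_group (cub_basis n v)"
  by (simp add: cub_res_def Grp_free_module)

lemma shifts_at: "commuting_shifts k {\<xi> \<in> Mor \<Lambda>. Src \<Lambda> \<xi> = v} (deg \<Lambda>) (\<lambda>i \<xi>. tail \<xi> (unit_deg i))"
proof
  fix \<xi> i assume \<xi>: "\<xi> \<in> {\<xi> \<in> Mor \<Lambda>. Src \<Lambda> \<xi> = v}" and i: "0 < deg \<Lambda> \<xi> i"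
  then have m: "\<xi> \<in> Mor \<Lambda>" "Src \<Lambda> \<xi> = v" "unit_deg i \<le> deg \<Lambda> \<xi>" using unit_deg_le[of "deg \<Lambda> \<xi>"] by auto
  show "tail \<xi> (unit_deg i) \<in> {\<xi> \<in> Mor \<Lambda>. Src \<Lambda> \<xi> = v}"
    using tail_Mor[OF m(1,3)] Src_tail[OF m(1,3)] m(2) by simp
  show "deg \<Lambda> (tail \<xi> (unit_deg i)) j = deg \<Lambda> \<xi> j - (if j = i then 1 else 0)" for j
    using deg_tail[OF m(1,3)] by (simp add: unit_deg_def)
  show "i < k" using deg_Nk[OF m(1)] i by (auto simp: Nk_def) (metis not_less less_irrefl)
  show "tail (tail \<xi> (unit_deg j)) (unit_deg i) = tail (tail \<xi> (unit_deg i)) (unit_deg j)"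
    if j: "0 < deg \<Lambda> \<xi> j" and ij: "i \<noteq> j" for j
  proof -
    have "unit_deg i + unit_deg j \<le> deg \<Lambda> \<xi>" "unit_deg j + unit_deg i \<le> deg \<Lambda> \<xi>"
      using i j ij by (auto simp: le_fun_def unit_deg_def)
    then show ?thesis using tail_add[OF m(1), of "unit_deg i" "unit_deg j"] tail_add[OF m(1), of "unit_deg j" "unit_deg i"]
      by (simp add: add.commute)
  qed
qed

context
  fixes v :: 'l
  assumes v: "v \<in> Obj \<Lambda>"
begin

interpretation K: commuting_shifts k "{\<xi> \<in> Mor \<Lambda>. Src \<Lambda> \<xi> = v}" "deg \<Lambda>" "\<lambda>i \<xi>. tail \<xi> (unit_deg i)"
  by (rule shifts_at)

lemma cells_dimD:
  assumes "(\<xi>, a) \<in> K.cells_dim n"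
  shows "\<xi> \<in> Mor \<Lambda>" "Src \<Lambda> \<xi> = v" "ind a \<le> deg \<Lambda> \<xi>" "a \<subseteq> {..<k}" "card a = n" "finite a"
    "\<And>i. i \<in> a \<Longrightarrow> 0 < deg \<Lambda> \<xi> i"
  using assms K.cells_finite[of \<xi> a] by (auto simp: K.cells_dim_def K.cells_def ind_def le_fun_def Suc_le_eq)

lemma cell_gen_basis:
  assumes "z \<in> K.cells_dim n"
  shows "cell_gen z \<in> cub_basis n v" and "gen_cell (cell_gen z) = z"
proof -
  obtain \<xi> a where z: "z = (\<xi>, a)" by (cases z)
  note d = cells_dimD[OF assms[unfolded z]]
  note p = fac_props[OF d(1,3)]
  have dirs: "dirs (head \<xi> (ind a)) = a" using dirs_ind[OF p(4) d(4)] .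
  show "cell_gen z \<in> cub_basis n v"
    using p d dirs by (simp add: z cell_gen_def free_gens_def cubes_iff)
  show "gen_cell (cell_gen z) = z"
    using p(6) dirs by (simp add: z cell_gen_def gen_cell_def)
qed

lemma gen_cell_cells:
  assumes "g \<in> cub_basis n v"
  shows "gen_cell g \<in> K.cells_dim n" and "cell_gen (gen_cell g) = g"
proof -
  obtain \<mu> \<eta> where g: "g = (\<mu>, \<eta>)" by (cases g)
  have *: "\<mu> \<in> Mor \<Lambda>" "Src \<Lambda> \<mu> = v" "\<eta> \<in> Mor \<Lambda>" "deg \<Lambda> \<eta> = ind (dirs \<eta>)" "card (dirs \<eta>) = n" "Src \<Lambda> \<eta> = Rng \<Lambda> \<mu>"
    using assms by (auto simp: g free_gens_def cubes_iff)
  have pos: "0 < deg \<Lambda> \<eta> i" if "i \<in> dirs \<eta>" for i using that by (simp add: dirs_def)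
  show "gen_cell g \<in> K.cells_dim n"
    using * pos by (simp add: g gen_cell_def K.cells_dim_def K.cells_def Cmp_closed Src_Cmp deg_Cmp)
  show "cell_gen (gen_cell g) = g"
    using head_tail_eqI[OF *(3,1,6) refl *(4)] by (simp add: g gen_cell_def cell_gen_def)
qed

definition to_gens :: "('l \<times> nat set \<Rightarrow>\<^sub>0 int) \<Rightarrow> ('l \<times> 'l \<Rightarrow>\<^sub>0 int)"
  where "to_gens = frag_extend (\<lambda>z. frag_of (cell_gen z))"

definition to_cells :: "('l \<times> 'l \<Rightarrow>\<^sub>0 int) \<Rightarrow> ('l \<times> nat set \<Rightarrow>\<^sub>0 int)"
  where "to_cells = frag_extend (\<lambda>g. frag_of (gen_cell g))"

lemma keys_to_gens:
  "Poly_Mapping.keys b \<subseteq> K.cells_dim n \<Longrightarrow> Poly_Mapping.keys (to_gens b) \<subseteq> cub_basis n v"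
  unfolding to_gens_def using keys_frag_extend[of "\<lambda>z. frag_of (cell_gen z)" b] cell_gen_basis(1) by fastforce

lemma keys_to_cells:
  "Poly_Mapping.keys c \<subseteq> cub_basis n v \<Longrightarrow> Poly_Mapping.keys (to_cells c) \<subseteq> K.cells_dim n"
  unfolding to_cells_def using keys_frag_extend[of "\<lambda>g. frag_of (gen_cell g)" c] gen_cell_cells(1) by fastforce

lemma to_cells_to_gens: "Poly_Mapping.keys b \<subseteq> K.cells_dim n \<Longrightarrow> to_cells (to_gens b) = b"
  by (rule frag_additive_eqI[where S = "K.cells_dim n" and g = "\<lambda>b. b"])
    (simp_all add: to_cells_def to_gens_def frag_extend_diff cell_gen_basis(2))

lemma to_gens_to_cells: "Poly_Mapping.keys c \<subseteq> cub_basis n v \<Longrightarrow> to_gens (to_cells c) = c"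
  by (rule frag_additive_eqI[where S = "cub_basis n v" and g = "\<lambda>b. b"])
    (simp_all add: to_cells_def to_gens_def frag_extend_diff gen_cell_cells(2))

text \<open>
  With \<open>j\<close> the \<open>i\<close>-th direction of \<open>\<eta>\<close>, the face that ends earlier and absorbs the last edge into \<open>\<mu>\<close>
  keeps the composite \<open>\<xi>\<close>, and the face that starts later replaces \<open>\<xi>\<close> by \<open>T j \<xi>\<close>.  Both lose the
  direction \<open>j\<close>.
\<close>

lemma cub_diff_cell:
  assumes z: "(\<xi>, a) \<in> K.cells_dim n"
  shows "cub_diff n v (frag_of (cell_gen (\<xi>, a))) = to_gens (K.bd (frag_of (\<xi>, a)))"
proof -
  note d = cells_dimD[OF z] note p = fac_props[OF d(1,3)]
  define \<eta> \<mu> where "\<eta> = head \<xi> (ind a)" and "\<mu> = tail \<xi> (ind a)"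
  have dirs: "dirs \<eta> = a" unfolding \<eta>_def by (rule dirs_ind[OF p(4) d(4)])
  have \<eta>: "\<eta> \<in> Mor \<Lambda>" and deg\<eta>: "deg \<Lambda> \<eta> = ind a" unfolding \<eta>_def by (rule p)+
  have cube: "\<eta> \<in> cubes k \<Lambda> (int n)" using \<eta> deg\<eta> dirs d(5) by (simp add: cubes_iff)
  let ?c = "cube_dir k \<Lambda> \<eta>"
  have bij: "bij_betw ?c {1..n} a" and pos: "\<And>i. i \<in> {1..n} \<Longrightarrow> card {l \<in> a. l \<le> ?c i} = i"
    using cube_dir_bij[OF cube] dirs by auto
  have ca: "?c i \<in> a" if "i \<in> {1..n}" for i using bij that by (auto simp: bij_betw_def)
  let ?G = "\<lambda>j. frag_of (cell_gen (\<xi>, a - {j})) - frag_of (cell_gen (tail \<xi> (unit_deg j), a - {j}))"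
  have faces: "(Cmp \<Lambda> (last_edge k \<Lambda> i \<eta>) \<mu>, face0 k \<Lambda> i \<eta>) = cell_gen (\<xi>, a - {?c i}) \<and>
      (\<mu>, face1 k \<Lambda> i \<eta>) = cell_gen (tail \<xi> (unit_deg (?c i)), a - {?c i})" if i: "i \<in> {1..n}" for i
  proof -
    define j b e where "j = ?c i" and "b = ind (a - {j})" and "e = unit_deg j"
    have ja: "j \<in> a" unfolding j_def by (rule ca[OF i])
    have ie: "ind a = b + e" "ind a = e + b" "ind a - e = b"
      unfolding b_def e_def using ind_remove[OF ja] by simp_all
    have le: "b + e \<le> deg \<Lambda> \<xi>" "e + b \<le> deg \<Lambda> \<xi>" using d(3) ie by simp_all
    have sum_le: "b l + e l \<le> deg \<Lambda> \<xi> l" for l using le_funD[OF le(1), of l] by simp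
    have bl: "b \<le> deg \<Lambda> \<xi>" using sum_le by (intro le_funI) (metis add_leD1)
    have el: "e \<le> deg \<Lambda> (tail \<xi> b)"
    proof (rule le_funI)
      show "e l \<le> deg \<Lambda> (tail \<xi> b) l" for l
        using sum_le[of l] fun_cong[OF deg_tail[OF d(1) bl], of l] by simp
    qed
    have pos: "0 < deg \<Lambda> \<eta> j" using ja by (simp add: deg\<eta> ind_def)
    from faces[OF \<eta> pos[unfolded j_def]]
    have f: "face0 k \<Lambda> i \<eta> = head \<eta> b" "face1 k \<Lambda> i \<eta> = tail \<eta> e" "last_edge k \<Lambda> i \<eta> = tail \<eta> b"
      unfolding j_def[symmetric] e_def[symmetric] deg\<eta> ie(3) by simp_all
    have "head \<eta> b = head \<xi> b" "tail \<eta> b = head (tail \<xi> b) e" "\<mu> = tail (tail \<xi> b) e"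
      unfolding \<eta>_def \<mu>_def ie(1)
      using head_head[OF d(1) le(1)] tail_head[OF d(1) le(1)] tail_add[OF d(1) le(1)] by simp_all
    moreover have "tail \<eta> e = head (tail \<xi> e) b" "\<mu> = tail (tail \<xi> e) b"
      unfolding \<eta>_def \<mu>_def ie(2)
      using tail_head[OF d(1) le(2)] tail_add[OF d(1) le(2)] by simp_all
    moreover have "Cmp \<Lambda> (head (tail \<xi> b) e) (tail (tail \<xi> b) e) = tail \<xi> b"
      by (rule head_tail[OF tail_Mor[OF d(1) bl] el])
    ultimately show ?thesis
      unfolding f cell_gen_def by (simp add: b_def e_def j_def)
  qed
  have "cub_diff n v (frag_of (cell_gen (\<xi>, a))) = (\<Sum>i\<in>{1..n}. frag_cmul ((- 1) ^ i)
      (frag_of (Cmp \<Lambda> (last_edge k \<Lambda> i \<eta>) \<mu>, face0 k \<Lambda> i \<eta>) - frag_of (\<mu>, face1 k \<Lambda> i \<eta>)))"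
    by (simp add: cub_diff_def cell_gen_def \<eta>_def \<mu>_def)
  also have "\<dots> = (\<Sum>i\<in>{1..n}. frag_cmul (K.sgn_at (?c i) a) (?G (?c i)))"
    by (rule sum.cong[OF refl]) (simp only: faces K.sgn_at_def pos)
  also have "\<dots> = (\<Sum>j\<in>a. frag_cmul (K.sgn_at j a) (?G j))"
    by (rule sum.reindex_bij_betw[OF bij])
  also have "\<dots> = (\<Sum>j<k. if j \<in> a then frag_cmul (K.sgn_at j a) (?G j) else 0)"
    using d(4) by (simp add: sum.inter_restrict[symmetric] Int_absorb1)
  also have "\<dots> = (\<Sum>j<k. to_gens (K.bd_dir j (frag_of (\<xi>, a))))"
    by (rule sum.cong[OF refl]) (simp add: to_gens_def K.bd_dir_of frag_extend_cmul frag_extend_diff)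
  also have "\<dots> = to_gens (K.bd (frag_of (\<xi>, a)))"
    unfolding K.bd_def to_gens_def by (subst frag_extend_sum) simp_all
  finally show ?thesis .
qed

lemma cub_diff_to_gens:
  assumes "Poly_Mapping.keys b \<subseteq> K.cells_dim n"
  shows "cub_diff n v (to_gens b) = to_gens (K.bd b)"
proof (rule frag_additive_eqI[where f = "\<lambda>b. cub_diff n v (to_gens b)" and g = "\<lambda>b. to_gens (K.bd b)", OF _ _ _ assms])
  fix z assume "z \<in> K.cells_dim n"
  then show "cub_diff n v (to_gens (frag_of z)) = to_gens (K.bd (frag_of z))"
    using cub_diff_cell by (cases z) (simp add: to_gens_def)
qed (simp_all add: to_gens_def cub_diff_def frag_extend_diff K.additive)

lemma cub_diff_eq:
  assumes "Poly_Mapping.keys c \<subseteq> cub_basis n v"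
  shows "cub_diff n v c = to_gens (K.bd (to_cells c))"
  using cub_diff_to_gens[OF keys_to_cells[OF assms]] to_gens_to_cells[OF assms] by simp

lemma keys_cub_diff:
  assumes "Poly_Mapping.keys c \<subseteq> cub_basis (Suc n) v"
  shows "Poly_Mapping.keys (cub_diff (Suc n) v c) \<subseteq> cub_basis n v"
  unfolding cub_diff_eq[OF assms] by (rule keys_to_gens[OF K.keys_bd[OF keys_to_cells[OF assms]]])

lemma cub_diff_diff:
  assumes "Poly_Mapping.keys c \<subseteq> cub_basis (Suc n) v"
  shows "cub_diff n v (cub_diff (Suc n) v c) = 0"
proof -
  note k = keys_to_cells[OF assms]
  have "cub_diff n v (cub_diff (Suc n) v c) = to_gens (K.bd (K.bd (to_cells c)))"
    unfolding cub_diff_eq[OF assms] by (rule cub_diff_to_gens[OF K.keys_bd[OF k]])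
  then show ?thesis using K.bd_bd[of "to_cells c"] k K.cells_dim_subset by (simp add: to_gens_def subset_trans)
qed

lemma cub_diff_exact:
  assumes c: "Poly_Mapping.keys c \<subseteq> cub_basis (Suc n) v" and 0: "cub_diff (Suc n) v c = 0"
  shows "\<exists>b. Poly_Mapping.keys b \<subseteq> cub_basis (Suc (Suc n)) v \<and> cub_diff (Suc (Suc n)) v b = c"
proof -
  note k = keys_to_cells[OF c]
  have "K.bd (to_cells c) = to_cells (to_gens (K.bd (to_cells c)))"
    by (rule to_cells_to_gens[OF K.keys_bd[OF k], symmetric])
  also have "\<dots> = 0" using 0 unfolding cub_diff_eq[OF c] by (simp add: to_cells_def)
  finally obtain b where b: "Poly_Mapping.keys b \<subseteq> K.cells_dim (Suc (Suc n))" "K.bd b = to_cells c"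
    using K.bd_exact[OF k] by blast
  then show ?thesis
    using keys_to_gens[OF b(1)] cub_diff_to_gens[OF b(1)] to_gens_to_cells[OF c] by auto
qed

text \<open>
  The only morphism of degree \<open>0\<close> with source \<open>v\<close> is \<open>v\<close> itself.
\<close>

lemma cub_contract_0:
  assumes c: "Poly_Mapping.keys c \<subseteq> cub_basis 0 v"
  shows "\<exists>b m. Poly_Mapping.keys b \<subseteq> cub_basis 1 v \<and> c = cub_diff 1 v b + frag_cmul m (frag_of (v, v))"
proof -
  have "\<xi> = v" if "\<xi> \<in> {\<xi> \<in> Mor \<Lambda>. Src \<Lambda> \<xi> = v}" "\<forall>i. deg \<Lambda> \<xi> i = 0" for \<xi>
    using deg_0_Obj[of \<xi>] that by (simp add: fun_eq_iff)
  from K.bd_contract_0[OF keys_to_cells[OF c] this] obtain b m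
    where b: "Poly_Mapping.keys b \<subseteq> K.cells_dim 1"
      and cb: "to_cells c = K.bd b + frag_cmul m (frag_of (v, {}))" by blast
  have "(0 :: nat \<Rightarrow> nat) = ind {}" by (simp add: ind_def fun_eq_iff)
  then have "cell_gen (v, {}) = (v, v)"
    using tail_0[OF Obj_Mor[OF v]] head_deg[OF Obj_Mor[OF v]] deg_Obj[OF v] by (simp add: cell_gen_def)
  then have "c = cub_diff 1 v (to_gens b) + frag_cmul m (frag_of (v, v))"
    using to_gens_to_cells[OF c] cub_diff_to_gens[OF b] cb
    by (simp add: to_gens_def frag_extend_add frag_extend_cmul)
  then show ?thesis using keys_to_gens[OF b] by blast
qed

end

lemma cub_diff_act:
  assumes \<nu>: "\<nu> \<in> Mor \<Lambda>" and c: "Poly_Mapping.keys c \<subseteq> cub_basis n (Rng \<Lambda> \<nu>)"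
  shows "cub_diff n (Src \<Lambda> \<nu>) (Act (cub_res n) \<nu> c) = Act (cub_res m) \<nu> (cub_diff n (Rng \<Lambda> \<nu>) c)"
proof (rule frag_additive_eqI[where f = "\<lambda>c. cub_diff n (Src \<Lambda> \<nu>) (Act (cub_res n) \<nu> c)" and
      g = "\<lambda>c. Act (cub_res m) \<nu> (cub_diff n (Rng \<Lambda> \<nu>) c)", OF _ _ _ c])
  fix z assume "z \<in> cub_basis n (Rng \<Lambda> \<nu>)"
  then obtain \<mu> \<eta> where z: "z = (\<mu>, \<eta>)" and \<mu>: "\<mu> \<in> Mor \<Lambda>" "Src \<Lambda> \<mu> = Rng \<Lambda> \<nu>" and
    \<eta>: "\<eta> \<in> cubes k \<Lambda> (int n)" "Src \<Lambda> \<eta> = Rng \<Lambda> \<mu>" by (auto simp: free_gens_def)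
  have \<eta>m: "\<eta> \<in> Mor \<Lambda>" using \<eta>(1) by (simp add: cubes_iff)
  have "Cmp \<Lambda> (Cmp \<Lambda> (last_edge k \<Lambda> i \<eta>) \<mu>) \<nu> = Cmp \<Lambda> (last_edge k \<Lambda> i \<eta>) (Cmp \<Lambda> \<mu> \<nu>)" if i: "i \<in> {1..n}" for i
  proof -
    have "cube_dir k \<Lambda> \<eta> i \<in> dirs \<eta>" using cube_dir_bij(1)[OF \<eta>(1)] i by (auto simp: bij_betw_def)
    then have "last_edge k \<Lambda> i \<eta> = tail \<eta> (deg \<Lambda> \<eta> - unit_deg (cube_dir k \<Lambda> \<eta> i))"
      by (intro last_edge_eq[OF \<eta>m]) (simp add: dirs_def)
    moreover have "deg \<Lambda> \<eta> - unit_deg (cube_dir k \<Lambda> \<eta> i) \<le> deg \<Lambda> \<eta>" by (simp add: le_fun_def)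
    ultimately have "last_edge k \<Lambda> i \<eta> \<in> Mor \<Lambda>" "Src \<Lambda> (last_edge k \<Lambda> i \<eta>) = Src \<Lambda> \<eta>"
      using tail_Mor[OF \<eta>m] Src_tail[OF \<eta>m] by simp_all
    then show ?thesis using \<mu> \<nu> \<eta>(2) by (intro Cmp_assoc) simp_all
  qed
  then have eq: "Cmp \<Lambda> (last_edge k \<Lambda> i \<eta>) (Cmp \<Lambda> \<mu> \<nu>) = Cmp \<Lambda> (Cmp \<Lambda> (last_edge k \<Lambda> i \<eta>) \<mu>) \<nu>"
    if "i \<in> {1..n}" for i using that by simp
  have "Act (cub_res m) \<nu> (cub_diff n (Rng \<Lambda> \<nu>) (frag_of z)) = (\<Sum>i\<in>{1..n}. frag_cmul ((- 1) ^ i)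
     (frag_of (Cmp \<Lambda> (Cmp \<Lambda> (last_edge k \<Lambda> i \<eta>) \<mu>) \<nu>, face0 k \<Lambda> i \<eta>) - frag_of (Cmp \<Lambda> \<mu> \<nu>, face1 k \<Lambda> i \<eta>)))"
    unfolding cub_res_def Act_free_module cub_diff_def z
    by (subst frag_extend_of, subst case_prod_conv, subst frag_extend_sum) (simp_all add: frag_extend_cmul frag_extend_diff)
  also have "\<dots> = cub_diff n (Src \<Lambda> \<nu>) (Act (cub_res n) \<nu> (frag_of z))"
    unfolding cub_res_def Act_free_module cub_diff_def z frag_extend_of case_prod_conv
    by (rule sum.cong[OF refl]) (simp only: eq)
  finally show "cub_diff n (Src \<Lambda> \<nu>) (Act (cub_res n) \<nu> (frag_of z)) =
    Act (cub_res m) \<nu> (cub_diff n (Rng \<Lambda> \<nu>) (frag_of z))" ..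
qed (simp_all add: cub_res_def Act_free_module cub_diff_def frag_extend_diff)

lemma cub_diff_map: "module_map \<Lambda> (cub_res (Suc n)) (cub_res n) (cub_diff (Suc n))"
  unfolding module_map_def
proof (intro conjI ballI)
  show "cub_diff (Suc n) v \<in> hom (Grp (cub_res (Suc n)) v) (Grp (cub_res n) v)" if v: "v \<in> Obj \<Lambda>" for v
    unfolding Grp_cub_res
  proof (rule homI)
    show "cub_diff (Suc n) v c \<in> carrier (free_Abelian_group (cub_basis n v))"
      if "c \<in> carrier (free_Abelian_group (cub_basis (Suc n) v))" for c
      using keys_cub_diff[OF v] that by simp
  qed (simp add: cub_diff_def frag_extend_add)
  show "cub_diff (Suc n) (Src \<Lambda> \<mu>) (Act (cub_res (Suc n)) \<mu> x) = Act (cub_res n) \<mu> (cub_diff (Suc n) (Rng \<Lambda> \<mu>) x)"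
    if "\<mu> \<in> Mor \<Lambda>" "x \<in> carrier (Grp (cub_res (Suc n)) (Rng \<Lambda> \<mu>))" for \<mu> x
    by (rule cub_diff_act) (use that in \<open>simp_all add: Grp_cub_res\<close>)
qed

lemma vertex_basis: "v \<in> Obj \<Lambda> \<Longrightarrow> (v, v) \<in> cub_basis 0 v"
proof -
  assume v: "v \<in> Obj \<Lambda>"
  have "dirs v = {}" using deg_Obj[OF v] by (simp add: dirs_def)
  then show ?thesis using v deg_Obj[OF v]
    by (simp add: free_gens_def cubes_iff[of _ 0, simplified] Obj_Mor Src_id Rng_id ind_def fun_eq_iff)
qed

text \<open>
  The augmentation sends every generator to \<open>1\<close>; exactness is read off in the coordinates given by
  cells.
\<close>

proposition cubical_resolution: "\<exists>\<epsilon>. projective_resolution \<Lambda> cub_res cub_diff \<epsilon>"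
proof -
  have mZ: "right_module \<Lambda> const_int_module" by (rule right_module_const_int)
  have mR: "right_module \<Lambda> (cub_res n)" for n unfolding cub_res_def by (rule right_module_free)
  obtain \<epsilon> where \<epsilon>: "module_map \<Lambda> (cub_res 0) const_int_module \<epsilon>"
    and \<epsilon>g: "\<And>v \<mu> i. \<lbrakk>v \<in> Obj \<Lambda>; (\<mu>, i) \<in> cub_basis 0 v\<rbrakk> \<Longrightarrow> \<epsilon> v (frag_of (\<mu>, i)) = 1"
    using free_module_map_exists[OF mZ, of "cubes k \<Lambda> (int 0)" "\<lambda>_. 1" "Src \<Lambda>"]
    unfolding cub_res_def by (auto simp: const_int_module_def)
  have \<epsilon>hom: "group_hom (free_Abelian_group (cub_basis 0 v)) integer_group (\<epsilon> v)" if "v \<in> Obj \<Lambda>" for v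
    using module_map_group_hom[OF mR mZ \<epsilon> that] by (simp add: Grp_cub_res const_int_module_def)
  have \<epsilon>m: "\<epsilon> v (frag_cmul m (frag_of (v, v))) = m" if v: "v \<in> Obj \<Lambda>" for v m
  proof -
    interpret group_hom "free_Abelian_group (cub_basis 0 v)" integer_group "\<epsilon> v" by (rule \<epsilon>hom[OF v])
    have k: "Poly_Mapping.keys (frag_of (v, v)) \<subseteq> cub_basis 0 v" using vertex_basis[OF v] by simp
    show ?thesis using hom_int_pow[of "frag_of (v, v)" m] \<epsilon>g[OF v vertex_basis[OF v]] k
      by simp
  qed
  have \<epsilon>d: "\<epsilon> v (cub_diff 1 v c) = 0" if v: "v \<in> Obj \<Lambda>" and c: "Poly_Mapping.keys c \<subseteq> cub_basis 1 v" for v c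
  proof -
    interpret e: group_hom "free_Abelian_group (cub_basis 0 v)" integer_group "\<epsilon> v" by (rule \<epsilon>hom[OF v])
    have hom: "(\<lambda>c. \<epsilon> v (cub_diff 1 v c)) \<in> hom (free_Abelian_group (cub_basis 1 v)) integer_group"
      using hom_compose[OF module_map_hom[OF cub_diff_map v, of 0, unfolded Grp_cub_res] e.homh] by (simp add: o_def)
    have "\<epsilon> v (cub_diff 1 v c) = (\<lambda>_. 0) c"
    proof (rule hom_free_Abelian_group_eqI[OF group_integer_group hom])
      show "(\<lambda>_. 0) \<in> hom (free_Abelian_group (cub_basis 1 v)) integer_group" by (auto simp: hom_def)
      show "c \<in> carrier (free_Abelian_group (cub_basis 1 v))" using c by simp
      fix z assume z: "z \<in> cub_basis 1 v"
      obtain \<mu> \<eta> where zz: "z = (\<mu>, \<eta>)" by (cases z)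
      let ?p = "(Cmp \<Lambda> (last_edge k \<Lambda> 1 \<eta>) \<mu>, face0 k \<Lambda> 1 \<eta>)" and ?q = "(\<mu>, face1 k \<Lambda> 1 \<eta>)"
      have d: "cub_diff 1 v (frag_of z) = frag_of ?q - frag_of ?p" by (simp add: cub_diff_def zz)
      \<comment> \<open>Both ends of an edge are basis elements, unless they coincide and cancel.\<close>
      have "Poly_Mapping.keys (frag_of ?q - frag_of ?p) \<subseteq> cub_basis 0 v"
        using keys_cub_diff[OF v, of "frag_of z" 0] z d by simp
      moreover have "Poly_Mapping.keys (frag_of ?q - frag_of ?p) = {?p, ?q}" if "?p \<noteq> ?q"
        using that by (auto simp: in_keys_iff lookup_minus split: if_splits)
      ultimately have "?p = ?q \<or> ?p \<in> cub_basis 0 v \<and> ?q \<in> cub_basis 0 v" by auto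
      then show "\<epsilon> v (cub_diff 1 v (frag_of z)) = (\<lambda>_. 0) (frag_of z)"
      proof
        assume "?p = ?q" then show ?thesis unfolding d using e.hom_one by simp
      next
        assume pq: "?p \<in> cub_basis 0 v \<and> ?q \<in> cub_basis 0 v"
        then have "\<epsilon> v (frag_of ?q + - frag_of ?p) = \<epsilon> v (frag_of ?q) + \<epsilon> v (- frag_of ?p)"
          using e.hom_mult[of "frag_of ?q" "- frag_of ?p"] by simp
        moreover have "\<epsilon> v (- frag_of ?p) = - \<epsilon> v (frag_of ?p)"
          using e.hom_inv[of "frag_of ?p"] pq by simp
        ultimately show ?thesis unfolding d using pq by (simp add: \<epsilon>g[OF v])
      qed
    qed
    then show ?thesis by simp
  qed
  show ?thesis unfolding projective_resolution_def
  proof (intro exI[of _ \<epsilon>] conjI allI ballI)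
    show "projective \<Lambda> (cub_res n)" for n
      unfolding cub_res_def by (rule projective_free) (rule Src_cube)
    show "module_map \<Lambda> (cub_res (Suc n)) (cub_res n) (cub_diff (Suc n))" for n by (rule cub_diff_map)
    show "surj_module_map \<Lambda> (cub_res 0) const_int_module \<epsilon>"
      unfolding surj_module_map_def
    proof (intro conjI ballI \<epsilon>)
      fix v assume v: "v \<in> Obj \<Lambda>"
      have "m \<in> \<epsilon> v ` carrier (Grp (cub_res 0) v)" for m
        using \<epsilon>m[OF v, of m] vertex_basis[OF v]
        by (intro image_eqI[of _ _ "frag_cmul m (frag_of (v, v))"]) (auto simp: Grp_cub_res)
      then show "\<epsilon> v ` carrier (Grp (cub_res 0) v) = carrier (Grp const_int_module v)"
        by (auto simp: const_int_module_def)
    qed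
    fix v assume v: "v \<in> Obj \<Lambda>"
    show "cub_diff 1 v ` carrier (Grp (cub_res 1) v) = kernel (Grp (cub_res 0) v) integer_group (\<epsilon> v)"
    proof (intro equalityI subsetI)
      fix x assume "x \<in> cub_diff 1 v ` carrier (Grp (cub_res 1) v)"
      then obtain b where b: "x = cub_diff 1 v b" "Poly_Mapping.keys b \<subseteq> cub_basis 1 v"
        by (auto simp: Grp_cub_res)
      then show "x \<in> kernel (Grp (cub_res 0) v) integer_group (\<epsilon> v)"
        using \<epsilon>d[OF v b(2)] keys_cub_diff[OF v, of b 0] by (simp add: kernel_def Grp_cub_res)
    next
      fix x assume x: "x \<in> kernel (Grp (cub_res 0) v) integer_group (\<epsilon> v)"
      then have xk: "Poly_Mapping.keys x \<subseteq> cub_basis 0 v" and x0: "\<epsilon> v x = 0"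
        by (simp_all add: kernel_def Grp_cub_res)
      obtain b m where b: "Poly_Mapping.keys b \<subseteq> cub_basis 1 v"
        and xb: "x = cub_diff 1 v b + frag_cmul m (frag_of (v, v))"
        using cub_contract_0[OF v xk] by blast
      interpret e: group_hom "free_Abelian_group (cub_basis 0 v)" integer_group "\<epsilon> v" by (rule \<epsilon>hom[OF v])
      have "Poly_Mapping.keys (cub_diff 1 v b) \<subseteq> cub_basis 0 v" using keys_cub_diff[OF v, of b 0] b by simp
      moreover have "Poly_Mapping.keys (frag_cmul m (frag_of (v, v))) \<subseteq> cub_basis 0 v"
        using vertex_basis[OF v] by auto
      ultimately have "\<epsilon> v x = \<epsilon> v (cub_diff 1 v b) + \<epsilon> v (frag_cmul m (frag_of (v, v)))"
        using e.hom_mult xb by simp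
      then have "m = 0" using x0 \<epsilon>d[OF v b] \<epsilon>m[OF v] by simp
      then show "x \<in> cub_diff 1 v ` carrier (Grp (cub_res 1) v)" using xb b by (simp add: Grp_cub_res)
    qed
    show "cub_diff (Suc (Suc n)) v ` carrier (Grp (cub_res (Suc (Suc n))) v) =
        kernel (Grp (cub_res (Suc n)) v) (Grp (cub_res n) v) (cub_diff (Suc n) v)" for n
    proof (intro equalityI subsetI)
      fix x assume "x \<in> cub_diff (Suc (Suc n)) v ` carrier (Grp (cub_res (Suc (Suc n))) v)"
      then obtain b where b: "x = cub_diff (Suc (Suc n)) v b" "Poly_Mapping.keys b \<subseteq> cub_basis (Suc (Suc n)) v"
        by (auto simp: Grp_cub_res)
      then show "x \<in> kernel (Grp (cub_res (Suc n)) v) (Grp (cub_res n) v) (cub_diff (Suc n) v)"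
        using keys_cub_diff[OF v b(2)] cub_diff_diff[OF v b(2)]
        by (simp add: kernel_def Grp_cub_res)
    next
      fix x assume "x \<in> kernel (Grp (cub_res (Suc n)) v) (Grp (cub_res n) v) (cub_diff (Suc n) v)"
      then show "x \<in> cub_diff (Suc (Suc n)) v ` carrier (Grp (cub_res (Suc (Suc n))) v)"
        using cub_diff_exact[OF v, of x n] by (fastforce simp: kernel_def Grp_cub_res)
    qed
  qed
qed

end

section \<open>Cubical complexes as tensor products and groups of maps\<close>

lemma hom_finprod:
  assumes "comm_group G" "\<And>i. i \<in> I \<Longrightarrow> f i \<in> hom A G"
  shows "(\<lambda>x. finprod G (\<lambda>i. f i x) I) \<in> hom A G"
proof -
  interpret comm_group G by fact
  have c: "f i x \<in> carrier G" if "i \<in> I" "x \<in> carrier A" for i x using hom_in_carrier[OF assms(2)] that .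
  show ?thesis
  proof (rule homI)
    show "finprod G (\<lambda>i. f i x) I \<in> carrier G" if "x \<in> carrier A" for x
      using c that by (intro finprod_closed) auto
    show "finprod G (\<lambda>i. f i (x \<otimes>\<^bsub>A\<^esub> y)) I = finprod G (\<lambda>i. f i x) I \<otimes>\<^bsub>G\<^esub> finprod G (\<lambda>i. f i y) I"
      if "x \<in> carrier A" "y \<in> carrier A" for x y
    proof -
      have "finprod G (\<lambda>i. f i (x \<otimes>\<^bsub>A\<^esub> y)) I = finprod G (\<lambda>i. f i x \<otimes>\<^bsub>G\<^esub> f i y) I"
        using that c hom_mult[OF assms(2)] by (intro finprod_cong) (auto simp: simp_implies_def)
      also have "\<dots> = finprod G (\<lambda>i. f i x) I \<otimes>\<^bsub>G\<^esub> finprod G (\<lambda>i. f i y) I"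
        using that c by (intro finprod_multf) auto
      finally show ?thesis .
    qed
  qed
qed

lemma hom_signed_difference:
  assumes "comm_group G" "f \<in> hom A G" "g \<in> hom A G"
  shows "(\<lambda>x. (f x \<otimes>\<^bsub>G\<^esub> inv\<^bsub>G\<^esub> g x) [^]\<^bsub>G\<^esub> (z :: int)) \<in> hom A G"
proof -
  interpret comm_group G by fact
  have c: "f x \<in> carrier G" "g x \<in> carrier G" if "x \<in> carrier A" for x
    using hom_in_carrier[OF assms(2)] hom_in_carrier[OF assms(3)] that by auto
  show ?thesis
  proof (rule homI)
    show "(f (x \<otimes>\<^bsub>A\<^esub> y) \<otimes>\<^bsub>G\<^esub> inv\<^bsub>G\<^esub> g (x \<otimes>\<^bsub>A\<^esub> y)) [^]\<^bsub>G\<^esub> z =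
      (f x \<otimes>\<^bsub>G\<^esub> inv\<^bsub>G\<^esub> g x) [^]\<^bsub>G\<^esub> z \<otimes>\<^bsub>G\<^esub> (f y \<otimes>\<^bsub>G\<^esub> inv\<^bsub>G\<^esub> g y) [^]\<^bsub>G\<^esub> z"
      if xy: "x \<in> carrier A" "y \<in> carrier A" for x y
    proof -
      have "f (x \<otimes>\<^bsub>A\<^esub> y) \<otimes>\<^bsub>G\<^esub> inv\<^bsub>G\<^esub> g (x \<otimes>\<^bsub>A\<^esub> y) = (f x \<otimes>\<^bsub>G\<^esub> inv\<^bsub>G\<^esub> g x) \<otimes>\<^bsub>G\<^esub> (f y \<otimes>\<^bsub>G\<^esub> inv\<^bsub>G\<^esub> g y)"
        using c[OF xy(1)] c[OF xy(2)] hom_mult[OF assms(2) xy] hom_mult[OF assms(3) xy] by (simp add: inv_mult m_ac)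
      then show ?thesis using c[OF xy(1)] c[OF xy(2)] by (simp add: int_pow_distrib)
    qed
  qed (use c in simp)
qed

text \<open>
  This translates alternating sums in a free group, as in \<open>cub_diff\<close>, into the multiplicative notation
  of the cubical boundary maps.
\<close>

lemma hom_free_signed_sum:
  assumes G: "comm_group G" and h: "h \<in> hom (free_Abelian_group S) G"
    and A: "finite A" and pq: "\<And>i. i \<in> A \<Longrightarrow> p i \<in> S \<and> q i \<in> S"
  shows "h (\<Sum>i\<in>A. frag_cmul (z i) (frag_of (p i) - frag_of (q i))) =
    finprod G (\<lambda>i. (h (frag_of (p i)) \<otimes>\<^bsub>G\<^esub> inv\<^bsub>G\<^esub> h (frag_of (q i))) [^]\<^bsub>G\<^esub> z i) A"
  using A pq
proof (induction A rule: finite_induct)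
  case empty
  interpret G: comm_group G by fact
  interpret h: group_hom "free_Abelian_group S" G h
    using G h by (simp add: group_hom_def group_hom_axioms_def comm_group_def)
  show ?case using h.hom_one by simp
next
  case (insert i A)
  interpret G: comm_group G by fact
  interpret h: group_hom "free_Abelian_group S" G h
    using G h by (simp add: group_hom_def group_hom_axioms_def comm_group_def)
  let ?t = "\<lambda>i. frag_cmul (z i) (frag_of (p i) - frag_of (q i))"
  have kd: "Poly_Mapping.keys (frag_of (p j) - frag_of (q j)) \<subseteq> S" if "j \<in> insert i A" for j
    using insert.prems[OF that] keys_diff[of "frag_of (p j)" "frag_of (q j)"] by auto
  have kt: "Poly_Mapping.keys (?t j) \<subseteq> S" if "j \<in> insert i A" for j
    using kd[OF that] keys_cmul by blast
  have ks: "Poly_Mapping.keys (sum ?t A) \<subseteq> S"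
    using keys_sum[of ?t A] kt by blast
  have cl: "h (frag_of (p j)) \<in> carrier G" "h (frag_of (q j)) \<in> carrier G" if "j \<in> insert i A" for j
    using insert.prems[OF that] by simp_all
  have "h (frag_of (p i) + - frag_of (q i)) = h (frag_of (p i)) \<otimes>\<^bsub>G\<^esub> h (- frag_of (q i))"
    using h.hom_mult[of "frag_of (p i)" "- frag_of (q i)"] insert.prems[of i] by simp
  also have "h (- frag_of (q i)) = inv\<^bsub>G\<^esub> h (frag_of (q i))"
    using h.hom_inv[of "frag_of (q i)"] insert.prems[of i] by simp
  finally have hd: "h (frag_of (p i) - frag_of (q i)) = h (frag_of (p i)) \<otimes>\<^bsub>G\<^esub> inv\<^bsub>G\<^esub> h (frag_of (q i))"
    by simp
  have ht: "h (?t i) = (h (frag_of (p i)) \<otimes>\<^bsub>G\<^esub> inv\<^bsub>G\<^esub> h (frag_of (q i))) [^]\<^bsub>G\<^esub> z i"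
    using h.hom_int_pow[of "frag_of (p i) - frag_of (q i)" "z i"] kd[of i] hd by simp
  have "h (sum ?t (insert i A)) = h (?t i + sum ?t A)" using insert.hyps by simp
  also have "\<dots> = h (?t i) \<otimes>\<^bsub>G\<^esub> h (sum ?t A)"
    using h.hom_mult[of "?t i" "sum ?t A"] kt[of i] ks by simp
  finally show ?case
    using insert cl by (simp add: ht Pi_def)
qed

context k_graph
begin

lemma cube_faces:
  assumes \<eta>: "\<eta> \<in> cubes k \<Lambda> (int (Suc m))" and i: "i \<in> {1..Suc m}"
  shows face0_cube: "face0 k \<Lambda> i \<eta> \<in> cubes k \<Lambda> (int m)" and face1_cube: "face1 k \<Lambda> i \<eta> \<in> cubes k \<Lambda> (int m)"
    and last_edge_Mor: "last_edge k \<Lambda> i \<eta> \<in> Mor \<Lambda>"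
    and Src_last_edge: "Src \<Lambda> (last_edge k \<Lambda> i \<eta>) = Src \<Lambda> \<eta>"
    and Rng_last_edge: "Rng \<Lambda> (last_edge k \<Lambda> i \<eta>) = Src \<Lambda> (face0 k \<Lambda> i \<eta>)"
    and Src_face1: "Src \<Lambda> (face1 k \<Lambda> i \<eta>) = Src \<Lambda> \<eta>"
proof -
  have c: "\<eta> \<in> Mor \<Lambda>" "deg \<Lambda> \<eta> = ind (dirs \<eta>)" "card (dirs \<eta>) = Suc m" using \<eta> cubes_iff by blast+
  define j where "j = cube_dir k \<Lambda> \<eta> i"
  have j: "j \<in> dirs \<eta>" using cube_dir_bij(1)[OF \<eta>] i unfolding j_def bij_betw_def by blast
  then have pos: "0 < deg \<Lambda> \<eta> j" by (simp add: dirs_def)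
  define b where "b = ind (dirs \<eta> - {j})"
  have ie: "deg \<Lambda> \<eta> - unit_deg j = b" unfolding c(2) b_def by (rule ind_remove(1)[OF j])
  have ble: "b \<le> deg \<Lambda> \<eta>" unfolding ie[symmetric] by (simp add: le_fun_def)
  have ele: "unit_deg j \<le> deg \<Lambda> \<eta>" by (rule unit_deg_le[of "deg \<Lambda> \<eta>" j, OF pos])
  note f = faces[OF c(1) pos[unfolded j_def], folded j_def, unfolded ie]
  note p = fac_props[OF c(1) ble] and q = fac_props[OF c(1) ele]
  have sub: "dirs \<eta> - {j} \<subseteq> {..<k}" by (auto simp: dirs_def)
  have card: "card (dirs \<eta> - {j}) = m" using c(3) j by simp
  have cube: "\<zeta> \<in> cubes k \<Lambda> (int m)" if "\<zeta> \<in> Mor \<Lambda>" "deg \<Lambda> \<zeta> = b" for \<zeta>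
    using that dirs_ind[OF that(2)[unfolded b_def] sub] card by (simp add: cubes_iff b_def)
  show "face0 k \<Lambda> i \<eta> \<in> cubes k \<Lambda> (int m)" unfolding f by (rule cube[OF p(1,4)])
  show "face1 k \<Lambda> i \<eta> \<in> cubes k \<Lambda> (int m)" unfolding f by (rule cube[OF q(2)]) (simp only: q(5) ie)
  show "last_edge k \<Lambda> i \<eta> \<in> Mor \<Lambda>" "Src \<Lambda> (last_edge k \<Lambda> i \<eta>) = Src \<Lambda> \<eta>"
    "Rng \<Lambda> (last_edge k \<Lambda> i \<eta>) = Src \<Lambda> (face0 k \<Lambda> i \<eta>)" "Src \<Lambda> (face1 k \<Lambda> i \<eta>) = Src \<Lambda> \<eta>"
    unfolding f using p(2,3,7) q(7) by simp_all
qed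

lemma cub_diff_keys:
  assumes "(\<mu>, \<eta>) \<in> cub_basis (Suc m) v" "i \<in> {1..Suc m}"
  shows "(Cmp \<Lambda> (last_edge k \<Lambda> i \<eta>) \<mu>, face0 k \<Lambda> i \<eta>) \<in> cub_basis m v" "(\<mu>, face1 k \<Lambda> i \<eta>) \<in> cub_basis m v"
proof -
  have *: "\<mu> \<in> Mor \<Lambda>" "Src \<Lambda> \<mu> = v" "\<eta> \<in> cubes k \<Lambda> (int (Suc m))" "Src \<Lambda> \<eta> = Rng \<Lambda> \<mu>"
    using assms(1) by (auto simp: free_gens_def simp del: of_nat_Suc)
  note c = cube_faces[OF *(3) assms(2)]
  show "(Cmp \<Lambda> (last_edge k \<Lambda> i \<eta>) \<mu>, face0 k \<Lambda> i \<eta>) \<in> cub_basis m v" "(\<mu>, face1 k \<Lambda> i \<eta>) \<in> cub_basis m v"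
    using * c by (simp_all add: free_gens_def Cmp_closed Src_Cmp Rng_Cmp)
qed

lemma cub_gen_eq: "cub_gen k \<Lambda> N n = sum_gen (cubes k \<Lambda> n) (\<lambda>\<eta>. Grp N (Src \<Lambda> \<eta>))"
  by (simp add: cub_gen_def sum_gen_def fun_eq_iff)

context
  fixes N :: "('l, 'b) cmodule"
  assumes N: "left_module \<Lambda> N"
begin

lemma comm_group_cub_chain: "comm_group (cub_chain k \<Lambda> N n)"
  unfolding cub_chain_def by (rule comm_group_sum_group) (rule left_module_group[OF N Src_cube])

lemma cub_gen_hom: "\<eta> \<in> cubes k \<Lambda> n \<Longrightarrow> cub_gen k \<Lambda> N n \<eta> \<in> hom (Grp N (Src \<Lambda> \<eta>)) (cub_chain k \<Lambda> N n)"
  unfolding cub_gen_eq cub_chain_def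
  using sum_gen_hom[of "cubes k \<Lambda> n" "\<lambda>\<eta>. Grp N (Src \<Lambda> \<eta>)" \<eta>] left_module_group[OF N Src_cube]
  by (simp add: comm_group_def)

lemma cub_boundary_gen_hom:
  assumes \<eta>: "\<eta> \<in> cubes k \<Lambda> n"
  shows "cub_boundary_gen k \<Lambda> N n \<eta> \<in> hom (Grp N (Src \<Lambda> \<eta>)) (cub_chain k \<Lambda> N (n - 1))"
  unfolding cub_boundary_gen_def Let_def
proof (intro hom_finprod hom_signed_difference comm_group_cub_chain)
  fix i assume i: "i \<in> {1..nat n}"
  then obtain m where n: "n = int (Suc m)" using int_pos_Suc[of n] by fastforce
  have n': "n - 1 = int m" using n by simp
  have i': "i \<in> {1..Suc m}" using i unfolding n by (simp only: nat_int)
  note c = cube_faces[OF \<eta>[unfolded n] i']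
  have "Act N (last_edge k \<Lambda> i \<eta>) \<in> hom (Grp N (Src \<Lambda> \<eta>)) (Grp N (Src \<Lambda> (face0 k \<Lambda> i \<eta>)))"
    using left_module_act[OF N c(3)] unfolding c(4,5) .
  from hom_compose[OF this cub_gen_hom[OF c(1)]]
  show "(\<lambda>a. cub_gen k \<Lambda> N (n - 1) (face0 k \<Lambda> i \<eta>) (Act N (last_edge k \<Lambda> i \<eta>) a)) \<in>
      hom (Grp N (Src \<Lambda> \<eta>)) (cub_chain k \<Lambda> N (n - 1))" unfolding n' by (simp add: o_def)
  show "cub_gen k \<Lambda> N (n - 1) (face1 k \<Lambda> i \<eta>) \<in> hom (Grp N (Src \<Lambda> \<eta>)) (cub_chain k \<Lambda> N (n - 1))"
    using cub_gen_hom[OF c(2)] unfolding n' c(6) .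
qed

lemma cub_boundary_hom: "cub_boundary k \<Lambda> N n \<in> hom (cub_chain k \<Lambda> N n) (cub_chain k \<Lambda> N (n - 1))"
proof -
  interpret comm_group "cub_chain k \<Lambda> N (n - 1)" by (rule comm_group_cub_chain)
  have "group (Grp N (Src \<Lambda> \<eta>))" if "\<eta> \<in> cubes k \<Lambda> n" for \<eta>
    using left_module_group[OF N Src_cube[OF that]] by (simp add: comm_group_def)
  then show ?thesis
    unfolding cub_boundary_def[abs_def] cub_chain_def[of k \<Lambda> N n]
    by (intro hom_group_sum cub_boundary_gen_hom)
qed

lemma cub_boundary_gen:
  assumes "\<eta> \<in> cubes k \<Lambda> n" "a \<in> carrier (Grp N (Src \<Lambda> \<eta>))"
  shows "cub_boundary k \<Lambda> N n (cub_gen k \<Lambda> N n \<eta> a) = cub_boundary_gen k \<Lambda> N n \<eta> a"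
  unfolding cub_boundary_def cub_gen_eq
  by (rule gfinprod_sum_gen[where f = "cub_boundary_gen k \<Lambda> N n" and A = "\<lambda>\<eta>. Grp N (Src \<Lambda> \<eta>)",
      OF comm_group_cub_chain cub_boundary_gen_hom _ assms])
    (use left_module_group[OF N Src_cube] in \<open>simp_all add: comm_group_def\<close>)

text \<open>
  On the elements \<open>(\<mu>, \<eta>) \<otimes> a\<close>, which correspond to \<open>\<mu> \<cdot> a\<close> in the summand of \<open>\<eta>\<close>, the differential
  \<open>cub_diff \<otimes> id\<close> becomes the cubical boundary: the morphism \<open>\<mu>\<close>, preceded by the last edge for one of
  the two faces, moves over to the side of \<open>a\<close>.
\<close>

lemma cub_homology_iso_cat: "cub_homology k \<Lambda> N n \<cong> cat_homology \<Lambda> cub_res cub_diff N n"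
proof -
  obtain \<epsilon> where R: "projective_resolution \<Lambda> cub_res cub_diff \<epsilon>" using cubical_resolution by blast
  note C = cat_chain_complex[OF N R]
  have mR: "right_module \<Lambda> (cub_res m)" for m by (rule resolution_module[OF R])
  define good where "good m \<Theta> \<longleftrightarrow> \<Theta> \<in> iso (tensor_group \<Lambda> (cub_res m) N) (cub_chain k \<Lambda> N (int m)) \<and>
    (\<forall>v\<in>Obj \<Lambda>. \<forall>\<mu> \<eta> a. (\<mu>, \<eta>) \<in> cub_basis m v \<longrightarrow> a \<in> carrier (Grp N v) \<longrightarrow>
      \<Theta> (tens (cub_res m) N v (frag_of (\<mu>, \<eta>)) a) = cub_gen k \<Lambda> N (int m) \<eta> (Act N \<mu> a))" for m \<Theta>
  have "\<forall>m. \<exists>\<Theta>. good m \<Theta>"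
  proof
    fix m
    show "\<exists>\<Theta>. good m \<Theta>"
      using free_tensor_iso[of "cubes k \<Lambda> (int m)" "Src \<Lambda>" N, OF Src_cube[of _ "int m"] N]
      unfolding good_def cub_res_def cub_gen_eq cub_chain_def Bex_def .
  qed
  from choice[OF this] obtain \<Theta> where \<Theta>: "good m (\<Theta> m)" for m by blast
  have iso: "\<Theta> m \<in> iso (tensor_group \<Lambda> (cub_res m) N) (cub_chain k \<Lambda> N (int m))" for m
    using \<Theta>[of m] by (simp only: good_def)
  have \<Theta>g: "\<Theta> m (tens (cub_res m) N v (frag_of (\<mu>, \<eta>)) a) = cub_gen k \<Lambda> N (int m) \<eta> (Act N \<mu> a)"
    if "v \<in> Obj \<Lambda>" "(\<mu>, \<eta>) \<in> cub_basis m v" "a \<in> carrier (Grp N v)" for m v \<mu> \<eta> a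
    using \<Theta>[of m] that unfolding good_def by blast
  have \<Theta>h: "\<Theta> m \<in> hom (tensor_group \<Lambda> (cub_res m) N) (cub_chain k \<Lambda> N (int m))" for m
    using iso[of m] by (simp add: iso_def)
  \<comment> \<open>In negative degrees all chain groups are trivial; the empty sum consists of \<open>\<lambda>_. undefined\<close>.\<close>
  define \<theta> where "\<theta> n = (if n < 0 then (\<lambda>_ _. undefined) else \<Theta> (nat n))" for n :: int
  have \<theta>m: "\<theta> (int m) = \<Theta> m" for m by (simp add: \<theta>_def)
  have trivial: "carrier (cub_chain k \<Lambda> N n) = {\<lambda>_. undefined}" if "n < 0" for n
    using cubes_neg[OF that] carrier_sum_group[of "{}" "\<lambda>\<eta>. Grp N (Src \<Lambda> \<eta>)"] by (simp add: cub_chain_def)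
  have \<theta>iso: "\<theta> n \<in> iso (cat_chain \<Lambda> cub_res N n) (cub_chain k \<Lambda> N n)" for n
  proof (cases "n < 0")
    case True
    interpret D: comm_group "cub_chain k \<Lambda> N n" by (rule comm_group_cub_chain)
    have "\<one>\<^bsub>cub_chain k \<Lambda> N n\<^esub> = (\<lambda>_. undefined)" using D.one_closed trivial[OF True] by blast
    then have "(\<lambda>_. undefined) \<otimes>\<^bsub>cub_chain k \<Lambda> N n\<^esub> (\<lambda>_. undefined) = (\<lambda>_. undefined)"
      using D.l_one[OF D.one_closed] by simp
    then show ?thesis using True trivial[OF True]
      by (simp add: \<theta>_def cat_chain_simps iso_def hom_def bij_betw_def)
  next
    case False
    then obtain m where n: "n = int m" using int_neg_or_nat by blast
    show ?thesis unfolding n \<theta>m cat_chain_simps by (rule iso)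
  qed
  have com: "\<theta> (n - 1) (cat_boundary \<Lambda> cub_res cub_diff N n x) = cub_boundary k \<Lambda> N n (\<theta> n x)"
    if x: "x \<in> carrier (cat_chain \<Lambda> cub_res N n)" for n x
  proof (cases "n \<le> 0")
    case True
    then have "n - 1 < 0" by simp
    from trivial[OF this] have *: "a = b" if "a \<in> carrier (cub_chain k \<Lambda> N (n - 1))" "b \<in> carrier (cub_chain k \<Lambda> N (n - 1))" for a b
      using that by auto
    have th: "\<theta> n \<in> hom (cat_chain \<Lambda> cub_res N n) (cub_chain k \<Lambda> N n)" for n
      using \<theta>iso[of n] by (simp add: iso_def)
    have "cat_boundary \<Lambda> cub_res cub_diff N n x \<in> carrier (cat_chain \<Lambda> cub_res N (n - 1))"
      by (rule hom_in_carrier[OF _ x]) (use C in \<open>simp add: chain_complex_def\<close>)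
    then show ?thesis
      by (intro * hom_in_carrier[OF th] hom_in_carrier[OF cub_boundary_hom] x)
  next
    case False
    then obtain m where n: "n = int (Suc m)" using int_pos_Suc by blast
    then have n': "n - 1 = int m" by simp
    let ?d = "cub_diff (Suc m)" and ?T = "tensor_group \<Lambda> (cub_res (Suc m)) N" and ?C = "cub_chain k \<Lambda> N (int m)"
    interpret D: comm_group ?C by (rule comm_group_cub_chain)
    note dh = tensor_induced_hom[OF mR mR N resolution_diff[OF R, of m]]
    note dt = tensor_induced_tens[OF mR mR N resolution_diff[OF R, of m]]
    have bh: "cub_boundary k \<Lambda> N (int (Suc m)) \<in> hom (cub_chain k \<Lambda> N (int (Suc m))) ?C"
      using cub_boundary_hom[of "int (Suc m)"] by simp
    have l: "(\<lambda>x. \<Theta> m (tensor_induced (cub_res m) N ?d x)) \<in> hom ?T ?C"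
      by (rule hom_compose[OF dh \<Theta>h, unfolded comp_def])
    have r: "(\<lambda>x. cub_boundary k \<Lambda> N (int (Suc m)) (\<Theta> (Suc m) x)) \<in> hom ?T ?C"
      by (rule hom_compose[OF \<Theta>h bh, unfolded comp_def])
    have x: "x \<in> carrier ?T" using x by (simp only: n cat_chain_simps)
    have "\<Theta> m (tensor_induced (cub_res m) N ?d x) = cub_boundary k \<Lambda> N (int (Suc m)) (\<Theta> (Suc m) x)"
    proof (rule tensor_hom_eqI[OF mR N D.is_group l r _ x])
      fix v c a assume v: "v \<in> Obj \<Lambda>" and c: "c \<in> carrier (Grp (cub_res (Suc m)) v)" and a: "a \<in> carrier (Grp N v)"
      note t = tens_hom_left[OF mR N v a, unfolded Grp_cub_res]
      have th: "(\<lambda>c. \<Theta> m (tens (cub_res m) N v c a)) \<in> hom (free_Abelian_group (cub_basis m v)) ?C"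
        by (rule hom_compose[OF t \<Theta>h, unfolded comp_def])
      show "\<Theta> m (tensor_induced (cub_res m) N ?d (tens (cub_res (Suc m)) N v c a)) =
        cub_boundary k \<Lambda> N (int (Suc m)) (\<Theta> (Suc m) (tens (cub_res (Suc m)) N v c a))"
      proof (rule hom_free_Abelian_group_eqI[OF D.is_group hom_compose[OF t l, unfolded comp_def]
            hom_compose[OF t r, unfolded comp_def]])
        show "c \<in> carrier (free_Abelian_group (cub_basis (Suc m) v))" using c by (simp only: Grp_cub_res)
        fix g assume g: "g \<in> cub_basis (Suc m) v"
        obtain \<mu> \<eta> where gg: "g = (\<mu>, \<eta>)" by (cases g)
        have *: "\<mu> \<in> Mor \<Lambda>" "Src \<Lambda> \<mu> = v" "\<eta> \<in> cubes k \<Lambda> (int (Suc m))" "Src \<Lambda> \<eta> = Rng \<Lambda> \<mu>"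
          using g gg by (auto simp: free_gens_def simp del: of_nat_Suc)
        have a': "Act N \<mu> a \<in> carrier (Grp N (Src \<Lambda> \<eta>))" using left_module_act_closed[OF N *(1)] a * by simp
        note k = cub_diff_keys[OF g[unfolded gg]]
        have gc: "frag_of g \<in> carrier (Grp (cub_res (Suc m)) v)" unfolding Grp_cub_res using g by simp
        let ?b = "Act N \<mu> a" and ?\<tau> = "\<lambda>c. \<Theta> m (tens (cub_res m) N v c a)"
        let ?e = "\<lambda>i. last_edge k \<Lambda> i \<eta>" and ?f = "\<lambda>i. face0 k \<Lambda> i \<eta>" and ?f' = "\<lambda>i. face1 k \<Lambda> i \<eta>"
        let ?x = "\<lambda>i. cub_gen k \<Lambda> N (int m) (?f i) (Act N (?e i) ?b)"
          and ?y = "\<lambda>i. cub_gen k \<Lambda> N (int m) (?f' i) ?b"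
        have xy: "?x i \<in> carrier ?C" "?y i \<in> carrier ?C"
          "?\<tau> (frag_of (Cmp \<Lambda> (?e i) \<mu>, ?f i)) = ?x i" "?\<tau> (frag_of (\<mu>, ?f' i)) = ?y i"
          if i: "i \<in> {1..Suc m}" for i
        proof -
          note c = cube_faces[OF *(3) i]
          show "?x i \<in> carrier ?C"
            using hom_in_carrier[OF cub_gen_hom[OF c(1)]] left_module_act_closed[OF N c(3)] a' c(4,5) by simp
          show "?y i \<in> carrier ?C"
            using hom_in_carrier[OF cub_gen_hom[OF c(2)]] a' c(6) by simp
          show "?\<tau> (frag_of (Cmp \<Lambda> (?e i) \<mu>, ?f i)) = ?x i" "?\<tau> (frag_of (\<mu>, ?f' i)) = ?y i"
            using \<Theta>g[OF v k(1)[OF i] a] \<Theta>g[OF v k(2)[OF i] a] c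
              left_module_act_Cmp[OF N _ *(1), of "?e i" a] a *(2,4) by simp_all
        qed
        have "\<Theta> m (tensor_induced (cub_res m) N ?d (tens (cub_res (Suc m)) N v (frag_of g) a)) =
            ?\<tau> (?d v (frag_of g))" using dt[OF v gc a] by simp
        also have "?d v (frag_of g) = (\<Sum>i\<in>{1..Suc m}. frag_cmul ((- 1) ^ i)
            (frag_of (Cmp \<Lambda> (?e i) \<mu>, ?f i) - frag_of (\<mu>, ?f' i)))"
          unfolding cub_diff_def gg frag_extend_of by simp
        also have "?\<tau> \<dots> = (\<Otimes>\<^bsub>?C\<^esub>i\<in>{1..Suc m}. (?\<tau> (frag_of (Cmp \<Lambda> (?e i) \<mu>, ?f i)) \<otimes>\<^bsub>?C\<^esub>
            inv\<^bsub>?C\<^esub> ?\<tau> (frag_of (\<mu>, ?f' i))) [^]\<^bsub>?C\<^esub> ((- 1) ^ i :: int))"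
          by (rule hom_free_signed_sum[OF D.comm_group_axioms th]) (use k in auto)
        also have "\<dots> = (\<Otimes>\<^bsub>?C\<^esub>i\<in>{1..Suc m}. (?x i \<otimes>\<^bsub>?C\<^esub> inv\<^bsub>?C\<^esub> ?y i) [^]\<^bsub>?C\<^esub> ((- 1) ^ i :: int))"
        proof (rule D.finprod_cong'[OF refl])
          show "(\<lambda>i. (?x i \<otimes>\<^bsub>?C\<^esub> inv\<^bsub>?C\<^esub> ?y i) [^]\<^bsub>?C\<^esub> ((- 1) ^ i :: int)) \<in> {1..Suc m} \<rightarrow> carrier ?C"
            using xy by (intro Pi_I D.int_pow_closed D.m_closed D.inv_closed)
        qed (simp only: xy)
        also have "\<dots> = cub_boundary_gen k \<Lambda> N (int (Suc m)) \<eta> ?b"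
          by (simp add: cub_boundary_gen_def Let_def nat_add_distrib)
        also have "\<dots> = cub_boundary k \<Lambda> N (int (Suc m)) (\<Theta> (Suc m) (tens (cub_res (Suc m)) N v (frag_of g) a))"
          unfolding gg \<Theta>g[OF v g[unfolded gg] a] by (rule cub_boundary_gen[OF *(3) a', symmetric])
        finally show "\<Theta> m (tensor_induced (cub_res m) N ?d (tens (cub_res (Suc m)) N v (frag_of g) a)) =
          cub_boundary k \<Lambda> N (int (Suc m)) (\<Theta> (Suc m) (tens (cub_res (Suc m)) N v (frag_of g) a))" .
      qed
    qed
    then show ?thesis unfolding n' unfolding n \<theta>m cat_chain_simps .
  qed
  show ?thesis unfolding cub_homology_def cat_homology_def
    by (rule chain_homology_transfer[where \<theta> = \<theta> and D = "cub_chain k \<Lambda> N", OF C comm_group_cub_chain \<theta>iso com])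
qed

end

context
  fixes M :: "('l, 'b) cmodule"
  assumes M: "right_module \<Lambda> M"
begin

text \<open>
  A module map \<open>x\<close> on the cubical resolution corresponds to its values on the generators.  The value of
  \<open>x\<close> on the boundary of the generator \<open>\<eta>\<close> is the cubical coboundary at \<open>\<eta>\<close>, because \<open>x\<close> commutes with
  the action of the last edges.
\<close>

lemma cub_cohomology_iso_cat: "cub_cohomology k \<Lambda> M n \<cong> cat_cohomology \<Lambda> cub_res cub_diff M n"
proof -
  obtain \<epsilon> where R: "projective_resolution \<Lambda> cub_res cub_diff \<epsilon>" using cubical_resolution by blast
  note C = cat_cochain_complex[OF M R]
  define ev :: "nat \<Rightarrow> ('l \<Rightarrow> ('l \<times> 'l \<Rightarrow>\<^sub>0 int) \<Rightarrow> 'b) \<Rightarrow> 'l \<Rightarrow> 'b"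
    where "ev m = free_eval (cubes k \<Lambda> (int m)) (Src \<Lambda>)" for m
  have iso: "ev m \<in> iso (Hom_group \<Lambda> (cub_res m) M) (cub_cochain k \<Lambda> M (int m))" for m
    unfolding ev_def cub_res_def cub_cochain_def by (rule free_eval_iso[OF Src_cube[of _ "int m"] M])
  have ev: "ev m \<phi> \<eta> = \<phi> (Src \<Lambda> \<eta>) (frag_of (Src \<Lambda> \<eta>, \<eta>))" if "\<eta> \<in> cubes k \<Lambda> (int m)" for m \<phi> \<eta>
    using that by (simp add: ev_def free_eval_def)
  have basis: "(Src \<Lambda> \<eta>, \<eta>) \<in> cub_basis m (Src \<Lambda> \<eta>)" if "\<eta> \<in> cubes k \<Lambda> (int m)" for m \<eta>
    by (rule free_gens_id[OF Src_cube[of _ "int m"] that])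
  \<comment> \<open>In negative degrees all cochain groups are trivial; the empty product consists of \<open>\<lambda>_. undefined\<close>.\<close>
  define \<theta> where "\<theta> n = (if n < 0 then (\<lambda>_ _. undefined) else ev (nat n))" for n :: int
  have \<theta>m: "\<theta> (int m) = ev m" for m by (simp add: \<theta>_def)
  have trivial: "carrier (cub_cochain k \<Lambda> M n) = {\<lambda>_. undefined}" if "n < 0" for n
    using cubes_neg[OF that] by (simp add: cub_cochain_def)
  have cg: "comm_group (cub_cochain k \<Lambda> M n)" for n
    unfolding cub_cochain_def by (rule comm_group_product_group) (rule right_module_group[OF M Src_cube])
  have \<theta>iso: "\<theta> n \<in> iso (cat_cochain \<Lambda> cub_res M n) (cub_cochain k \<Lambda> M n)" for n
  proof (cases "n < 0")
    case True
    interpret D: comm_group "cub_cochain k \<Lambda> M n" by (rule cg)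
    have "\<one>\<^bsub>cub_cochain k \<Lambda> M n\<^esub> = (\<lambda>_. undefined)" using D.one_closed trivial[OF True] by blast
    then have "(\<lambda>_. undefined) \<otimes>\<^bsub>cub_cochain k \<Lambda> M n\<^esub> (\<lambda>_. undefined) = (\<lambda>_. undefined)"
      using D.l_one[OF D.one_closed] by simp
    then show ?thesis using True trivial[OF True]
      by (simp add: \<theta>_def cat_cochain_simps iso_def hom_def bij_betw_def)
  next
    case False
    then obtain m where n: "n = int m" using int_neg_or_nat by blast
    show ?thesis unfolding n \<theta>m cat_cochain_simps by (rule iso)
  qed
  have com: "\<theta> (n + 1) (cat_coboundary \<Lambda> cub_res cub_diff M n x) = cub_coboundary k \<Lambda> M n (\<theta> n x)"
    if x: "x \<in> carrier (cat_cochain \<Lambda> cub_res M n)" for n x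
  proof (cases "n < 0")
    case True
    have th: "\<theta> n \<in> hom (cat_cochain \<Lambda> cub_res M n) (cub_cochain k \<Lambda> M n)" for n
      using \<theta>iso[of n] by (simp add: iso_def)
    have "group (cat_cochain \<Lambda> cub_res M (n + 1))" "group (cub_cochain k \<Lambda> M (n + 1))"
      using C cg by (simp_all add: cochain_complex_def comm_group_def)
    from hom_one[OF th this] have "\<theta> (n + 1) \<one>\<^bsub>cat_cochain \<Lambda> cub_res M (n + 1)\<^esub> =
        (\<lambda>\<eta>\<in>cubes k \<Lambda> (n + 1). \<one>\<^bsub>Grp M (Src \<Lambda> \<eta>)\<^esub>)" by (simp add: cub_cochain_def)
    also have "\<dots> = cub_coboundary k \<Lambda> M n (\<theta> n x)"
      unfolding cub_coboundary_def
    proof (rule restrict_ext)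
      fix \<eta> assume "\<eta> \<in> cubes k \<Lambda> (n + 1)"
      then interpret G: comm_group "Grp M (Src \<Lambda> \<eta>)" by (intro right_module_group[OF M] Src_cube)
      have "{1..nat (n + 1)} = {}" using True by simp
      then show "\<one>\<^bsub>Grp M (Src \<Lambda> \<eta>)\<^esub> = (let G = Grp M (Src \<Lambda> \<eta>) in \<Otimes>\<^bsub>G\<^esub>i\<in>{1..nat (n + 1)}.
        (Act M (last_edge k \<Lambda> i \<eta>) (\<theta> n x (face0 k \<Lambda> i \<eta>)) \<otimes>\<^bsub>G\<^esub>
         inv\<^bsub>G\<^esub> \<theta> n x (face1 k \<Lambda> i \<eta>)) [^]\<^bsub>G\<^esub> ((-1) ^ i :: int))" by (simp only: Let_def G.finprod_empty)
    qed
    finally show ?thesis using True by (simp add: cat_cochain_simps)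
  next
    case False
    then obtain m where n: "n = int m" using int_neg_or_nat by blast
    then have n': "n + 1 = int (Suc m)" by simp
    have x: "x \<in> carrier (Hom_group \<Lambda> (cub_res m) M)" using x by (simp only: n cat_cochain_simps)
    note xm = Hom_group_carrierD[OF x]
    have "ev (Suc m) (hom_pre (cub_res (Suc m)) (cub_diff (Suc m)) x) = cub_coboundary k \<Lambda> M (int m) (ev m x)"
    proof (rule extensionalityI[of _ "cubes k \<Lambda> (int (Suc m))"])
      show "ev (Suc m) (hom_pre (cub_res (Suc m)) (cub_diff (Suc m)) x) \<in> extensional (cubes k \<Lambda> (int (Suc m)))"
        unfolding ev_def free_eval_def
        by (rule restrict_extensional)
      show "cub_coboundary k \<Lambda> M (int m) (ev m x) \<in> extensional (cubes k \<Lambda> (int (Suc m)))"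
        by (simp add: cub_coboundary_def add.commute)
      fix \<eta> assume \<eta>: "\<eta> \<in> cubes k \<Lambda> (int (Suc m))"
      let ?v = "Src \<Lambda> \<eta>" let ?G = "Grp M ?v"
      have v: "?v \<in> Obj \<Lambda>" by (rule Src_cube[OF \<eta>])
      interpret G: comm_group ?G by (rule right_module_group[OF M v])
      note k = cub_diff_keys[OF basis[OF \<eta>]]
      have xh: "x ?v \<in> hom (free_Abelian_group (cub_basis m ?v)) ?G"
        using module_map_hom[OF xm v] by (simp only: Grp_cub_res)
      have gc: "frag_of (?v, \<eta>) \<in> carrier (Grp (cub_res (Suc m)) ?v)"
        unfolding Grp_cub_res using basis[OF \<eta>] by simp
      let ?e = "\<lambda>i. last_edge k \<Lambda> i \<eta>" and ?f = "\<lambda>i. face0 k \<Lambda> i \<eta>" and ?f' = "\<lambda>i. face1 k \<Lambda> i \<eta>"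
      have face: "x ?v (frag_of (Cmp \<Lambda> (?e i) ?v, ?f i)) = Act M (?e i) (ev m x (?f i))"
        "x ?v (frag_of (?v, ?f' i)) = ev m x (?f' i)" if i: "i \<in> {1..Suc m}" for i
      proof -
        note c = cube_faces[OF \<eta> i]
        have f: "frag_of (Src \<Lambda> (?f i), ?f i) \<in> carrier (Grp (cub_res m) (Rng \<Lambda> (?e i)))"
          unfolding Grp_cub_res c(5) using basis[OF c(1)] by simp
        have "Act (cub_res m) (?e i) (frag_of (Src \<Lambda> (?f i), ?f i)) = frag_of (?e i, ?f i)"
          unfolding cub_res_def Act_free_module using Cmp_id_left[OF c(3)] c(5) by simp
        then have "x ?v (frag_of (?e i, ?f i)) = Act M (?e i) (ev m x (?f i))"
          using module_map_act[OF xm c(3) f] c(4,5) ev[OF c(1)] by simp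
        moreover have "Cmp \<Lambda> (?e i) ?v = ?e i" using Cmp_id_right[OF c(3)] c(4) by simp
        ultimately show "x ?v (frag_of (Cmp \<Lambda> (?e i) ?v, ?f i)) = Act M (?e i) (ev m x (?f i))" by simp
        show "x ?v (frag_of (?v, ?f' i)) = ev m x (?f' i)" using ev[OF c(2)] c(6) by simp
      qed
      have closed: "x ?v (frag_of (Cmp \<Lambda> (?e i) ?v, ?f i)) \<in> carrier ?G"
        "x ?v (frag_of (?v, ?f' i)) \<in> carrier ?G" if "i \<in> {1..Suc m}" for i
        using hom_in_carrier[OF xh] k[OF that] by simp_all
      have "ev (Suc m) (hom_pre (cub_res (Suc m)) (cub_diff (Suc m)) x) \<eta> = x ?v (cub_diff (Suc m) ?v (frag_of (?v, \<eta>)))"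
        unfolding ev[OF \<eta>] by (rule hom_pre_apply[OF v gc])
      also have "cub_diff (Suc m) ?v (frag_of (?v, \<eta>)) = (\<Sum>i\<in>{1..Suc m}. frag_cmul ((- 1) ^ i)
            (frag_of (Cmp \<Lambda> (?e i) ?v, ?f i) - frag_of (?v, ?f' i)))"
        unfolding cub_diff_def frag_extend_of by simp
      also have "x ?v \<dots> = (\<Otimes>\<^bsub>?G\<^esub>i\<in>{1..Suc m}. (x ?v (frag_of (Cmp \<Lambda> (?e i) ?v, ?f i)) \<otimes>\<^bsub>?G\<^esub>
          inv\<^bsub>?G\<^esub> x ?v (frag_of (?v, ?f' i))) [^]\<^bsub>?G\<^esub> ((- 1) ^ i :: int))"
        by (rule hom_free_signed_sum[OF G.comm_group_axioms xh]) (use k in auto)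
      also have "\<dots> = (\<Otimes>\<^bsub>?G\<^esub>i\<in>{1..Suc m}. (Act M (?e i) (ev m x (?f i)) \<otimes>\<^bsub>?G\<^esub>
          inv\<^bsub>?G\<^esub> ev m x (?f' i)) [^]\<^bsub>?G\<^esub> ((- 1) ^ i :: int))"
      proof (rule G.finprod_cong'[OF refl])
        show "(\<lambda>i. (Act M (?e i) (ev m x (?f i)) \<otimes>\<^bsub>?G\<^esub> inv\<^bsub>?G\<^esub> ev m x (?f' i)) [^]\<^bsub>?G\<^esub> ((- 1) ^ i :: int))
            \<in> {1..Suc m} \<rightarrow> carrier ?G"
          using closed by (intro Pi_I G.int_pow_closed G.m_closed G.inv_closed) (simp_all only: face)
      qed (simp only: face)
      also have "\<dots> = cub_coboundary k \<Lambda> M (int m) (ev m x) \<eta>"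
        using \<eta> by (simp add: cub_coboundary_def Let_def nat_add_distrib add.commute)
      finally show "ev (Suc m) (hom_pre (cub_res (Suc m)) (cub_diff (Suc m)) x) \<eta> =
        cub_coboundary k \<Lambda> M (int m) (ev m x) \<eta>" .
    qed
    then show ?thesis unfolding n' unfolding n \<theta>m cat_cochain_simps .
  qed
  show ?thesis unfolding cub_cohomology_def cat_cohomology_def
    by (rule cochain_cohomology_transfer[where \<theta> = \<theta> and D = "cub_cochain k \<Lambda> M", OF C cg \<theta>iso com])
qed

end

end

theorem theorem6p2:
  fixes k :: nat
    and \<Lambda> :: "'l kgraph"
    and N :: "('l, 'a) cmodule"
    and M :: "('l, 'b) cmodule"
    and R :: "nat \<Rightarrow> ('l, 'r) cmodule"
    and d :: "nat \<Rightarrow> 'l \<Rightarrow> 'r \<Rightarrow> 'r"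
    and \<epsilon> :: "'l \<Rightarrow> 'r \<Rightarrow> int"
    and n :: int
  assumes "k_graph k \<Lambda>"
    and "left_module \<Lambda> N"
    and "right_module \<Lambda> M"
    and "projective_resolution \<Lambda> R d \<epsilon>"
  shows "cub_homology k \<Lambda> N n \<cong> cat_homology \<Lambda> R d N n \<and>
         cub_cohomology k \<Lambda> M n \<cong> cat_cohomology \<Lambda> R d M n"
proof -
  interpret k_graph k \<Lambda> by fact
  obtain \<epsilon>' where P: "projective_resolution \<Lambda> cub_res cub_diff \<epsilon>'" using cubical_resolution by blast
  show ?thesis
    using iso_trans[OF cub_homology_iso_cat[OF assms(2)] cat_homology_unique[OF assms(2) P assms(4)]]
      iso_trans[OF cub_cohomology_iso_cat[OF assms(3)] cat_cohomology_unique[OF assms(3) P assms(4)]]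
    by blast
qed

end
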